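(* Let $N\ge2$, $\sigma_{1+1}=\ln(1+E_{1+1})$, and let $$\mathcal F_{\mathcal E_1}=\Bigl(\prod_{i=2}^{N}\exp\bigl\{E_{1-i}\otimes E_{1+i}\,e^{-\frac12\sigma_{1+1}}\bigr\}\Bigr)\exp\{H_{11}\otimes\sigma_{1+1}\}$$ (factors with larger $i$ to the left) be the full extended jordanian twist for $U(\mathfrak{sp}(N))$ with initial root $2e_1$. Let $\Delta_{\mathcal E_1}(a)=\mathcal F_{\mathcal E_1}\Delta(a)\mathcal F_{\mathcal E_1}^{-1}$ be the coproduct of the twisted Hopf algebra $U_{\mathcal E_1}(\mathfrak{sp}(N))$, where $\Delta$ is the primitive coproduct of $U(\mathfrak{sp}(N))$. For $2\le i<j\le N$ in the formulas with two indices and $2\le i\le N$ in those with one, put $$E'_{i+i}=E_{i+i}-E_{1+i}^2e^{-\sigma_{1+1}},\quad F'_{i+i}=F_{i+i}-E_{1-i}^2,\quad E'_{i+j}=E_{i+j}-E_{1+i}E_{1+j}e^{-\sigma_{1+1}},\quad F'_{i+j}=F_{i+j}-E_{1-i}E_{1-j},$$ $$E'_{i-j}=E_{i-j},\qquad F'_{i-j}=F_{i-j},\qquad H'_{ii}=H_{ii}.$$ Then every one of these elements $X'$ is primitive in $U_{\mathcal E_1}(\mathfrak{sp}(N))$, i.e. $\Delta_{\mathcal E_1}(X')=X'\otimes1+1\otimes X'$, and the elements $X'$ form a basis of a Lie algebra $\mathfrak{sp}'(N-1)$ (under the commutator) isomorphic to $\mathfrak{sp}(N-1)$.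
   Context: All algebras are over $\mathbb C$. $\mathfrak{sp}(N)$ denotes the symplectic Lie algebra of rank $N$ (type $C_N$), with roots $\pm e_i\pm e_j$ ($i\neq j$), $\pm2e_i$. For $i<j$, $E_{i\pm j}$ and $F_{i\pm j}$ are the generators for the roots $e_i\pm e_j$ and $-(e_i\pm e_j)$; $E_{i+i}$, $F_{i+i}$ those for $2e_i$, $-2e_i$; $H_{ii}$ is the Cartan generator dual to $2e_i$. The normalization, in $2N\times2N$ matrix units $e_{ab}$, is: $E_{i-j}=e_{ij}-e_{N+j,N+i}$, $E_{i+j}=e_{i,N+j}+e_{j,N+i}$, $F_{i-j}=e_{ji}-e_{N+i,N+j}$, $F_{i+j}=e_{N+i,j}+e_{N+j,i}$ (the formulas for $E_{i+j},F_{i+j}$ also for $i=j$), $H_{ii}=\frac12(e_{ii}-e_{N+i,N+i})$. In particular $[H_{ii},E_{n+n}]=\delta_{in}E_{n+n}$, $[H_{ii},E_{n\pm m}]=\frac12(\delta_{in}\pm\delta_{im})E_{n\pm m}$, $[E_{i-j},E_{n+n}]=2\delta_{jn}E_{i+n}$, $[E_{i-j},E_{n-m}]=\delta_{jn}E_{i-m}-\delta_{mi}E_{n-j}$, $[E_{i-j},E_{n+m}]=\delta_{jn}E_{i+m}+\delta_{jm}E_{i+n}$. (Products like $E_{1+i}^2$ are taken in the universal enveloping algebra, not as matrix products.) Formal interpretation of infinite series: the symbols $E_{i+j}$ and $F_{i+j}$ ($i\le j$) in all formulas are understood as $\xi$, respectively $\xi^{-1}$, times the corresponding Lie algebra elements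 ($\xi$ a formal parameter), the $E_{i-j},F_{i-j},H_{ii}$ being unscaled; this preserves all commutation relations. All expressions then lie in $U(\mathfrak{sp}(N))[[\xi]][\xi^{-1}]$ or in $(U(\mathfrak{sp}(N))\otimes U(\mathfrak{sp}(N)))[[\xi]][\xi^{-1}]$. The primitive coproduct is $\Delta(x)=x\otimes1+1\otimes x$ for $x\in\mathfrak{sp}(N)$. *)

theory Defs
  imports
    "Jordan_Normal_Form.Matrix"
    "HOL-Library.Poly_Mapping"
    "HOL-Library.Cardinality"
    "HOL-Computational_Algebra.Formal_Laurent_Series"
begin

section \<open>Complex vector spaces, associative algebras and Lie algebras\<close>

class complex_vector = ab_group_add +
  fixes cscale :: "complex \<Rightarrow> 'a \<Rightarrow> 'a"  (infixr \<open>*\<^sub>C\<close> 75)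
  assumes cscale_add_right: "c *\<^sub>C (x + y) = c *\<^sub>C x + c *\<^sub>C y"
    and cscale_add_left: "(c + d) *\<^sub>C x = c *\<^sub>C x + d *\<^sub>C x"
    and cscale_cscale: "c *\<^sub>C d *\<^sub>C x = (c * d) *\<^sub>C x"
    and cscale_one: "1 *\<^sub>C x = x"

global_interpretation complex_vector:
  vector_space "cscale :: complex \<Rightarrow> 'a \<Rightarrow> 'a::complex_vector"
  by unfold_locales (simp_all add: cscale_add_right cscale_add_left cscale_cscale cscale_one)

global_interpretation complex_vector:
  vector_space_pair "cscale :: complex \<Rightarrow> 'a \<Rightarrow> 'a::complex_vector"
    "cscale :: complex \<Rightarrow> 'b \<Rightarrow> 'b::complex_vector"
  by unfold_locales

class complex_algebra_1 = complex_vector + ring_1 +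
  assumes cscale_mult_left: "(c *\<^sub>C x) * y = c *\<^sub>C (x * y)"
    and cscale_mult_right: "x * (c *\<^sub>C y) = c *\<^sub>C (x * y)"

class complex_lie_algebra = complex_vector +
  fixes lie :: "'a \<Rightarrow> 'a \<Rightarrow> 'a"
  assumes lie_add_left: "lie (x + y) z = lie x z + lie y z"
    and lie_add_right: "lie x (y + z) = lie x y + lie x z"
    and lie_scale_left: "lie (c *\<^sub>C x) y = c *\<^sub>C lie x y"
    and lie_scale_right: "lie x (c *\<^sub>C y) = c *\<^sub>C lie x y"
    and lie_self: "lie x x = 0"
    and jacobi: "lie x (lie y z) + lie y (lie z x) + lie z (lie x y) = 0"

instantiation complex :: complex_algebra_1
begin
definition cscale_complex :: "complex \<Rightarrow> complex \<Rightarrow> complex" where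
  "cscale_complex c x = c * x"
instance
  by intro_classes (simp_all add: cscale_complex_def algebra_simps)
end

definition lin_ext :: "('k \<Rightarrow> 'v) \<Rightarrow> ('k \<Rightarrow>\<^sub>0 complex) \<Rightarrow> 'v::complex_vector" where
  "lin_ext f p = (\<Sum>k\<in>Poly_Mapping.keys p. Poly_Mapping.lookup p k *\<^sub>C f k)"

lemma lin_ext_add: "lin_ext f (p + q) = lin_ext f p + lin_ext f q"
  unfolding lin_ext_def
  by (rule setsum_keys_plus_distrib) (simp_all add: cscale_add_left)

lemma lin_ext_single: "lin_ext f (Poly_Mapping.single k c) = c *\<^sub>C f k"
  by (cases "c = 0") (simp_all add: lin_ext_def)

lemma lin_ext_zero [simp]: "lin_ext f 0 = 0"
  by (simp add: lin_ext_def)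

lemma lin_ext_diff: "lin_ext f (p - q) = lin_ext f p - lin_ext f q"
  using lin_ext_add[of f "p - q" q] by simp

lemma poly_mapping_sum_induct [case_names single add]:
  fixes p :: "'k \<Rightarrow>\<^sub>0 complex"
  assumes "\<And>k c. P (Poly_Mapping.single k c)"
    and "\<And>p q. P p \<Longrightarrow> P q \<Longrightarrow> P (p + q)"
  shows "P p"
proof (induction p rule: update_induct)
  case const
  show ?case using assms(1)[of undefined 0] by simp
next
  case (update f a b)
  have "Poly_Mapping.update a b f = Poly_Mapping.single a b + f"
    using update(1)
    by (intro poly_mapping_eqI)
       (auto simp: lookup_update lookup_add lookup_single in_keys_iff when_def)
  then show ?case using assms update by simp
qed

lemma lin_ext_mult:
  fixes f :: "'k::monoid_add \<Rightarrow> 'v::complex_algebra_1"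
  assumes "\<And>k l. f (k + l) = f k * f l"
  shows "lin_ext f (p * q) = lin_ext f p * lin_ext f q"
proof (induction p rule: poly_mapping_sum_induct)
  case (single k c)
  show ?case
  proof (induction q rule: poly_mapping_sum_induct)
    case (single l d)
    show ?case
      by (simp add: mult_single lin_ext_single assms cscale_mult_left cscale_mult_right
          cscale_cscale)
  qed (simp add: lin_ext_add algebra_simps)
qed (simp add: lin_ext_add algebra_simps)

section \<open>The universal enveloping algebra\<close>

datatype 'g gword = GWord (letters: "'g list")

instantiation gword :: (type) monoid_add
begin
definition zero_gword :: "'a gword" where "zero_gword = GWord []"
definition plus_gword :: "'a gword \<Rightarrow> 'a gword \<Rightarrow> 'a gword" where
  "plus_gword u v = GWord (letters u @ letters v)"
instance
  by intro_classes (simp_all add: zero_gword_def plus_gword_def)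
end

lemma letters_simps [simp]: "letters 0 = []" "letters (u + v) = letters u @ letters v"
  by (simp_all add: zero_gword_def plus_gword_def)

text \<open>The ring \<open>'g gword \<Rightarrow>\<^sub>0 complex\<close> is the free associative unital algebra on the set \<open>'g\<close>.\<close>

definition letter :: "'g \<Rightarrow> ('g gword \<Rightarrow>\<^sub>0 complex)" where
  "letter x = Poly_Mapping.single (GWord [x]) 1"

inductive_set ideal_gen :: "'a::ring_1 set \<Rightarrow> 'a set" for R where
  zero: "0 \<in> ideal_gen R"
| gen: "r \<in> R \<Longrightarrow> a * r * b \<in> ideal_gen R"
| add: "x \<in> ideal_gen R \<Longrightarrow> y \<in> ideal_gen R \<Longrightarrow> x + y \<in> ideal_gen R"

text \<open>The first two families make \<open>letter\<close> linear, so that the quotient by them alone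
  is the tensor algebra of \<open>'g\<close>.\<close>

definition uea_relators :: "('g::complex_lie_algebra gword \<Rightarrow>\<^sub>0 complex) set" where
  "uea_relators =
     {letter (x + y) - letter x - letter y | x y. True} \<union>
     {letter (c *\<^sub>C x) - Poly_Mapping.single 0 c * letter x | c x. True} \<union>
     {letter x * letter y - letter y * letter x - letter (lie x y) | x y. True}"

definition uea_rel ::
  "('g::complex_lie_algebra gword \<Rightarrow>\<^sub>0 complex) \<Rightarrow> ('g gword \<Rightarrow>\<^sub>0 complex) \<Rightarrow> bool" where
  "uea_rel p q \<longleftrightarrow> p - q \<in> ideal_gen uea_relators"

lemma ideal_gen_mult_left: "x \<in> ideal_gen R \<Longrightarrow> a * x \<in> ideal_gen R"
proof (induction rule: ideal_gen.induct)
  case (gen r b c)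
  then show ?case using ideal_gen.gen[of r R "a * b" c] by (simp add: mult.assoc)
qed (auto intro: ideal_gen.intros simp: distrib_left)

lemma ideal_gen_mult_right: "x \<in> ideal_gen R \<Longrightarrow> x * a \<in> ideal_gen R"
proof (induction rule: ideal_gen.induct)
  case (gen r b c)
  then show ?case using ideal_gen.gen[of r R b "c * a"] by (simp add: mult.assoc)
qed (auto intro: ideal_gen.intros simp: distrib_right)

lemma ideal_gen_uminus: "x \<in> ideal_gen R \<Longrightarrow> - x \<in> ideal_gen R"
  using ideal_gen_mult_left[of x R "- 1"] by simp

lemma ideal_gen_base: "r \<in> R \<Longrightarrow> r \<in> ideal_gen R"
  using ideal_gen.gen[of r R 1 1] by simp

lemma equivp_uea_rel: "equivp uea_rel"
proof (rule equivpI)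
  show "reflp uea_rel" by (rule reflpI) (simp add: uea_rel_def ideal_gen.zero)
  show "symp uea_rel"
    by (rule sympI) (metis ideal_gen_uminus minus_diff_eq uea_rel_def)
  show "transp uea_rel"
  proof (rule transpI)
    fix x y z assume "uea_rel x y" "uea_rel y z"
    then have "(x - y) + (y - z) \<in> ideal_gen uea_relators"
      unfolding uea_rel_def by (rule ideal_gen.add)
    then show "uea_rel x z" by (simp add: uea_rel_def)
  qed
qed

text \<open>A linear map \<open>f\<close> with \<open>f (lie x y) = f x * f y - f y * f x\<close> extends to an algebra
  homomorphism on the enveloping algebra.\<close>

definition free_ext :: "('g \<Rightarrow> 'a) \<Rightarrow> ('g gword \<Rightarrow>\<^sub>0 complex) \<Rightarrow> 'a::complex_algebra_1" where
  "free_ext f = lin_ext (\<lambda>w. prod_list (map f (letters w)))"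

lemma free_ext_simps:
  "free_ext f (p + q) = free_ext f p + free_ext f q"
  "free_ext f (p - q) = free_ext f p - free_ext f q"
  "free_ext f (p * q) = free_ext f p * free_ext f q"
  "free_ext f 0 = 0"
  "free_ext f 1 = 1"
  "free_ext f (letter x) = f x"
  "free_ext f (Poly_Mapping.single 0 c) = c *\<^sub>C 1"
  by (simp_all add: free_ext_def lin_ext_add lin_ext_diff lin_ext_mult letter_def lin_ext_single
      cscale_one flip: single_one)

lemma free_ext_uea_rel:
  assumes "uea_rel p q"
    and add: "\<And>x y. f (x + y) = f x + f y"
    and scale: "\<And>c x. f (c *\<^sub>C x) = c *\<^sub>C f x"
    and lie: "\<And>x y. f (lie x y) = f x * f y - f y * f x"
  shows "free_ext f p = free_ext f q"
proof -
  have "free_ext f z = 0" if "z \<in> ideal_gen uea_relators" for z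
    using that
  proof (induction rule: ideal_gen.induct)
    case (gen r a b)
    then have "free_ext f r = 0"
      by (auto simp: uea_relators_def free_ext_simps add scale lie cscale_mult_left)
    then show ?case by (simp add: free_ext_simps)
  qed (simp_all add: free_ext_simps)
  from this[of "p - q"] show ?thesis
    using assms(1) by (simp add: uea_rel_def free_ext_simps)
qed

quotient_type (overloaded) 'g uea = "'g::complex_lie_algebra gword \<Rightarrow>\<^sub>0 complex" / uea_rel
  by (rule equivp_uea_rel)

instantiation uea :: (complex_lie_algebra) complex_algebra_1
begin

lift_definition zero_uea :: "'a uea" is 0 .
lift_definition one_uea :: "'a uea" is 1 .
lift_definition plus_uea :: "'a uea \<Rightarrow> 'a uea \<Rightarrow> 'a uea" is "(+)"
  unfolding uea_rel_def by (metis add_diff_add ideal_gen.add)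
lift_definition uminus_uea :: "'a uea \<Rightarrow> 'a uea" is uminus
  unfolding uea_rel_def by (metis ideal_gen_uminus minus_diff_commute minus_diff_eq
      uminus_add_conv_diff add.commute diff_minus_eq_add)
lift_definition minus_uea :: "'a uea \<Rightarrow> 'a uea \<Rightarrow> 'a uea" is "(-)"
proof -
  fix a b c d :: "'a gword \<Rightarrow>\<^sub>0 complex"
  assume "uea_rel a b" "uea_rel c d"
  then have "(a - b) + - (c - d) \<in> ideal_gen uea_relators"
    unfolding uea_rel_def by (intro ideal_gen.add ideal_gen_uminus)
  then show "uea_rel (a - c) (b - d)" by (simp add: uea_rel_def algebra_simps)
qed
lift_definition times_uea :: "'a uea \<Rightarrow> 'a uea \<Rightarrow> 'a uea" is "(*)"
proof -
  fix a b c d :: "'a gword \<Rightarrow>\<^sub>0 complex"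
  assume "uea_rel a b" "uea_rel c d"
  then have "(a - b) * c + b * (c - d) \<in> ideal_gen uea_relators"
    unfolding uea_rel_def
    by (intro ideal_gen.add ideal_gen_mult_left ideal_gen_mult_right)
  then show "uea_rel (a * c) (b * d)" by (simp add: uea_rel_def algebra_simps)
qed
lift_definition cscale_uea :: "complex \<Rightarrow> 'a uea \<Rightarrow> 'a uea" is
  "\<lambda>c p. Poly_Mapping.single 0 c * p"
  unfolding uea_rel_def by (metis ideal_gen_mult_left right_diff_distrib)

instance
proof
  fix a b c :: "'a uea" and s t :: complex
  note refl = equivp_reflp[OF equivp_uea_rel]
  have central: "p * Poly_Mapping.single 0 s = Poly_Mapping.single 0 s * p"
    for s and p :: "'a gword \<Rightarrow>\<^sub>0 complex"
    by (induction p rule: poly_mapping_sum_induct)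
       (simp_all add: mult_single algebra_simps)
  show "a + b + c = a + (b + c)" by transfer (simp add: refl add.assoc)
  show "a + b = b + a" by transfer (simp add: refl add.commute)
  show "0 + a = a" by transfer (simp add: refl)
  show "- a + a = 0" by transfer (simp add: refl)
  show "a - b = a + - b" by transfer (simp add: refl)
  show "a * b * c = a * (b * c)" by transfer (simp add: refl mult.assoc)
  show "1 * a = a" by transfer (simp add: refl)
  show "a * 1 = a" by transfer (simp add: refl)
  show "(a + b) * c = a * c + b * c" by transfer (simp add: refl distrib_right)
  show "a * (b + c) = a * b + a * c" by transfer (simp add: refl distrib_left)
  show "s *\<^sub>C (a + b) = s *\<^sub>C a + s *\<^sub>C b" by transfer (simp add: refl distrib_left)
  show "(s + t) *\<^sub>C a = s *\<^sub>C a + t *\<^sub>C a"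
    by transfer (simp add: refl single_add distrib_right)
  show "s *\<^sub>C t *\<^sub>C a = (s * t) *\<^sub>C a"
    by transfer (simp add: refl mult_single flip: mult.assoc)
  show "1 *\<^sub>C a = a" by transfer (simp add: refl)
  show "(s *\<^sub>C a) * b = s *\<^sub>C (a * b)" by transfer (simp add: refl mult.assoc)
  show "a * (s *\<^sub>C b) = s *\<^sub>C (a * b)"
    by transfer (simp add: refl central flip: mult.assoc)
  show "(0 :: 'a uea) \<noteq> 1"
  proof transfer
    show "\<not> uea_rel (0 :: 'a gword \<Rightarrow>\<^sub>0 complex) 1"
      using free_ext_uea_rel[where f = "\<lambda>x::'a. 0 :: complex" and p = 0 and q = 1]
      by (auto simp: free_ext_simps)
  qed
qed

end

lift_definition uea_in :: "'g::complex_lie_algebra \<Rightarrow> 'g uea" is letter .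

section \<open>The tensor product of two algebras\<close>

datatype ('a, 'b) pair_basis = Pair_basis 'a 'b

instantiation pair_basis :: (monoid_mult, monoid_mult) monoid_add
begin
definition zero_pair_basis :: "('a, 'b) pair_basis" where "zero_pair_basis = Pair_basis 1 1"
fun plus_pair_basis ::
  "('a, 'b) pair_basis \<Rightarrow> ('a, 'b) pair_basis \<Rightarrow> ('a, 'b) pair_basis" where
  "plus_pair_basis (Pair_basis a b) (Pair_basis a' b') = Pair_basis (a * a') (b * b')"
instance
proof
  fix u v w :: "('a, 'b) pair_basis"
  show "u + v + w = u + (v + w)" by (cases u; cases v; cases w) (simp add: mult.assoc)
  show "0 + u = u" by (cases u) (simp add: zero_pair_basis_def)
  show "u + 0 = u" by (cases u) (simp add: zero_pair_basis_def)
qed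
end

text \<open>The free vector space on the pairs \<open>(a, b)\<close> carries the product
  \<open>(a, b) (a', b') = (a a', b b')\<close>. The tensor product is its quotient by the subspace spanned by
  the bilinearity relators.\<close>

abbreviation free_pair :: "'a \<Rightarrow> 'b \<Rightarrow> complex \<Rightarrow> (('a, 'b) pair_basis \<Rightarrow>\<^sub>0 complex)" where
  "free_pair a b t \<equiv> Poly_Mapping.single (Pair_basis a b) t"

inductive_set tensor_null ::
  "(('a::complex_algebra_1, 'b::complex_algebra_1) pair_basis \<Rightarrow>\<^sub>0 complex) set" where
  zero: "0 \<in> tensor_null"
| add: "x \<in> tensor_null \<Longrightarrow> y \<in> tensor_null \<Longrightarrow> x + y \<in> tensor_null"
| add_left: "free_pair (a + a') b t - free_pair a b t - free_pair a' b t \<in> tensor_null"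
| add_right: "free_pair a (b + b') t - free_pair a b t - free_pair a b' t \<in> tensor_null"
| scale_left: "free_pair (c *\<^sub>C a) b t - free_pair a b (c * t) \<in> tensor_null"
| scale_right: "free_pair a (c *\<^sub>C b) t - free_pair a b (c * t) \<in> tensor_null"

definition tensor_rel ::
  "(('a::complex_algebra_1, 'b::complex_algebra_1) pair_basis \<Rightarrow>\<^sub>0 complex) \<Rightarrow>
   (('a, 'b) pair_basis \<Rightarrow>\<^sub>0 complex) \<Rightarrow> bool" where
  "tensor_rel p q \<longleftrightarrow> p - q \<in> tensor_null"

lemma tensor_null_mult_left: "x \<in> tensor_null \<Longrightarrow> p * x \<in> tensor_null"
proof (induction p rule: poly_mapping_sum_induct)
  case (single k s)
  obtain u v where k: "k = Pair_basis u v" by (cases k)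
  from single show ?case
  proof (induction rule: tensor_null.induct)
    case (add_left a a' b t)
    show ?case using tensor_null.add_left[of "u * a" "u * a'" "v * b" "s * t"]
      by (simp add: k mult_single right_diff_distrib distrib_left)
  next
    case (add_right a b b' t)
    show ?case using tensor_null.add_right[of "u * a" "v * b" "v * b'" "s * t"]
      by (simp add: k mult_single right_diff_distrib distrib_left)
  next
    case (scale_left c a b t)
    show ?case using tensor_null.scale_left[of c "u * a" "v * b" "s * t"]
      by (simp add: k mult_single right_diff_distrib cscale_mult_right mult.left_commute)
  next
    case (scale_right a c b t)
    show ?case using tensor_null.scale_right[of "u * a" c "v * b" "s * t"]
      by (simp add: k mult_single right_diff_distrib cscale_mult_right mult.left_commute)
  qed (simp_all add: tensor_null.zero tensor_null.add distrib_left)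
qed (simp add: distrib_right tensor_null.add)

lemma tensor_null_mult_right: "x \<in> tensor_null \<Longrightarrow> x * p \<in> tensor_null"
proof (induction p rule: poly_mapping_sum_induct)
  case (single k s)
  obtain u v where k: "k = Pair_basis u v" by (cases k)
  from single show ?case
  proof (induction rule: tensor_null.induct)
    case (add_left a a' b t)
    show ?case using tensor_null.add_left[of "a * u" "a' * u" "b * v" "t * s"]
      by (simp add: k mult_single left_diff_distrib distrib_right)
  next
    case (add_right a b b' t)
    show ?case using tensor_null.add_right[of "a * u" "b * v" "b' * v" "t * s"]
      by (simp add: k mult_single left_diff_distrib distrib_right)
  next
    case (scale_left c a b t)
    show ?case using tensor_null.scale_left[of c "a * u" "b * v" "t * s"]
      by (simp add: k mult_single left_diff_distrib cscale_mult_left mult.assoc)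
  next
    case (scale_right a c b t)
    show ?case using tensor_null.scale_right[of "a * u" c "b * v" "t * s"]
      by (simp add: k mult_single left_diff_distrib cscale_mult_left mult.assoc)
  qed (simp_all add: tensor_null.zero tensor_null.add distrib_right)
qed (simp add: distrib_left tensor_null.add)

lemma tensor_null_uminus: "x \<in> tensor_null \<Longrightarrow> - x \<in> tensor_null"
  using tensor_null_mult_left[of x "- 1"] by simp

lemma equivp_tensor_rel: "equivp tensor_rel"
proof (rule equivpI)
  show "reflp tensor_rel" by (rule reflpI) (simp add: tensor_rel_def tensor_null.zero)
  show "symp tensor_rel"
    by (rule sympI) (metis tensor_null_uminus minus_diff_eq tensor_rel_def)
  show "transp tensor_rel"
  proof (rule transpI)
    fix x y z assume "tensor_rel x y" "tensor_rel y z"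
    then have "(x - y) + (y - z) \<in> tensor_null"
      unfolding tensor_rel_def by (rule tensor_null.add)
    then show "tensor_rel x z" by (simp add: tensor_rel_def)
  qed
qed

lemma one_not_tensor_null:
  "(1 :: ('a::complex_algebra_1, 'b::complex_algebra_1) pair_basis \<Rightarrow>\<^sub>0 complex) \<notin> tensor_null"
proof
  have ex: "\<exists>f :: 'c::complex_algebra_1 \<Rightarrow> complex. Vector_Spaces.linear cscale cscale f \<and> f 1 = 1"
  proof -
    have "complex_vector.independent {1 :: 'c}"
      by (simp add: complex_vector.dependent_single)
    from complex_vector.linear_independent_extend[OF this, of "\<lambda>_. 1 :: complex"]
    show ?thesis by auto
  qed
  obtain f :: "'a \<Rightarrow> complex" where f: "Vector_Spaces.linear cscale cscale f" "f 1 = 1"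
    using ex by blast
  obtain g :: "'b \<Rightarrow> complex" where g: "Vector_Spaces.linear cscale cscale g" "g 1 = 1"
    using ex by blast
  note lin = complex_vector.linear_add[OF f(1)] complex_vector.linear_add[OF g(1)]
    complex_vector.linear_scale[OF f(1)] complex_vector.linear_scale[OF g(1)]
  define h where "h = lin_ext (\<lambda>k. case k of Pair_basis a b \<Rightarrow> f a * g b)"
  have h0: "h x = 0" if "x \<in> tensor_null" for x
    using that
    by (induction rule: tensor_null.induct)
       (simp_all add: h_def lin_ext_add lin_ext_diff lin_ext_single lin cscale_complex_def
          algebra_simps)
  assume "(1 :: ('a, 'b) pair_basis \<Rightarrow>\<^sub>0 complex) \<in> tensor_null"
  then have "h 1 = 0" by (rule h0)
  moreover have "h 1 = 1"
    unfolding h_def single_one[symmetric] lin_ext_single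
    by (simp add: zero_pair_basis_def f g cscale_one)
  ultimately show False by simp
qed

quotient_type (overloaded) ('a, 'b) tensor =
  "('a::complex_algebra_1, 'b::complex_algebra_1) pair_basis \<Rightarrow>\<^sub>0 complex" / tensor_rel
  by (rule equivp_tensor_rel)

instantiation tensor :: (complex_algebra_1, complex_algebra_1) complex_algebra_1
begin

lift_definition zero_tensor :: "('a, 'b) tensor" is 0 .
lift_definition one_tensor :: "('a, 'b) tensor" is 1 .
lift_definition plus_tensor :: "('a, 'b) tensor \<Rightarrow> ('a, 'b) tensor \<Rightarrow> ('a, 'b) tensor" is "(+)"
  unfolding tensor_rel_def by (metis add_diff_add tensor_null.add)
lift_definition uminus_tensor :: "('a, 'b) tensor \<Rightarrow> ('a, 'b) tensor" is uminus
  unfolding tensor_rel_def by (metis tensor_null_uminus minus_diff_commute minus_diff_eq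
      uminus_add_conv_diff add.commute diff_minus_eq_add)
lift_definition minus_tensor :: "('a, 'b) tensor \<Rightarrow> ('a, 'b) tensor \<Rightarrow> ('a, 'b) tensor" is "(-)"
proof -
  fix a b c d :: "('a, 'b) pair_basis \<Rightarrow>\<^sub>0 complex"
  assume "tensor_rel a b" "tensor_rel c d"
  then have "(a - b) + - (c - d) \<in> tensor_null"
    unfolding tensor_rel_def by (intro tensor_null.add tensor_null_uminus)
  then show "tensor_rel (a - c) (b - d)" by (simp add: tensor_rel_def algebra_simps)
qed
lift_definition times_tensor :: "('a, 'b) tensor \<Rightarrow> ('a, 'b) tensor \<Rightarrow> ('a, 'b) tensor" is "(*)"
proof -
  fix a b c d :: "('a, 'b) pair_basis \<Rightarrow>\<^sub>0 complex"
  assume "tensor_rel a b" "tensor_rel c d"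
  then have "(a - b) * c + b * (c - d) \<in> tensor_null"
    unfolding tensor_rel_def
    by (intro tensor_null.add tensor_null_mult_left tensor_null_mult_right)
  then show "tensor_rel (a * c) (b * d)" by (simp add: tensor_rel_def algebra_simps)
qed
lift_definition cscale_tensor :: "complex \<Rightarrow> ('a, 'b) tensor \<Rightarrow> ('a, 'b) tensor" is
  "\<lambda>c p. Poly_Mapping.single 0 c * p"
  unfolding tensor_rel_def by (metis tensor_null_mult_left right_diff_distrib)

instance
proof
  fix a b c :: "('a, 'b) tensor" and s t :: complex
  note refl = equivp_reflp[OF equivp_tensor_rel]
  have central: "p * Poly_Mapping.single 0 s = Poly_Mapping.single 0 s * p"
    for s and p :: "('a, 'b) pair_basis \<Rightarrow>\<^sub>0 complex"
    by (induction p rule: poly_mapping_sum_induct)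
       (simp_all add: mult_single algebra_simps)
  show "a + b + c = a + (b + c)" by transfer (simp add: refl add.assoc)
  show "a + b = b + a" by transfer (simp add: refl add.commute)
  show "0 + a = a" by transfer (simp add: refl)
  show "- a + a = 0" by transfer (simp add: refl)
  show "a - b = a + - b" by transfer (simp add: refl)
  show "a * b * c = a * (b * c)" by transfer (simp add: refl mult.assoc)
  show "1 * a = a" by transfer (simp add: refl)
  show "a * 1 = a" by transfer (simp add: refl)
  show "(a + b) * c = a * c + b * c" by transfer (simp add: refl distrib_right)
  show "a * (b + c) = a * b + a * c" by transfer (simp add: refl distrib_left)
  show "s *\<^sub>C (a + b) = s *\<^sub>C a + s *\<^sub>C b" by transfer (simp add: refl distrib_left)
  show "(s + t) *\<^sub>C a = s *\<^sub>C a + t *\<^sub>C a"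
    by transfer (simp add: refl single_add distrib_right)
  show "s *\<^sub>C t *\<^sub>C a = (s * t) *\<^sub>C a"
    by transfer (simp add: refl mult_single flip: mult.assoc)
  show "1 *\<^sub>C a = a" by transfer (simp add: refl)
  show "(s *\<^sub>C a) * b = s *\<^sub>C (a * b)" by transfer (simp add: refl mult.assoc)
  show "a * (s *\<^sub>C b) = s *\<^sub>C (a * b)"
    by transfer (simp add: refl central flip: mult.assoc)
  show "(0 :: ('a, 'b) tensor) \<noteq> 1"
  proof transfer
    show "\<not> tensor_rel (0 :: ('a, 'b) pair_basis \<Rightarrow>\<^sub>0 complex) 1"
      using tensor_null_uminus one_not_tensor_null unfolding tensor_rel_def
      by (metis diff_0 minus_minus)
  qed
qed

end

lift_definition pure_tensor ::
  "'a::complex_algebra_1 \<Rightarrow> 'b::complex_algebra_1 \<Rightarrow> ('a, 'b) tensor" is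
  "\<lambda>a b. free_pair a b 1" .

lemma pure_tensor_add_left: "pure_tensor (a + a') b = pure_tensor a b + pure_tensor a' b"
  by transfer (simp add: tensor_rel_def tensor_null.add_left flip: diff_diff_eq)

lemma pure_tensor_add_right: "pure_tensor a (b + b') = pure_tensor a b + pure_tensor a b'"
  by transfer (simp add: tensor_rel_def tensor_null.add_right flip: diff_diff_eq)

lemma pure_tensor_scale_left: "pure_tensor (c *\<^sub>C a) b = c *\<^sub>C pure_tensor a b"
  by transfer (use tensor_null.scale_left[where t = 1] in
      \<open>simp add: tensor_rel_def mult_single\<close>)

lemma pure_tensor_scale_right: "pure_tensor a (c *\<^sub>C b) = c *\<^sub>C pure_tensor a b"
  by transfer (use tensor_null.scale_right[where t = 1] in
      \<open>simp add: tensor_rel_def mult_single\<close>)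

lemma pure_tensor_mult: "pure_tensor a b * pure_tensor a' b' = pure_tensor (a * a') (b * b')"
  by transfer (simp add: mult_single equivp_reflp[OF equivp_tensor_rel])

lemma pure_tensor_one: "pure_tensor 1 1 = 1"
  by transfer (simp add: equivp_reflp[OF equivp_tensor_rel] flip: zero_pair_basis_def)

section \<open>The primitive coproduct\<close>

lemma uea_in_add: "uea_in (x + y) = uea_in x + uea_in y"
  by transfer
     (auto simp: uea_rel_def uea_relators_def diff_diff_eq[symmetric] intro!: ideal_gen_base)

lemma uea_in_scale: "uea_in (c *\<^sub>C x) = c *\<^sub>C uea_in x"
  by transfer (auto simp: uea_rel_def uea_relators_def intro!: ideal_gen_base)

lemma uea_in_lie: "uea_in (lie x y) = uea_in x * uea_in y - uea_in y * uea_in x"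
proof -
  have "uea_in x * uea_in y - uea_in y * uea_in x = uea_in (lie x y)"
    by transfer (auto simp: uea_rel_def uea_relators_def intro!: ideal_gen_base)
  then show ?thesis by simp
qed

definition prim :: "'g::complex_lie_algebra \<Rightarrow> ('g uea, 'g uea) tensor" where
  "prim x = pure_tensor (uea_in x) 1 + pure_tensor 1 (uea_in x)"

lemma prim_lie: "prim (lie x y) = prim x * prim y - prim y * prim x"
proof -
  have minus_left: "pure_tensor (a - a') b = pure_tensor a b - pure_tensor a' b"
    for a a' b :: "'a uea"
    using pure_tensor_add_left[of "a - a'" a' b] by simp
  have minus_right: "pure_tensor b (a - a') = pure_tensor b a - pure_tensor b a'"
    for a a' b :: "'a uea"
    using pure_tensor_add_right[of b "a - a'" a'] by simp
  show ?thesis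
    by (simp add: prim_def uea_in_lie minus_left minus_right distrib_left distrib_right
        pure_tensor_mult)
qed

lift_definition coproduct :: "'g::complex_lie_algebra uea \<Rightarrow> ('g uea, 'g uea) tensor" is
  "free_ext prim"
  by (erule free_ext_uea_rel)
     (simp_all add: prim_lie, simp_all add: prim_def uea_in_add uea_in_scale pure_tensor_add_left
        pure_tensor_add_right pure_tensor_scale_left pure_tensor_scale_right cscale_add_right)

lemma coproduct_hom:
  fixes a b :: "'g::complex_lie_algebra uea"
  shows "coproduct (a * b) = coproduct a * coproduct b"
  "coproduct (a + b) = coproduct a + coproduct b"
  "coproduct (c *\<^sub>C a) = c *\<^sub>C coproduct a"
  "coproduct (1 :: 'g uea) = 1"
  "coproduct (uea_in x) = pure_tensor (uea_in x) 1 + pure_tensor 1 (uea_in x)"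
proof -
  obtain p q where pq: "a = abs_uea p" "b = abs_uea q"
    by (metis Quotient3_abs_rep[OF Quotient3_uea])
  note defs = pq times_uea.abs_eq plus_uea.abs_eq cscale_uea.abs_eq one_uea.abs_eq uea_in.abs_eq
    coproduct.abs_eq free_ext_simps
  show "coproduct (a * b) = coproduct a * coproduct b" by (simp add: defs)
  show "coproduct (a + b) = coproduct a + coproduct b" by (simp add: defs)
  show "coproduct (c *\<^sub>C a) = c *\<^sub>C coproduct a" by (simp add: defs cscale_mult_left)
  show "coproduct (1 :: 'g uea) = 1" by (simp add: defs)
  show "coproduct (uea_in x) = pure_tensor (uea_in x) 1 + pure_tensor 1 (uea_in x)"
    by (subst uea_in.abs_eq) (simp add: coproduct.abs_eq free_ext_simps prim_def)
qed

section \<open>Laurent series over an algebra\<close>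

text \<open>The ring \<open>'a fls\<close> plays the role of \<open>A[[\<xi>]][\<xi>\<^sup>-\<^sup>1]\<close>, with \<open>\<xi> = fls_X\<close>.\<close>

instantiation fls :: (complex_algebra_1) complex_algebra_1
begin
definition cscale_fls :: "complex \<Rightarrow> 'a fls \<Rightarrow> 'a fls" where
  "cscale_fls c f = fls_const (c *\<^sub>C 1) * f"
instance
proof
  fix c d :: complex and f g :: "'a fls"
  show "c *\<^sub>C (f + g) = c *\<^sub>C f + c *\<^sub>C g" by (simp add: cscale_fls_def distrib_left)
  show "(c + d) *\<^sub>C f = c *\<^sub>C f + d *\<^sub>C f"
    by (simp add: cscale_fls_def cscale_add_left distrib_right flip: fls_plus_const)
  show "c *\<^sub>C d *\<^sub>C f = (c * d) *\<^sub>C f"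
    by (simp add: cscale_fls_def cscale_mult_left cscale_cscale fls_const_mult_const flip: mult.assoc)
  show "1 *\<^sub>C f = f" by (simp add: cscale_fls_def cscale_one)
  show "(c *\<^sub>C f) * g = c *\<^sub>C (f * g)" by (simp add: cscale_fls_def mult.assoc)
  have "f * fls_const (c *\<^sub>C 1) = fls_const (c *\<^sub>C 1) * f"
    by (rule fls_eqI) (simp add: cscale_mult_left cscale_mult_right)
  then show "f * (c *\<^sub>C g) = c *\<^sub>C (f * g)" by (simp add: cscale_fls_def flip: mult.assoc)
qed
end

lemma cscale_fls_nth: "fls_nth (c *\<^sub>C f) n = c *\<^sub>C fls_nth f n"
  by (simp add: cscale_fls_def cscale_mult_left)

text \<open>Coefficientwise application; meaningful for maps \<open>h\<close> with \<open>h 0 = 0\<close>.\<close>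

definition fls_map :: "('a::zero \<Rightarrow> 'b::zero) \<Rightarrow> 'a fls \<Rightarrow> 'b fls" where
  "fls_map h f = Abs_fls (\<lambda>n. h (fls_nth f n))"

text \<open>Substitution of \<open>f\<close> into a complex power series; meaningful for \<open>f\<close> in \<open>\<xi> A[[\<xi>]]\<close>.\<close>

definition series_subst :: "complex fps \<Rightarrow> 'a::complex_algebra_1 fls \<Rightarrow> 'a fls" where
  "series_subst p f =
     fps_to_fls (fps_compose (Abs_fps (\<lambda>n. fps_nth p n *\<^sub>C 1)) (fls_regpart f))"

definition formal_exp :: "'a::complex_algebra_1 fls \<Rightarrow> 'a fls" where
  "formal_exp = series_subst (fps_exp 1)"

text \<open>\<open>formal_ln1p f\<close> is \<open>ln (1 + f)\<close>.\<close>

definition formal_ln1p :: "'a::complex_algebra_1 fls \<Rightarrow> 'a fls" where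
  "formal_ln1p = series_subst (fps_ln 1)"

text \<open>The coefficient of \<open>\<xi>\<^sup>n\<close> in \<open>f \<boxtimes> g\<close> is the sum of the \<open>f\<^sub>i \<otimes> g\<^sub>j\<close> with \<open>i + j = n\<close>.\<close>

definition fls_tensor ::
  "'a::complex_algebra_1 fls \<Rightarrow> 'b::complex_algebra_1 fls \<Rightarrow> ('a, 'b) tensor fls"
  (infixl \<open>\<boxtimes>\<close> 72) where
  "f \<boxtimes> g = fls_map (\<lambda>a. pure_tensor a 1) f * fls_map (\<lambda>b. pure_tensor 1 b) g"

definition fls_coproduct ::
  "'g::complex_lie_algebra uea fls \<Rightarrow> ('g uea, 'g uea) tensor fls" where
  "fls_coproduct = fls_map coproduct"

definition ring_inverse :: "'a::ring_1 \<Rightarrow> 'a" where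
  "ring_inverse x = (THE y. x * y = 1 \<and> y * x = 1)"

section \<open>The symplectic Lie algebra\<close>

definition symplectic_form :: "nat \<Rightarrow> complex mat" where
  "symplectic_form N = four_block_mat (0\<^sub>m N N) (1\<^sub>m N) (- 1\<^sub>m N) (0\<^sub>m N N)"

definition sp_mats :: "nat \<Rightarrow> complex mat set" where
  "sp_mats N = {A \<in> carrier_mat (2 * N) (2 * N).
     transpose_mat A * symplectic_form N + symplectic_form N * A = 0\<^sub>m (2 * N) (2 * N)}"

definition mat_commutator :: "complex mat \<Rightarrow> complex mat \<Rightarrow> complex mat" where
  "mat_commutator A B = A * B - B * A"

lemma symplectic_form_carrier [simp]: "symplectic_form N \<in> carrier_mat (2 * N) (2 * N)"
  unfolding symplectic_form_def mult_2 by (rule four_block_carrier_mat) auto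

lemma symplectic_form_dim [simp]:
  "dim_row (symplectic_form N) = 2 * N" "dim_col (symplectic_form N) = 2 * N"
  using symplectic_form_carrier[of N] unfolding carrier_mat_def by blast+

lemma symplectic_form_mult_carrier:
  "A \<in> carrier_mat (2 * N) m \<Longrightarrow> symplectic_form N * A \<in> carrier_mat (2 * N) m"
  by (rule mult_carrier_mat[OF symplectic_form_carrier])

lemma sp_mats_iff:
  "A \<in> sp_mats N \<longleftrightarrow> A \<in> carrier_mat (2 * N) (2 * N) \<and>
     transpose_mat A * symplectic_form N = - (symplectic_form N * A)"
proof -
  have "X + Y = 0\<^sub>m n n \<longleftrightarrow> X = - Y"
    if "X \<in> carrier_mat n n" "Y \<in> carrier_mat n n" for X Y :: "complex mat" and n
    using that by (auto simp: mat_eq_iff add_eq_0_iff2)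
  from this[of "transpose_mat A * symplectic_form N" "2 * N" "symplectic_form N * A"]
  show ?thesis
    using mult_carrier_mat[of "transpose_mat A" "2 * N" "2 * N" "symplectic_form N" "2 * N"]
      symplectic_form_mult_carrier[of A N "2 * N"]
    by (fastforce simp: sp_mats_def)
qed

lemma sp_mats_carrier: "A \<in> sp_mats N \<Longrightarrow> A \<in> carrier_mat (2 * N) (2 * N)"
  by (simp add: sp_mats_def)

lemma transpose_zero: "transpose_mat (0\<^sub>m n n) = 0\<^sub>m n n"
  by auto

lemma sp_mats_zero: "0\<^sub>m (2 * N) (2 * N) \<in> sp_mats N"
  by (simp add: sp_mats_def right_mult_zero_mat[OF symplectic_form_carrier]
      left_mult_zero_mat[OF symplectic_form_carrier] transpose_zero)

lemma sp_mats_smult: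
  assumes "A \<in> sp_mats N"
  shows "c \<cdot>\<^sub>m A \<in> sp_mats N"
proof -
  have A: "A \<in> carrier_mat (2 * N) (2 * N)" using assms by (rule sp_mats_carrier)
  have "transpose_mat (c \<cdot>\<^sub>m A) = c \<cdot>\<^sub>m transpose_mat A" by auto
  moreover have "c \<cdot>\<^sub>m (- (symplectic_form N * A)) = - (c \<cdot>\<^sub>m (symplectic_form N * A))" by auto
  ultimately show ?thesis
    using assms mult_smult_assoc_mat[of "transpose_mat A" "2 * N" "2 * N" "symplectic_form N" "2 * N" c]
      mult_smult_distrib[of "symplectic_form N" "2 * N" "2 * N" A "2 * N" c]
    by (simp add: sp_mats_iff)
qed

lemma sp_mats_add:
  assumes "A \<in> sp_mats N" "B \<in> sp_mats N"
  shows "A + B \<in> sp_mats N"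
proof -
  have A: "A \<in> carrier_mat (2 * N) (2 * N)" and B: "B \<in> carrier_mat (2 * N) (2 * N)"
    using assms by (auto intro: sp_mats_carrier)
  have "- X + - Y = - (X + Y)"
    if "X \<in> carrier_mat n n" "Y \<in> carrier_mat n n" for X Y :: "complex mat" and n
    using that by (auto simp: mat_eq_iff)
  from this[of "symplectic_form N * A" "2 * N" "symplectic_form N * B"]
  show ?thesis
    using assms A B
      add_mult_distrib_mat[of "transpose_mat A" "2 * N" "2 * N" "transpose_mat B" "symplectic_form N" "2 * N"]
      mult_add_distrib_mat[of "symplectic_form N" "2 * N" "2 * N" A "2 * N" B]
    by (simp add: sp_mats_iff transpose_add symplectic_form_mult_carrier)
qed

lemma sp_mats_uminus: "A \<in> sp_mats N \<Longrightarrow> - A \<in> sp_mats N"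
  using sp_mats_smult[of A N "- 1"] by (simp add: smult_mat_def map_mat_def uminus_mat_def)

lemma sp_mats_minus:
  assumes "A \<in> sp_mats N" "B \<in> sp_mats N"
  shows "A - B \<in> sp_mats N"
  using sp_mats_add[OF assms(1) sp_mats_uminus[OF assms(2)]] assms
  by (metis add_uminus_minus_mat sp_mats_carrier)

lemma sp_mats_commutator:
  assumes "A \<in> sp_mats N" "B \<in> sp_mats N"
  shows "mat_commutator A B \<in> sp_mats N"
proof -
  let ?J = "symplectic_form N"
  let ?n = "2 * N"
  have A: "A \<in> carrier_mat ?n ?n" and B: "B \<in> carrier_mat ?n ?n" and J: "?J \<in> carrier_mat ?n ?n"
    using assms by (auto intro: sp_mats_carrier)
  have AJ: "transpose_mat A * ?J = - (?J * A)" and BJ: "transpose_mat B * ?J = - (?J * B)"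
    using assms by (simp_all add: sp_mats_iff)
  have swap: "transpose_mat (X * Y) * ?J = ?J * (Y * X)"
    if X: "X \<in> carrier_mat ?n ?n" and Y: "Y \<in> carrier_mat ?n ?n"
      and XJ: "transpose_mat X * ?J = - (?J * X)" and YJ: "transpose_mat Y * ?J = - (?J * Y)"
    for X Y
  proof -
    have "transpose_mat (X * Y) * ?J = transpose_mat Y * (transpose_mat X * ?J)"
      using X Y J transpose_mult[OF X Y]
        assoc_mult_mat[of "transpose_mat Y" ?n ?n "transpose_mat X" ?n ?J ?n]
      by simp
    also have "\<dots> = - (transpose_mat Y * (?J * X))"
      unfolding XJ using X Y J symplectic_form_mult_carrier[OF X] by auto
    also have "transpose_mat Y * (?J * X) = transpose_mat Y * ?J * X"
      by (rule assoc_mult_mat[of "transpose_mat Y" ?n ?n ?J ?n X ?n, symmetric]) (use X Y in auto)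
    also have "\<dots> = - (?J * Y * X)"
      unfolding YJ using X Y J by simp
    also have "- (- (?J * Y * X)) = ?J * (Y * X)"
      unfolding assoc_mult_mat[OF J Y X] by simp
    finally show ?thesis .
  qed
  have "transpose_mat (A * B - B * A) = transpose_mat (A * B) - transpose_mat (B * A)"
    using A B by (auto simp: mat_eq_iff)
  then have "transpose_mat (A * B - B * A) * ?J = ?J * (B * A) - ?J * (A * B)"
    using minus_mult_distrib_mat[of "transpose_mat (A * B)" ?n ?n "transpose_mat (B * A)" ?J ?n]
      A B J swap[OF A B AJ BJ] swap[OF B A BJ AJ]
    by simp
  also have "\<dots> = - (?J * (A * B) - ?J * (B * A))"
    using A B J by (auto simp: mat_eq_iff)
  also have "?J * (A * B) - ?J * (B * A) = ?J * (A * B - B * A)"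
    using mult_minus_distrib_mat[of ?J ?n ?n "A * B" ?n "B * A"] A B J by simp
  finally show ?thesis
    using A B unfolding sp_mats_iff mat_commutator_def by (metis minus_carrier_mat mult_carrier_mat)
qed

text \<open>The rank \<open>N\<close> is the cardinality of the otherwise irrelevant index type.\<close>

typedef ('n::finite) sp = "sp_mats CARD('n)"
  using sp_mats_zero by blast

setup_lifting type_definition_sp

lemma mat_jacobi:
  assumes A: "A \<in> carrier_mat n n" and B: "B \<in> carrier_mat n n" and C: "C \<in> carrier_mat n n"
  shows "mat_commutator A (mat_commutator B C) + mat_commutator B (mat_commutator C A)
    + mat_commutator C (mat_commutator A B) = 0\<^sub>m n n"
proof -
  have expand: "mat_commutator X (mat_commutator Y Z) =
      (X * (Y * Z) - X * (Z * Y)) - (Y * (Z * X) - Z * (Y * X))"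
    if X: "X \<in> carrier_mat n n" and Y: "Y \<in> carrier_mat n n" and Z: "Z \<in> carrier_mat n n"
    for X Y Z
    using mult_minus_distrib_mat[of X n n "Y * Z" n "Z * Y"]
      minus_mult_distrib_mat[of "Y * Z" n n "Z * Y" X n] that
    by (simp add: mat_commutator_def)
  have "(p - q - (r - s)) + (r - u - (v - q)) + (v - s - (p - u)) = 0\<^sub>m n n"
    if "p \<in> carrier_mat n n" "q \<in> carrier_mat n n" "r \<in> carrier_mat n n"
      "s \<in> carrier_mat n n" "u \<in> carrier_mat n n" "v \<in> carrier_mat n n"
    for p q r s u v :: "complex mat"
    using that by (auto simp: mat_eq_iff)
  from this[of "A * (B * C)" "A * (C * B)" "B * (C * A)" "C * (B * A)" "B * (A * C)" "C * (A * B)"]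
  show ?thesis
    using A B C by (simp add: expand)
qed

instantiation sp :: (finite) complex_lie_algebra
begin

lift_definition zero_sp :: "'a sp" is "0\<^sub>m (2 * CARD('a)) (2 * CARD('a))"
  by (rule sp_mats_zero)
lift_definition plus_sp :: "'a sp \<Rightarrow> 'a sp \<Rightarrow> 'a sp" is "(+)" by (rule sp_mats_add)
lift_definition uminus_sp :: "'a sp \<Rightarrow> 'a sp" is uminus by (rule sp_mats_uminus)
lift_definition minus_sp :: "'a sp \<Rightarrow> 'a sp \<Rightarrow> 'a sp" is "(-)" by (rule sp_mats_minus)
lift_definition cscale_sp :: "complex \<Rightarrow> 'a sp \<Rightarrow> 'a sp" is "(\<cdot>\<^sub>m)" by (rule sp_mats_smult)
lift_definition lie_sp :: "'a sp \<Rightarrow> 'a sp \<Rightarrow> 'a sp" is mat_commutator by (rule sp_mats_commutator)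

instance
proof
  fix x y z :: "'a sp" and c d :: complex
  let ?n = "2 * CARD('a)"
  show "x + y + z = x + (y + z)"
    by transfer (auto simp: mat_eq_iff dest!: sp_mats_carrier)
  show "x + y = y + x"
    by transfer (auto simp: mat_eq_iff dest!: sp_mats_carrier)
  show "0 + x = x"
    by transfer (auto simp: mat_eq_iff dest!: sp_mats_carrier)
  show "- x + x = 0"
    by transfer (auto simp: mat_eq_iff dest!: sp_mats_carrier)
  show "x - y = x + - y"
    by transfer (auto simp: mat_eq_iff dest!: sp_mats_carrier)
  show "c *\<^sub>C (x + y) = c *\<^sub>C x + c *\<^sub>C y"
    by transfer (auto simp: mat_eq_iff distrib_left dest!: sp_mats_carrier)
  show "(c + d) *\<^sub>C x = c *\<^sub>C x + d *\<^sub>C x"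
    by transfer (auto simp: mat_eq_iff distrib_right dest!: sp_mats_carrier)
  show "c *\<^sub>C d *\<^sub>C x = (c * d) *\<^sub>C x"
    by transfer (auto simp: mat_eq_iff dest!: sp_mats_carrier)
  show "1 *\<^sub>C x = x"
    by transfer (auto simp: mat_eq_iff dest!: sp_mats_carrier)
  show "lie (x + y) z = lie x z + lie y z"
  proof transfer
    fix A B C assume "A \<in> sp_mats CARD('a)" "B \<in> sp_mats CARD('a)" "C \<in> sp_mats CARD('a)"
    then have c: "A \<in> carrier_mat ?n ?n" "B \<in> carrier_mat ?n ?n" "C \<in> carrier_mat ?n ?n"
      by (auto intro: sp_mats_carrier)
    then show "mat_commutator (A + B) C = mat_commutator A C + mat_commutator B C"
      using add_mult_distrib_mat[of A ?n ?n B C ?n] mult_add_distrib_mat[of C ?n ?n A ?n B]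
      by (auto simp: mat_commutator_def mat_eq_iff)
  qed
  show "lie x (y + z) = lie x y + lie x z"
  proof transfer
    fix A B C assume "A \<in> sp_mats CARD('a)" "B \<in> sp_mats CARD('a)" "C \<in> sp_mats CARD('a)"
    then have c: "A \<in> carrier_mat ?n ?n" "B \<in> carrier_mat ?n ?n" "C \<in> carrier_mat ?n ?n"
      by (auto intro: sp_mats_carrier)
    then show "mat_commutator A (B + C) = mat_commutator A B + mat_commutator A C"
      using add_mult_distrib_mat[of B ?n ?n C A ?n] mult_add_distrib_mat[of A ?n ?n B ?n C]
      by (auto simp: mat_commutator_def mat_eq_iff)
  qed
  show "lie (c *\<^sub>C x) y = c *\<^sub>C lie x y"
  proof transfer
    fix k and A B assume "A \<in> sp_mats CARD('a)" "B \<in> sp_mats CARD('a)"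
    then have c: "A \<in> carrier_mat ?n ?n" "B \<in> carrier_mat ?n ?n"
      by (auto intro: sp_mats_carrier)
    then show "mat_commutator (k \<cdot>\<^sub>m A) B = k \<cdot>\<^sub>m mat_commutator A B"
      using mult_smult_distrib[of B ?n ?n A ?n k] mult_smult_assoc_mat[of A ?n ?n B ?n k]
      by (auto simp: mat_commutator_def mat_eq_iff right_diff_distrib)
  qed
  show "lie x (c *\<^sub>C y) = c *\<^sub>C lie x y"
  proof transfer
    fix A k and B assume "A \<in> sp_mats CARD('a)" "B \<in> sp_mats CARD('a)"
    then have c: "A \<in> carrier_mat ?n ?n" "B \<in> carrier_mat ?n ?n"
      by (auto intro: sp_mats_carrier)
    then show "mat_commutator A (k \<cdot>\<^sub>m B) = k \<cdot>\<^sub>m mat_commutator A B"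
      using mult_smult_distrib[of A ?n ?n B ?n k] mult_smult_assoc_mat[of B ?n ?n A ?n k]
      by (auto simp: mat_commutator_def mat_eq_iff right_diff_distrib)
  qed
  show "lie x x = 0"
    by transfer (auto simp: mat_commutator_def mat_eq_iff dest!: sp_mats_carrier)
  show "lie x (lie y z) + lie y (lie z x) + lie z (lie x y) = 0"
    by transfer (rule mat_jacobi; erule sp_mats_carrier)
qed

end

text \<open>Matrix units of size \<open>2N\<close>, with the row and column indices counted from 1.\<close>

definition mat_unit :: "nat \<Rightarrow> nat \<Rightarrow> nat \<Rightarrow> complex mat" where
  "mat_unit N a b = mat (2 * N) (2 * N) (\<lambda>(i, j). if Suc i = a \<and> Suc j = b then 1 else 0)"

definition E_minus_mat :: "nat \<Rightarrow> nat \<Rightarrow> nat \<Rightarrow> complex mat" where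
  "E_minus_mat N i j = mat_unit N i j - mat_unit N (N + j) (N + i)"

definition E_plus_mat :: "nat \<Rightarrow> nat \<Rightarrow> nat \<Rightarrow> complex mat" where
  "E_plus_mat N i j = mat_unit N i (N + j) + mat_unit N j (N + i)"

definition F_minus_mat :: "nat \<Rightarrow> nat \<Rightarrow> nat \<Rightarrow> complex mat" where
  "F_minus_mat N i j = mat_unit N j i - mat_unit N (N + i) (N + j)"

definition F_plus_mat :: "nat \<Rightarrow> nat \<Rightarrow> nat \<Rightarrow> complex mat" where
  "F_plus_mat N i j = mat_unit N (N + i) j + mat_unit N (N + j) i"

definition H_mat :: "nat \<Rightarrow> nat \<Rightarrow> complex mat" where
  "H_mat N i = (1 / 2) \<cdot>\<^sub>m (mat_unit N i i - mat_unit N (N + i) (N + i))"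

lemma symplectic_form_index:
  assumes "i < 2 * N" "j < 2 * N"
  shows "symplectic_form N $$ (i, j) = (if j = i + N then 1 else if i = j + N then - 1 else 0)"
  using assms by (auto simp: symplectic_form_def four_block_mat_def Let_def)

lemma mult_symplectic_form_index:
  assumes "A \<in> carrier_mat (2 * N) (2 * N)" "i < 2 * N" "j < 2 * N"
  shows "(A * symplectic_form N) $$ (i, j) =
    (if j < N then - A $$ (i, j + N) else A $$ (i, j - N))"
proof -
  have "(A * symplectic_form N) $$ (i, j) =
      (\<Sum>k<2 * N. A $$ (i, k) * (if j = k + N then 1 else if k = j + N then - 1 else 0))"
    using assms
    by (auto simp: scalar_prod_def symplectic_form_index lessThan_atLeast0 intro!: sum.cong)
  also have "\<dots> = (\<Sum>k<2 * N. if k = (if j < N then j + N else j - N)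
      then A $$ (i, k) * (if j < N then - 1 else 1) else 0)"
    using assms by (intro sum.cong) auto
  also have "\<dots> = (if j < N then - A $$ (i, j + N) else A $$ (i, j - N))"
    using assms by auto
  finally show ?thesis .
qed

lemma symplectic_form_mult_index:
  assumes "A \<in> carrier_mat (2 * N) (2 * N)" "i < 2 * N" "j < 2 * N"
  shows "(symplectic_form N * A) $$ (i, j) =
    (if i < N then A $$ (i + N, j) else - A $$ (i - N, j))"
proof -
  have "(symplectic_form N * A) $$ (i, j) =
      (\<Sum>k<2 * N. (if k = i + N then 1 else if i = k + N then - 1 else 0) * A $$ (k, j))"
    using assms
    by (auto simp: scalar_prod_def symplectic_form_index lessThan_atLeast0 intro!: sum.cong)
  also have "\<dots> = (\<Sum>k<2 * N. if k = (if i < N then i + N else i - N)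
      then (if i < N then 1 else - 1) * A $$ (k, j) else 0)"
    using assms by (intro sum.cong) auto
  also have "\<dots> = (if i < N then A $$ (i + N, j) else - A $$ (i - N, j))"
    using assms by auto
  finally show ?thesis .
qed

lemma sp_matsI:
  assumes A: "A \<in> carrier_mat (2 * N) (2 * N)"
    and "\<And>i j. i < N \<Longrightarrow> j < N \<Longrightarrow> A $$ (i, j + N) = A $$ (j, i + N)"
    and "\<And>i j. i < N \<Longrightarrow> j < N \<Longrightarrow> A $$ (i + N, j) = A $$ (j + N, i)"
    and "\<And>i j. i < N \<Longrightarrow> j < N \<Longrightarrow> A $$ (i + N, j + N) = - A $$ (j, i)"
  shows "A \<in> sp_mats N"
proof -
  have T: "transpose_mat A \<in> carrier_mat (2 * N) (2 * N)" using A by simp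
  have "(transpose_mat A * symplectic_form N) $$ (i, j) = (- (symplectic_form N * A)) $$ (i, j)"
    if ij: "i < 2 * N" "j < 2 * N" for i j
  proof -
    have i: "i < N \<or> (\<exists>k<N. i = k + N)" and j: "j < N \<or> (\<exists>k<N. j = k + N)"
      using ij by presburger+
    show ?thesis
      using i j ij A assms(2-4)
      by (auto simp: mult_symplectic_form_index[OF T] symplectic_form_mult_index[OF A]
          simp del: index_mult_mat(1))
  qed
  then show ?thesis
    using A by (auto simp: sp_mats_iff mat_eq_iff)
qed

lemma mat_unit_carrier [simp]: "mat_unit N a b \<in> carrier_mat (2 * N) (2 * N)"
  by (simp add: mat_unit_def)

lemma generator_mats_in_sp:
  assumes "i \<in> {1..N}" "j \<in> {1..N}"
  shows "E_minus_mat N i j \<in> sp_mats N" "E_plus_mat N i j \<in> sp_mats N"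
    "F_minus_mat N i j \<in> sp_mats N" "F_plus_mat N i j \<in> sp_mats N" "H_mat N i \<in> sp_mats N"
proof -
  obtain k l where kl: "i = Suc k" "j = Suc l" "k < N" "l < N"
    using assms by (cases i; cases j) auto
  define d :: "nat \<Rightarrow> nat \<Rightarrow> complex" where "d = (\<lambda>x y. if x = y then 1 else 0)"
  have entry: "mat_unit N a b $$ (x, y) = d (Suc x) a * d (Suc y) b"
    if "x < 2 * N" "y < 2 * N" for a b x y
    using that by (simp add: mat_unit_def d_def)
  have dims: "dim_row (mat_unit N a b) = 2 * N" "dim_col (mat_unit N a b) = 2 * N" for a b
    by (simp_all add: mat_unit_def)
  have d_simps: "d (Suc x) (Suc y) = d x y" "d (x + N) (N + y) = d x y" for x y
    by (simp_all add: d_def)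
  have d_zero: "d (x + N) k = 0" "d (x + N) l = 0" for x
    using kl by (simp_all add: d_def)
  have d_zero': "d x (N + y) = 0" if "x < N" for x y
    using that by (simp add: d_def)
  note entries = E_minus_mat_def E_plus_mat_def F_minus_mat_def F_plus_mat_def H_mat_def kl entry
    dims d_simps d_zero d_zero' minus_carrier_mat
  show "E_minus_mat N i j \<in> sp_mats N" "F_minus_mat N i j \<in> sp_mats N" "H_mat N i \<in> sp_mats N"
    by (rule sp_matsI; simp add: entries)+
  show "E_plus_mat N i j \<in> sp_mats N" "F_plus_mat N i j \<in> sp_mats N"
    by (rule sp_matsI; simp add: entries)+
qed

text \<open>The Lie algebra generators inside the Laurent series over the enveloping algebra, those for
  the roots \<open>\<plusminus> (e\<^sub>i + e\<^sub>j)\<close> rescaled by \<open>\<xi>\<^sup>\<plusminus>\<^sup>1\<close>. They are specified for indices from 1 to the rank.\<close>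

definition E_minus :: "nat \<Rightarrow> nat \<Rightarrow> 'n::finite sp uea fls" where
  "E_minus i j = fls_const (uea_in (Abs_sp (E_minus_mat CARD('n) i j)))"

definition E_plus :: "nat \<Rightarrow> nat \<Rightarrow> 'n::finite sp uea fls" where
  "E_plus i j = fls_X * fls_const (uea_in (Abs_sp (E_plus_mat CARD('n) i j)))"

definition F_minus :: "nat \<Rightarrow> nat \<Rightarrow> 'n::finite sp uea fls" where
  "F_minus i j = fls_const (uea_in (Abs_sp (F_minus_mat CARD('n) i j)))"

definition F_plus :: "nat \<Rightarrow> nat \<Rightarrow> 'n::finite sp uea fls" where
  "F_plus i j = fls_X_inv * fls_const (uea_in (Abs_sp (F_plus_mat CARD('n) i j)))"

definition H_cartan :: "nat \<Rightarrow> 'n::finite sp uea fls" where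
  "H_cartan i = fls_const (uea_in (Abs_sp (H_mat CARD('n) i)))"

section \<open>The full extended jordanian twist\<close>

definition sigma11 :: "'n::finite sp uea fls" where
  "sigma11 = formal_ln1p (E_plus 1 1)"

definition twist :: "('n::finite sp uea, 'n sp uea) tensor fls" where
  "twist =
     prod_list (map (\<lambda>i. formal_exp (E_minus 1 i \<boxtimes> (E_plus 1 i * formal_exp ((- 1 / 2) *\<^sub>C sigma11))))
       (rev [2..<CARD('n) + 1]))
     * formal_exp (H_cartan 1 \<boxtimes> sigma11)"

definition twisted_coproduct ::
  "'n::finite sp uea fls \<Rightarrow> ('n sp uea, 'n sp uea) tensor fls" where
  "twisted_coproduct a = twist * fls_coproduct a * ring_inverse twist"

text \<open>Labels of the elements \<open>X'\<close>: for instance \<open>EPlus i j\<close> stands for \<open>E'\<^sub>i\<^sub>+\<^sub>j\<close>.\<close>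

datatype label = EPlus nat nat | FPlus nat nat | EMinus nat nat | FMinus nat nat | HCartan nat

definition labels :: "nat \<Rightarrow> label set" where
  "labels N =
     {EPlus i j | i j. 2 \<le> i \<and> i \<le> j \<and> j \<le> N} \<union>
     {FPlus i j | i j. 2 \<le> i \<and> i \<le> j \<and> j \<le> N} \<union>
     {EMinus i j | i j. 2 \<le> i \<and> i < j \<and> j \<le> N} \<union>
     {FMinus i j | i j. 2 \<le> i \<and> i < j \<and> j \<le> N} \<union>
     {HCartan i | i. 2 \<le> i \<and> i \<le> N}"

fun primed :: "label \<Rightarrow> 'n::finite sp uea fls" where
  "primed (EPlus i j) = E_plus i j - E_plus 1 i * E_plus 1 j * formal_exp (- sigma11)"
| "primed (FPlus i j) = F_plus i j - E_minus 1 i * E_minus 1 j"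
| "primed (EMinus i j) = E_minus i j"
| "primed (FMinus i j) = F_minus i j"
| "primed (HCartan i) = H_cartan i"

end

theory Submission
  imports Defs
begin

text \<open>Write \<open>A\<^sub>i = E\<^sub>1\<^sub>-\<^sub>i\<close>, \<open>B\<^sub>i = E\<^sub>1\<^sub>+\<^sub>i\<close>, \<open>Z = E\<^sub>1\<^sub>+\<^sub>1\<close>. The \<open>A\<^sub>i\<close>, \<open>B\<^sub>i\<close> generate a Heisenberg algebra with centre
  \<open>Z\<close>, on which the subalgebra \<open>sp(N - 1)\<close> acts. The factors of the extension commute, so their
  product is \<open>e\<^sup>S\<close> with \<open>S = \<Sum> A\<^sub>i \<otimes> B\<^sub>i e\<^sup>-\<^sup>\<sigma>\<^sup>/\<^sup>2\<close>; conjugation by the jordanian factor only rescales weight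
  vectors of \<open>H\<^sub>1\<^sub>1\<close> by powers of \<open>1 \<otimes> e\<^sup>\<sigma>\<close>, and the conjugation by \<open>e\<^sup>S\<close> terminates after the second
  commutator. This gives
  \<open>A\<^sub>i \<mapsto> A\<^sub>i \<otimes> e\<^sup>-\<^sup>\<sigma>\<^sup>/\<^sup>2 + 1 \<otimes> A\<^sub>i\<close>, \<open>B\<^sub>i \<mapsto> B\<^sub>i \<otimes> e\<^sup>\<sigma>\<^sup>/\<^sup>2 + e\<^sup>\<sigma> \<otimes> B\<^sub>i\<close> and \<open>e\<^sup>\<sigma> \<mapsto> e\<^sup>\<sigma> \<otimes> e\<^sup>\<sigma>\<close>, and the quadratic
  corrections in the primed generators cancel the non-primitive terms. The same corrections
  preserve the symplectic commutation relations because \<open>e\<^sup>-\<^sup>\<sigma> (1 + Z) = 1\<close>. Linear independence is read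
  off from the leading coefficients in \<open>\<xi>\<close>, since \<open>sp(N)\<close> embeds into its enveloping algebra.\<close>

section \<open>The \<open>\<xi>\<close>-adic filtration\<close>

text \<open>All brackets come from one axiomatisation, \<open>sp_relations\<close>, in which
  \<open>e i j\<close> exists for every ordered pair, so that E_(i-j), F_(i-j) and H_ii are treated
  uniformly. The original generators satisfy it, and \<open>sp_deformation\<close> shows that the
  primed ones satisfy it again on the indices other than 1. Every such family carries a Lie
  homomorphism \<open>rep\<close> defined on symplectic matrices and read off block by block.
  Closure of the span under commutators and the isomorphism are therefore inherited from the
  matrices, and only triviality of the kernel is left. The obstacle there is that the elements
  E'_(i+j) are infinite series over a quotient algebra without an explicit basis; the lowest
  coefficients, in contrast, are single elements of the Lie algebra, on which matrix entries can be
  read. Identities between infinite series are proved by comparing truncations modulo every power of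
  \<xi>.\<close>

definition adic :: "int \<Rightarrow> 'a::zero fls set" where
  "adic m = {f. \<forall>k<m. fls_nth f k = 0}"

lemma adicI: "(\<And>k. k < m \<Longrightarrow> fls_nth f k = 0) \<Longrightarrow> f \<in> adic m"
  and adicD: "f \<in> adic m \<Longrightarrow> k < m \<Longrightarrow> fls_nth f k = 0"
  by (simp_all add: adic_def)

lemma adic_mono: "f \<in> adic m \<Longrightarrow> k \<le> m \<Longrightarrow> f \<in> adic k"
  by (simp add: adic_def)

lemma adic_subdegree: "f \<in> adic (fls_subdegree f)"
  by (simp add: adic_def)

lemma adic_zero [simp]: "0 \<in> adic m"
  by (simp add: adic_def)

lemma adic_add: "f \<in> adic m \<Longrightarrow> g \<in> adic m \<Longrightarrow> f + g \<in> adic m"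
  and adic_diff: "f' \<in> adic m \<Longrightarrow> g' \<in> adic m \<Longrightarrow> f' - g' \<in> adic m"
  for f g :: "'a::monoid_add fls" and f' g' :: "'b::group_add fls"
  by (simp_all add: adic_def)

lemma adic_scale: "f \<in> adic m \<Longrightarrow> c *\<^sub>C f \<in> adic m" for f :: "'a::complex_algebra_1 fls"
  by (simp add: adic_def cscale_fls_nth)

lemma adic_uminus: "f \<in> adic m \<Longrightarrow> - f \<in> adic m" for f :: "'a::group_add fls"
  by (simp add: adic_def)

lemma adic_sum: "(\<And>x. x \<in> A \<Longrightarrow> f x \<in> adic m) \<Longrightarrow> sum f A \<in> adic m"
  for f :: "'b \<Rightarrow> 'a::comm_monoid_add fls"
  by (induction A rule: infinite_finite_induct) (auto intro: adic_add)

text \<open>Coefficients below a lower bound of the order vanish, so arbitrary bounds may replace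
  the exact subdegrees as summation limits. This makes products comparable after a coefficientwise
  map, which can raise the subdegree, and it covers 0, which lies in every
  \<open>adic m\<close>.\<close>

lemma fls_times_nth_adic:
  fixes f g :: "'a::semiring_0 fls"
  assumes "f \<in> adic m" "g \<in> adic k"
  shows "fls_nth (f * g) n = (\<Sum>i = m..n - k. fls_nth f i * fls_nth g (n - i))"
proof -
  let ?m = "min m (fls_subdegree f)" and ?k = "min k (fls_subdegree g)"
  have "fls_nth (f * g) n = (\<Sum>i = ?m..n - ?k. fls_nth f i * fls_nth g (n - i))"
    unfolding fls_times_nth(2) by (rule sum.mono_neutral_left) auto
  also have "\<dots> = (\<Sum>i = m..n - k. fls_nth f i * fls_nth g (n - i))"
    using assms by (intro sum.mono_neutral_right) (auto simp: adic_def not_le)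
  finally show ?thesis .
qed

lemma adic_mult:
  fixes f g :: "'a::semiring_0 fls"
  assumes "f \<in> adic m" "g \<in> adic k"
  shows "f * g \<in> adic (m + k)"
  using assms by (auto intro!: adicI simp: fls_times_nth_adic[OF assms])

lemma adic_const [simp]: "fls_const c \<in> adic 0"
  by (simp add: adic_def)

lemma adic_one [simp]: "1 \<in> adic 0"
  by (simp add: adic_def)

lemma adic_power:
  fixes f :: "'a::ring_1 fls"
  shows "f \<in> adic 1 \<Longrightarrow> f ^ n \<in> adic (int n)"
  using adic_mult[of f 1 "f ^ n" "int n" for n] by (induction n) auto

lemma adic_power_0:
  fixes f :: "'a::ring_1 fls"
  shows "f \<in> adic 1 \<Longrightarrow> f ^ n \<in> adic 0"
  using adic_power[of f n] by (auto intro: adic_mono)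

text \<open>The filtration is separated. The offset \<open>m\<close>, which may be negative, absorbs
  the pole of a fixed factor by which a remainder has been multiplied.\<close>

lemma adic_all_zero: "(\<And>n. f \<in> adic (int n + m)) \<Longrightarrow> f = 0"
proof (rule fls_eqI)
  fix k assume f: "\<And>n. f \<in> adic (int n + m)"
  have "k < int (nat (k - m + 1)) + m" by linarith
  from adicD[OF f this] show "fls_nth f k = fls_nth 0 k" by simp
qed

lemma common_adic:
  assumes "finite S"
  obtains m where "\<And>f. f \<in> S \<Longrightarrow> f \<in> adic m"
proof
  fix f assume "f \<in> S"
  then show "f \<in> adic (Min (fls_subdegree ` S))"
    using assms by (auto intro: adic_mono[OF adic_subdegree])
qed

section \<open>Substitution into power series\<close>

abbreviation series_trunc :: "complex fps \<Rightarrow> 'a::complex_algebra_1 fls \<Rightarrow> nat \<Rightarrow> 'a fls" where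
  "series_trunc p f n \<equiv> \<Sum>i<n. fps_nth p i *\<^sub>C f ^ i"

lemma fps_to_fls_regpart:
  assumes "f \<in> adic 0"
  shows "fps_to_fls (fls_regpart f) = f"
  using assms by (intro fls_eqI) (auto simp: adic_def)

text \<open>Since \<open>f ^ i\<close> has order at least \<open>i\<close>, the coefficient of
  \<xi>^k in the substitution involves only the powers up to k. Together with
  \<open>series_subst_eqI\<close> this characterises \<open>series_subst\<close> by its truncations;
  its definition is not unfolded again.\<close>

lemma series_subst_trunc:
  fixes f :: "'a::complex_algebra_1 fls"
  assumes "f \<in> adic 1"
  shows "series_subst p f - series_trunc p f n \<in> adic (int n)"
proof (rule adicI)
  fix k assume k: "k < int n"
  let ?F = "fls_regpart f"
  have f: "fps_to_fls ?F = f"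
    using assms by (auto intro!: fps_to_fls_regpart intro: adic_mono)
  have pow: "fls_nth (f ^ i) k = (if k < 0 then 0 else fps_nth (?F ^ i) (nat k))" for i
    by (subst f[symmetric]) (simp flip: fps_to_fls_power)
  show "fls_nth (series_subst p f - series_trunc p f n) k = 0"
  proof (cases "k < 0")
    case False
    then have "fls_nth (series_subst p f) k = (\<Sum>i\<le>nat k. fps_nth p i *\<^sub>C fps_nth (?F ^ i) (nat k))"
      by (simp add: series_subst_def fps_compose_nth cscale_mult_left atLeast0AtMost)
    also have "\<dots> = (\<Sum>i<n. fps_nth p i *\<^sub>C fps_nth (?F ^ i) (nat k))"
    proof (rule sum.mono_neutral_left)
      show "\<forall>i\<in>{..<n} - {..nat k}. fps_nth p i *\<^sub>C fps_nth (?F ^ i) (nat k) = 0"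
        using False pow adicD[OF adic_power[OF assms], of k] by auto
    qed (use k False in auto)
    finally show ?thesis
      using False by (simp add: fls_nth_sum cscale_fls_nth pow)
  qed (simp add: series_subst_def fls_nth_sum cscale_fls_nth pow)
qed

lemma series_subst_eqI:
  assumes "f \<in> adic 1" "\<And>n. g - series_trunc p f n \<in> adic (int n)"
  shows "g = series_subst p f"
proof -
  have "g - series_subst p f \<in> adic (int n + 0)" for n
    using adic_diff[OF assms(2)[of n] series_subst_trunc[OF assms(1), of p n]] by simp
  from adic_all_zero[OF this] show ?thesis by simp
qed

lemma series_subst_adic_0: "f \<in> adic 1 \<Longrightarrow> series_subst p f \<in> adic 0"
  using series_subst_trunc[of f p 0] by simp

lemma series_subst_adic:
  assumes "f \<in> adic 1" "\<And>i. i < n \<Longrightarrow> fps_nth p i = 0"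
  shows "series_subst p f \<in> adic (int n)"
  using series_subst_trunc[OF assms(1), of p n] assms(2) by simp

lemma series_subst_diff:
  assumes "f \<in> adic 1"
  shows "series_subst (p - q) f = series_subst p f - series_subst q f"
proof (rule series_subst_eqI[symmetric, OF assms])
  fix n
  have "series_subst p f - series_subst q f - series_trunc (p - q) f n =
    (series_subst p f - series_trunc p f n) - (series_subst q f - series_trunc q f n)"
    by (simp add: complex_vector.scale_left_diff_distrib sum_subtractf)
  then show "series_subst p f - series_subst q f - series_trunc (p - q) f n \<in> adic (int n)"
    by (simp only: adic_diff series_subst_trunc assms)
qed

lemma series_subst_scale:
  assumes "f \<in> adic 1"
  shows "series_subst (fps_const c * p) f = c *\<^sub>C series_subst p f"
proof (rule series_subst_eqI[symmetric, OF assms])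
  fix n
  have "c *\<^sub>C series_subst p f - series_trunc (fps_const c * p) f n =
    c *\<^sub>C (series_subst p f - series_trunc p f n)"
    by (simp add: complex_vector.scale_right_diff_distrib complex_vector.scale_sum_right)
  then show "c *\<^sub>C series_subst p f - series_trunc (fps_const c * p) f n \<in> adic (int n)"
    by (simp only: adic_scale series_subst_trunc assms)
qed

lemma series_subst_one:
  assumes "f \<in> adic 1"
  shows "series_subst 1 f = 1"
proof (rule series_subst_eqI[symmetric, OF assms])
  fix n show "1 - series_trunc 1 f n \<in> adic (int n)"
    by (cases n) (simp_all add: sum.lessThan_Suc_shift cscale_one del: sum.lessThan_Suc)
qed

lemma series_subst_X:
  assumes "f \<in> adic 1"
  shows "series_subst fps_X f = f"
proof (rule series_subst_eqI[symmetric, OF assms])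
  fix n
  show "f - series_trunc fps_X f n \<in> adic (int n)"
    using assms adic_mono[OF assms, of 0]
    by (cases n; cases "n - 1") (simp_all add: sum.lessThan_Suc_shift cscale_one del: sum.lessThan_Suc)
qed

text \<open>The Cauchy product, stated for two families of terms so that it covers both the product of
  two series in one element and the product of exponentials of two commuting elements.\<close>

lemma cauchy_trunc:
  fixes u v :: "nat \<Rightarrow> 'a::ring_1 fls"
  assumes "\<And>i. u i \<in> adic (int i)" "\<And>i. v i \<in> adic (int i)"
  shows "(\<Sum>i<n. u i) * (\<Sum>j<n. v j) - (\<Sum>k<n. \<Sum>i\<le>k. u i * v (k - i)) \<in> adic (int n)"
proof -
  have "(\<Sum>k<n. \<Sum>i\<le>k. u i * v (k - i)) = (\<Sum>(i, j)\<in>{(i, j). i + j < n}. u i * v j)"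
    by (rule sum.triangle_reindex[symmetric])
  moreover have "(\<Sum>i<n. u i) * (\<Sum>j<n. v j) = (\<Sum>(i, j)\<in>{..<n} \<times> {..<n}. u i * v j)"
    by (simp add: sum_product sum.cartesian_product)
  moreover have "(\<Sum>(i, j)\<in>{..<n} \<times> {..<n}. u i * v j) - (\<Sum>(i, j)\<in>{(i, j). i + j < n}. u i * v j) =
      (\<Sum>(i, j)\<in>{..<n} \<times> {..<n} - {(i, j). i + j < n}. u i * v j)"
    by (rule sum_diff[symmetric]) auto
  moreover have "\<dots> \<in> adic (int n)"
  proof (rule adic_sum)
    fix x assume "x \<in> {..<n} \<times> {..<n} - {(i, j). i + j < n}"
    then obtain i j where x: "x = (i, j)" "n \<le> i + j" by auto
    then show "(case x of (i, j) \<Rightarrow> u i * v j) \<in> adic (int n)"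
      using adic_mult[OF assms(1,2), of i j] by (auto intro: adic_mono)
  qed
  ultimately show ?thesis by simp
qed

text \<open>The factors are truncated one at a time, P Q - P_n Q_n = (P - P_n) Q + P_n (Q - Q_n),
  where each summand contains a remainder of order n. The product of the two truncations is then
  handled by \<open>cauchy_trunc\<close>.\<close>

lemma series_product_trunc:
  assumes "f \<in> adic 1" "g \<in> adic 1"
  shows "series_subst p f * series_subst q g -
    (\<Sum>k<n. \<Sum>i\<le>k. (fps_nth p i *\<^sub>C f ^ i) * (fps_nth q (k - i) *\<^sub>C g ^ (k - i))) \<in> adic (int n)"
proof -
  have 1: "(series_subst p f - series_trunc p f n) * series_subst q g \<in> adic (int n)"
    using adic_mult[OF series_subst_trunc[OF assms(1)] series_subst_adic_0[OF assms(2)]] by simp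
  have "series_trunc p f n \<in> adic 0"
    by (intro adic_sum adic_scale adic_power_0 assms)
  from adic_mult[OF this series_subst_trunc[OF assms(2)]]
  have 2: "series_trunc p f n * (series_subst q g - series_trunc q g n) \<in> adic (int n)"
    by simp
  have 3: "series_trunc p f n * series_trunc q g n -
      (\<Sum>k<n. \<Sum>i\<le>k. (fps_nth p i *\<^sub>C f ^ i) * (fps_nth q (k - i) *\<^sub>C g ^ (k - i))) \<in> adic (int n)"
    by (rule cauchy_trunc) (intro adic_scale adic_power assms)+
  from adic_add[OF adic_add[OF 1 2] 3] show ?thesis
    by (simp add: left_diff_distrib right_diff_distrib)
qed

lemma series_subst_mult:
  assumes "f \<in> adic 1"
  shows "series_subst (p * q) f = series_subst p f * series_subst q f"
proof (rule series_subst_eqI[symmetric, OF assms])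
  fix n
  have "series_trunc (p * q) f n =
      (\<Sum>k<n. \<Sum>i\<le>k. (fps_nth p i *\<^sub>C f ^ i) * (fps_nth q (k - i) *\<^sub>C f ^ (k - i)))"
    by (intro sum.cong refl)
       (simp add: fps_mult_nth complex_vector.scale_sum_left cscale_mult_left cscale_mult_right
         cscale_cscale atLeast0AtMost mult.commute flip: power_add)
  then show "series_subst p f * series_subst q f - series_trunc (p * q) f n \<in> adic (int n)"
    using series_product_trunc[OF assms assms] by simp
qed

lemma series_subst_power:
  "f \<in> adic 1 \<Longrightarrow> series_subst (p ^ n) f = series_subst p f ^ n"
  by (induction n) (simp_all add: series_subst_one series_subst_mult)

text \<open>Without a constant term in \<open>q\<close>, the power \<open>q ^ i\<close> starts in
  degree i, so the polynomial \<open>P\<close> in \<open>q\<close> agrees with \<open>p oo q\<close>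
  below degree n. Linearity and multiplicativity of the substitution turn \<open>P\<close> into the
  truncation of \<open>p\<close> at \<open>series_subst q f\<close>. This is needed to evaluate exp
  at ln (1 + f).\<close>

lemma series_subst_compose:
  assumes f: "f \<in> adic 1" and q: "fps_nth q 0 = 0"
  shows "series_subst p (series_subst q f) = series_subst (p oo q) f"
proof (rule series_subst_eqI[symmetric])
  show "series_subst q f \<in> adic 1"
    using series_subst_adic[OF f, of 1 q] q by simp
  fix n
  define P where "P = (\<Sum>i<n. fps_const (fps_nth p i) * q ^ i)"
  have sum: "series_subst (\<Sum>i<k. fps_const (fps_nth p i) * q ^ i) f = series_trunc p (series_subst q f) k" for k
  proof (induction k)
    case 0
    show ?case using series_subst_diff[OF f, of 0 0] by simp
  next
    case (Suc k)
    have "series_subst (a + b) f = series_subst a f + series_subst b f" for a b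
      using series_subst_diff[OF f, of "a + b" b] by simp
    then show ?case by (simp add: Suc series_subst_scale series_subst_power f)
  qed
  have "fps_nth ((p oo q) - P) k = 0" if "k < n" for k
  proof -
    have "(\<Sum>i = 0..k. fps_nth p i * fps_nth (q ^ i) k) = (\<Sum>i<n. fps_nth p i * fps_nth (q ^ i) k)"
      using that q by (intro sum.mono_neutral_left) (auto simp: startsby_zero_power_prefix)
    then show ?thesis by (simp add: P_def fps_compose_nth fps_sum_nth)
  qed
  from series_subst_adic[OF f this]
  show "series_subst (p oo q) f - series_trunc p (series_subst q f) n \<in> adic (int n)"
    by (simp add: series_subst_diff f P_def sum)
qed

text \<open>From \<open>f * y = y * g\<close> follows \<open>f ^ i * y = y * g ^ i\<close> for all
  i. Two different arguments are allowed because moving a weight vector past the jordanian exponent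
  changes that exponent. The order of \<open>y\<close> may be negative and enters as the offset in
  \<open>adic_all_zero\<close>.\<close>

lemma series_subst_intertwine:
  fixes f g y :: "'a::complex_algebra_1 fls"
  assumes f: "f \<in> adic 1" and g: "g \<in> adic 1" and "f * y = y * g"
  shows "series_subst p f * y = y * series_subst p g"
proof -
  have "f ^ i * y = y * g ^ i" for i
  proof (induction i)
    case (Suc i)
    then show ?case by (metis assms(3) mult.assoc power_Suc)
  qed simp
  then have trunc: "series_trunc p f n * y = y * series_trunc p g n" for n
    by (simp add: sum_distrib_left sum_distrib_right cscale_mult_left cscale_mult_right)
  have "series_subst p f * y - y * series_subst p g \<in> adic (int n + fls_subdegree y)" for n
  proof -
    have "series_subst p f * y - y * series_subst p g =
        (series_subst p f - series_trunc p f n) * y - y * (series_subst p g - series_trunc p g n)"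
      by (simp add: left_diff_distrib right_diff_distrib trunc)
    also have "\<dots> \<in> adic (int n + fls_subdegree y)"
      using adic_mult[OF series_subst_trunc[OF f] adic_subdegree, of p n y]
        adic_mult[OF adic_subdegree series_subst_trunc[OF g], of y p n]
      by (intro adic_diff) (simp_all add: add.commute)
    finally show ?thesis .
  qed
  from adic_all_zero[OF this] show ?thesis by simp
qed

section \<open>The formal exponential\<close>

lemma formal_exp_adic: "f \<in> adic 1 \<Longrightarrow> formal_exp f \<in> adic 0"
  by (simp add: formal_exp_def series_subst_adic_0)

lemma formal_exp_intertwine:
  "f \<in> adic 1 \<Longrightarrow> g \<in> adic 1 \<Longrightarrow> f * y = y * g \<Longrightarrow> formal_exp f * y = y * formal_exp g"
  by (simp add: formal_exp_def series_subst_intertwine)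

lemma formal_exp_zero: "formal_exp 0 = 1"
proof -
  have "(1 :: 'a fls) - series_trunc (fps_exp 1) 0 n \<in> adic (int n)" for n
    by (cases n) (simp_all add: sum.lessThan_Suc_shift cscale_one del: sum.lessThan_Suc)
  then have "1 = series_subst (fps_exp 1) (0 :: 'a fls)"
    by (intro series_subst_eqI) simp_all
  then show ?thesis by (simp add: formal_exp_def)
qed

lemma binomial_commuting:
  fixes x y :: "'a::ring_1"
  assumes "x * y = y * x"
  shows "(x + y) ^ n = (\<Sum>k\<le>n. of_nat (n choose k) * x ^ k * y ^ (n - k))"
proof (induction n)
  case 0
  show ?case by simp
next
  case (Suc n)
  have xy: "y * x ^ k = x ^ k * y" for k
    by (metis assms power_commuting_commutes)
  have y: "y * (of_nat m * x ^ k * y ^ j) = of_nat m * x ^ k * y ^ Suc j" for m k j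
  proof -
    have "y * (of_nat m * x ^ k * y ^ j) = of_nat m * (y * x ^ k) * y ^ j"
      using mult_of_nat_commute[of m y] by (simp flip: mult.assoc)
    then show ?thesis by (simp only: xy power_Suc mult.assoc)
  qed
  have x: "x * (of_nat m * x ^ k * y ^ j) = of_nat m * x ^ Suc k * y ^ j" for m k j
    using mult_of_nat_commute[of m x] by (simp flip: mult.assoc)
  have "(x + y) ^ Suc n = (\<Sum>k\<le>n. of_nat (n choose k) * x ^ Suc k * y ^ (n - k)) +
      (\<Sum>k\<le>n. of_nat (n choose k) * x ^ k * y ^ Suc (n - k))"
    by (simp only: power_Suc Suc distrib_right sum_distrib_left sum.distrib x[unfolded power_Suc] y[unfolded power_Suc])
  also have "(\<Sum>k\<le>n. of_nat (n choose k) * x ^ k * y ^ Suc (n - k)) =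
      (\<Sum>k\<le>n. of_nat (n choose k) * x ^ k * y ^ (Suc n - k))"
    by (intro sum.cong) (simp_all add: Suc_diff_le)
  also have "\<dots> = (\<Sum>k\<le>Suc n. of_nat (n choose k) * x ^ k * y ^ (Suc n - k))"
    by (simp add: binomial_eq_0)
  also have "\<dots> = y ^ Suc n + (\<Sum>k\<le>n. of_nat (n choose Suc k) * x ^ Suc k * y ^ (n - k))"
    by (subst sum.atMost_Suc_shift) simp
  also have "(\<Sum>k\<le>n. of_nat (n choose k) * x ^ Suc k * y ^ (n - k)) +
      (y ^ Suc n + (\<Sum>k\<le>n. of_nat (n choose Suc k) * x ^ Suc k * y ^ (n - k))) =
      y ^ Suc n + (\<Sum>k\<le>n. of_nat (Suc n choose Suc k) * x ^ Suc k * y ^ (n - k))"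
    by (simp add: distrib_right sum.distrib add.left_commute)
  also have "\<dots> = (\<Sum>k\<le>Suc n. of_nat (Suc n choose k) * x ^ k * y ^ (Suc n - k))"
    by (subst sum.atMost_Suc_shift) simp
  finally show ?case .
qed

lemma of_nat_mult_cscale: "of_nat n * x = of_nat n *\<^sub>C x" for x :: "'a::complex_algebra_1"
  by (induction n) (simp_all add: cscale_add_left distrib_right cscale_one)

lemma formal_exp_add:
  fixes f g :: "'a::complex_algebra_1 fls"
  assumes f: "f \<in> adic 1" and g: "g \<in> adic 1" and fg: "f * g = g * f"
  shows "formal_exp (f + g) = formal_exp f * formal_exp g"
  unfolding formal_exp_def
proof (rule series_subst_eqI[symmetric, OF adic_add[OF f g]])
  fix n
  have "series_trunc (fps_exp 1) (f + g) n = (\<Sum>k<n. \<Sum>i\<le>k.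
      (fps_nth (fps_exp 1) i *\<^sub>C f ^ i) * (fps_nth (fps_exp 1) (k - i) *\<^sub>C g ^ (k - i)))"
  proof (intro sum.cong refl)
    fix k
    show "fps_nth (fps_exp 1) k *\<^sub>C (f + g) ^ k = (\<Sum>i\<le>k.
      (fps_nth (fps_exp 1) i *\<^sub>C f ^ i) * (fps_nth (fps_exp 1) (k - i) *\<^sub>C g ^ (k - i)))"
      by (simp add: binomial_commuting[OF fg] complex_vector.scale_sum_right of_nat_mult_cscale
          cscale_mult_left cscale_mult_right cscale_cscale binomial_fact field_simps)
  qed
  then show "series_subst (fps_exp 1) f * series_subst (fps_exp 1) g -
      series_trunc (fps_exp 1) (f + g) n \<in> adic (int n)"
    by (simp only: series_product_trunc[OF f g])
qed

lemma formal_exp_uminus: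
  assumes "f \<in> adic 1"
  shows "formal_exp f * formal_exp (- f) = 1" "formal_exp (- f) * formal_exp f = 1"
  using formal_exp_add[of f "- f"] formal_exp_add[of "- f" f] assms
  by (simp_all add: adic_uminus formal_exp_zero)

lemma formal_exp_commute:
  "f \<in> adic 1 \<Longrightarrow> f * y = y * f \<Longrightarrow> formal_exp f * y = y * formal_exp f"
  by (rule formal_exp_intertwine)

lemma prod_list_formal_exp:
  fixes g :: "'b \<Rightarrow> 'a::complex_algebra_1 fls"
  assumes "\<And>i. i \<in> set xs \<Longrightarrow> g i \<in> adic 1"
    and "\<And>i j. i \<in> set xs \<Longrightarrow> j \<in> set xs \<Longrightarrow> g i * g j = g j * g i"
  shows "prod_list (map (\<lambda>i. formal_exp (g i)) xs) = formal_exp (sum_list (map g xs))"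
  using assms
proof (induction xs)
  case (Cons x xs)
  have "sum_list (map g xs) \<in> adic 1" and "g x * sum_list (map g xs) = sum_list (map g xs) * g x"
    using Cons.prems by (induction xs) (auto intro: adic_add simp: distrib_left distrib_right)
  with Cons show ?case by (simp add: formal_exp_add)
qed (simp add: formal_exp_zero)

lemma formal_ln1p_adic: "f \<in> adic 1 \<Longrightarrow> formal_ln1p f \<in> adic 1"
  using series_subst_adic[of f 1 "fps_ln 1"] by (simp add: formal_ln1p_def)

lemma formal_exp_ln1p:
  assumes "f \<in> adic 1"
  shows "formal_exp (formal_ln1p f) = 1 + f"
proof -
  \<comment> \<open>A compositional inverse requires a vanishing constant term, so the 1 is split
    off from the exponential and restored at the end.\<close>
  have "(fps_exp 1 - 1 :: complex fps) oo fps_ln 1 = fps_X"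
    unfolding fps_ln_fps_exp_inv[OF one_neq_zero] by (rule fps_inv_right) simp_all
  then have "(fps_exp 1 oo fps_ln 1) - (1 :: complex fps) = fps_X"
    by (simp add: fps_compose_sub_distrib)
  then have "series_subst (fps_exp 1 oo fps_ln 1) f - 1 = f"
    using series_subst_diff[OF assms, of "fps_exp 1 oo fps_ln 1" 1]
    by (simp add: series_subst_one series_subst_X assms)
  then show ?thesis
    by (simp add: formal_exp_def formal_ln1p_def series_subst_compose assms algebra_simps)
qed

lemma formal_ln1p_commute:
  "f \<in> adic 1 \<Longrightarrow> f * y = y * f \<Longrightarrow> formal_ln1p f * y = y * formal_ln1p f"
  by (simp add: formal_ln1p_def series_subst_intertwine)

text \<open>\<open>e\<^sup>S x e\<^sup>-\<^sup>S = x + [S, x] + \<half> [S, [S, x]]\<close> when the next iterated commutator vanishes;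
  the three summands are \<open>x\<close>, \<open>z\<close> and \<open>w\<close>.\<close>

lemma formal_exp_conjugate:
  fixes S x z w :: "'a::complex_algebra_1 fls"
  assumes S: "S \<in> adic 1" and x: "S * x = x * S + z" and z: "S * z = z * S + (w + w)"
    and w: "S * w = w * S"
  shows "formal_exp S * x = (x + z + w) * formal_exp S"
proof -
  define T where "T n = series_trunc (fps_exp 1) S n" for n
  \<comment> \<open>This is S^n x = \<Sum> binom(n, k) ad_S^k(x) S^(n-k), which stops at k = 2; as
    the double commutator is 2w, its coefficient is 2 binom(n, 2) = n (n - 1). The exponents n - 1
    and n - 2 are cut off at 0 only where the coefficient vanishes.\<close>
  have pow: "S ^ n * x = x * S ^ n + of_nat n *\<^sub>C (z * S ^ (n - 1)) +
      (of_nat n * (of_nat n - 1)) *\<^sub>C (w * S ^ (n - 2))" for n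
  proof (induction n)
    case (Suc n)
    have sx: "S * (x * a) = x * (S * a) + z * a" "S * (w * a) = w * (S * a)"
      "S * (z * a) = z * (S * a) + 2 *\<^sub>C (w * a)" for a
      using x z w cscale_add_left[of 1 1 "w * a"]
      by (simp_all add: mult.assoc[symmetric] distrib_right cscale_one)
    have z1: "of_nat n *\<^sub>C (z * (S * S ^ (n - 1))) = of_nat n *\<^sub>C (z * S ^ n)"
      by (cases n) simp_all
    have w1: "(of_nat n * (of_nat n - 1)) *\<^sub>C (w * (S * S ^ (n - 2))) =
        (of_nat n * (of_nat n - 1)) *\<^sub>C (w * S ^ (n - 1))"
    proof (cases "n < 2")
      case True
      then have "n = 0 \<or> n = 1" by auto
      then show ?thesis by auto
    next
      case False
      then have "n - 1 = Suc (n - 2)" by simp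
      then show ?thesis by (simp only: power_Suc)
    qed
    have "S ^ Suc n * x = S * (x * S ^ n + of_nat n *\<^sub>C (z * S ^ (n - 1)) +
      (of_nat n * (of_nat n - 1)) *\<^sub>C (w * S ^ (n - 2)))"
      by (simp add: Suc mult.assoc)
    also have "\<dots> = x * S ^ Suc n + (z * S ^ n + of_nat n *\<^sub>C (z * S ^ n)) +
        ((of_nat n * 2) *\<^sub>C (w * S ^ (n - 1)) + (of_nat n * (of_nat n - 1)) *\<^sub>C (w * S ^ (n - 1)))"
      by (simp only: distrib_left cscale_mult_right sx cscale_add_right cscale_cscale z1 w1 add.assoc power_Suc)
    also have "\<dots> = x * S ^ Suc n + (1 + of_nat n) *\<^sub>C (z * S ^ n) +
        (of_nat n * 2 + of_nat n * (of_nat n - 1)) *\<^sub>C (w * S ^ (n - 1))"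
      by (simp only: cscale_add_left cscale_one)
    finally show ?case by (simp add: algebra_simps)
  qed simp
  \<comment> \<open>Division by n! cancels the factors n and n (n - 1) and lowers the index by one
    and by two, hence the three different truncation lengths.\<close>
  have trunc: "T (n + 2) * x = x * T (n + 2) + z * T (n + 1) + w * T n" for n
  proof -
    have "T (n + 2) * x = x * T (n + 2) +
       (\<Sum>i<n + 2. (of_nat i / fact i) *\<^sub>C (z * S ^ (i - 1))) +
       (\<Sum>i<n + 2. (of_nat i * (of_nat i - 1) / fact i) *\<^sub>C (w * S ^ (i - 2)))"
      by (simp add: T_def sum_distrib_left sum_distrib_right cscale_mult_left cscale_mult_right pow
          cscale_add_right cscale_cscale sum.distrib del: sum.lessThan_Suc)
    also have "(\<Sum>i<n + 2. (of_nat i / fact i) *\<^sub>C (z * S ^ (i - 1))) = z * T (n + 1)"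
      by (simp add: T_def sum.lessThan_Suc_shift sum_distrib_left cscale_mult_right distrib_left
          del: sum.lessThan_Suc of_nat_Suc)
    also have "(\<Sum>i<n + 2. (of_nat i * (of_nat i - 1) / fact i) *\<^sub>C (w * S ^ (i - 2))) = w * T n"
    proof -
      have "of_nat (Suc (Suc i)) * (of_nat (Suc (Suc i)) - 1) / fact (Suc (Suc i)) = (1 / fact i :: complex)" for i
      proof -
        have "of_nat (Suc (Suc i)) - 1 = (of_nat (Suc i) :: complex)" by simp
        then show ?thesis by (simp del: of_nat_Suc)
      qed
      then show ?thesis
        by (simp add: T_def sum.lessThan_Suc_shift sum_distrib_left cscale_mult_right
            del: sum.lessThan_Suc of_nat_Suc fact_Suc)
    qed
    finally show ?thesis .
  qed
  obtain m where m: "x \<in> adic m" "z \<in> adic m" "w \<in> adic m"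
    using common_adic[of "{x, z, w}"] by (metis finite.emptyI finite.insertI insertCI)
  define R where "R n = formal_exp S - T n" for n
  have R: "R n \<in> adic (int n)" for n
    unfolding R_def T_def formal_exp_def by (rule series_subst_trunc[OF S])
  have "formal_exp S * x - (x + z + w) * formal_exp S \<in> adic (int n + m)" for n
  proof -
    have "formal_exp S * x - (x + z + w) * formal_exp S =
        R (n + 2) * x - x * R (n + 2) - z * R (n + 1) - w * R n"
      using trunc[of n] by (simp add: R_def left_diff_distrib right_diff_distrib distrib_right)
    also have "\<dots> \<in> adic (int n + m)"
    proof (intro adic_diff)
      show "R (n + 2) * x \<in> adic (int n + m)"
        using adic_mult[OF R m(1), of "n + 2"] by (rule adic_mono) simp
      show "x * R (n + 2) \<in> adic (int n + m)"
        using adic_mult[OF m(1) R, of "n + 2"] by (rule adic_mono) simp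
      show "z * R (n + 1) \<in> adic (int n + m)"
        using adic_mult[OF m(2) R, of "n + 1"] by (rule adic_mono) simp
      show "w * R n \<in> adic (int n + m)"
        using adic_mult[OF m(3) R, of n] by (rule adic_mono) simp
    qed
    finally show ?thesis .
  qed
  from adic_all_zero[OF this] show ?thesis by simp
qed

section \<open>Algebra homomorphisms on Laurent series\<close>

locale alg_hom =
  fixes h :: "'a::complex_algebra_1 \<Rightarrow> 'b::complex_algebra_1"
  assumes hom_add: "h (x + y) = h x + h y"
    and hom_mult: "h (x * y) = h x * h y"
    and hom_one: "h 1 = 1"
    and hom_scale: "h (c *\<^sub>C x) = c *\<^sub>C h x"
begin

lemma hom_zero: "h 0 = 0"
  using hom_add[of 0 0] by simp

lemma hom_uminus: "h (- x) = - h x"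
  using hom_add[of x "- x"] by (simp add: hom_zero eq_neg_iff_add_eq_0 add.commute)

lemma hom_diff: "h (x - y) = h x - h y"
  using hom_add[of x "- y"] by (simp add: hom_uminus)

lemma hom_sum: "h (sum g A) = (\<Sum>x\<in>A. h (g x))"
  by (induction A rule: infinite_finite_induct) (simp_all add: hom_zero hom_add)

lemma hom_power: "h (x ^ n) = h x ^ n"
  by (induction n) (simp_all add: hom_one hom_mult)

lemma fls_map_nth: "fls_nth (fls_map h f) n = h (fls_nth f n)"
  unfolding fls_map_def
  by (rule nth_Abs_fls_lower_bound[of "fls_subdegree f"]) (simp add: hom_zero)

lemma fls_map_adic: "f \<in> adic m \<Longrightarrow> fls_map h f \<in> adic m"
  by (simp add: adic_def fls_map_nth hom_zero)

lemma fls_map_hom: "alg_hom (fls_map h)"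
proof
  fix f g :: "'a fls" and c
  show "fls_map h (f + g) = fls_map h f + fls_map h g"
    by (rule fls_eqI) (simp add: fls_map_nth hom_add)
  show "fls_map h 1 = 1"
    by (rule fls_eqI) (simp add: fls_map_nth hom_one hom_zero)
  show "fls_map h (c *\<^sub>C f) = c *\<^sub>C fls_map h f"
    by (rule fls_eqI) (simp add: fls_map_nth cscale_fls_nth hom_scale)
  note f = adic_subdegree[of f] and g = adic_subdegree[of g]
  show "fls_map h (f * g) = fls_map h f * fls_map h g"
    by (rule fls_eqI)
       (simp add: fls_map_nth fls_times_nth_adic[OF f g]
         fls_times_nth_adic[OF fls_map_adic[OF f] fls_map_adic[OF g]] hom_sum hom_mult)
qed

lemma fls_map_series_subst:
  assumes "f \<in> adic 1"
  shows "fls_map h (series_subst p f) = series_subst p (fls_map h f)"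
proof (rule series_subst_eqI)
  interpret H: alg_hom "fls_map h" by (rule fls_map_hom)
  show "fls_map h f \<in> adic 1" by (rule fls_map_adic[OF assms])
  fix n
  have "fls_map h (series_subst p f) - series_trunc p (fls_map h f) n =
      fls_map h (series_subst p f - series_trunc p f n)"
    by (simp add: H.hom_diff H.hom_sum H.hom_scale H.hom_power)
  then show "fls_map h (series_subst p f) - series_trunc p (fls_map h f) n \<in> adic (int n)"
    by (simp only: fls_map_adic series_subst_trunc assms)
qed

lemma fls_map_formal_exp:
  "f \<in> adic 1 \<Longrightarrow> fls_map h (formal_exp f) = formal_exp (fls_map h f)"
  by (simp add: formal_exp_def fls_map_series_subst)

end

lemma fls_map_commute:
  fixes h :: "'a::complex_algebra_1 \<Rightarrow> 'c::complex_algebra_1"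
    and k :: "'b::complex_algebra_1 \<Rightarrow> 'c"
  assumes "alg_hom h" "alg_hom k" "\<And>x y. h x * k y = k y * h x"
  shows "fls_map h f * fls_map k g = fls_map k g * fls_map h f"
proof (rule fls_eqI)
  interpret h: alg_hom h by fact
  interpret k: alg_hom k by fact
  note f = h.fls_map_adic[OF adic_subdegree, of f] and g = k.fls_map_adic[OF adic_subdegree, of g]
  fix n
  show "fls_nth (fls_map h f * fls_map k g) n = fls_nth (fls_map k g * fls_map h f) n"
    unfolding fls_times_nth_adic[OF f g] fls_times_nth_adic[OF g f] h.fls_map_nth k.fls_map_nth
    by (rule sum.reindex_bij_witness[of _ "\<lambda>i. n - i" "\<lambda>i. n - i"]) (auto simp: assms(3))
qed

section \<open>The two tensor legs and the coproduct as homomorphisms on Laurent series\<close>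

lemma pure_tensor_left_hom:
  "alg_hom (\<lambda>a. pure_tensor a 1 :: ('a::complex_algebra_1, 'b::complex_algebra_1) tensor)"
  by unfold_locales
     (simp_all add: pure_tensor_add_left pure_tensor_mult pure_tensor_one pure_tensor_scale_left)

lemma pure_tensor_right_hom:
  "alg_hom (\<lambda>b. pure_tensor 1 b :: ('a::complex_algebra_1, 'b::complex_algebra_1) tensor)"
  by unfold_locales
     (simp_all add: pure_tensor_add_right pure_tensor_mult pure_tensor_one pure_tensor_scale_right)

lemma coproduct_alg_hom: "alg_hom coproduct"
  by unfold_locales (simp_all add: coproduct_hom)

text \<open>With these two commuting homomorphisms \<open>f \<boxtimes> g\<close> is the product
  \<open>inl f * inr g\<close>, so all rules for \<open>\<boxtimes>\<close> reduce to ring axioms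
  and homomorphism laws.\<close>

definition inl :: "'a::complex_algebra_1 fls \<Rightarrow> ('a, 'b::complex_algebra_1) tensor fls" where
  "inl = fls_map (\<lambda>a. pure_tensor a 1)"

definition inr :: "'b::complex_algebra_1 fls \<Rightarrow> ('a::complex_algebra_1, 'b) tensor fls" where
  "inr = fls_map (\<lambda>b. pure_tensor 1 b)"

global_interpretation inl: alg_hom inl
  unfolding inl_def by (rule alg_hom.fls_map_hom[OF pure_tensor_left_hom])

global_interpretation inr: alg_hom inr
  unfolding inr_def by (rule alg_hom.fls_map_hom[OF pure_tensor_right_hom])

global_interpretation fls_coproduct: alg_hom fls_coproduct
  unfolding fls_coproduct_def by (rule alg_hom.fls_map_hom[OF coproduct_alg_hom])

lemma fls_tensor_eq: "f \<boxtimes> g = inl f * inr g"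
  by (simp add: fls_tensor_def inl_def inr_def)

lemma inr_inl_commute: "inr g * inl f = inl f * inr g"
  unfolding inl_def inr_def
  by (rule fls_map_commute[OF pure_tensor_right_hom pure_tensor_left_hom])
     (simp add: pure_tensor_mult)

lemma inl_adic: "f \<in> adic m \<Longrightarrow> inl f \<in> adic m"
  and inr_adic: "g \<in> adic m \<Longrightarrow> inr g \<in> adic m"
  by (simp_all add: inl_def inr_def alg_hom.fls_map_adic pure_tensor_left_hom pure_tensor_right_hom)

lemma inr_formal_exp: "f \<in> adic 1 \<Longrightarrow> inr (formal_exp f) = formal_exp (inr f)"
  by (simp add: inr_def alg_hom.fls_map_formal_exp pure_tensor_right_hom)

section \<open>Commutators\<close>

definition comm :: "'a::ring \<Rightarrow> 'a \<Rightarrow> 'a" where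
  "comm x y = x * y - y * x"

lemma comm_add_left: "comm (x + y) z = comm x z + comm y z"
  and comm_add_right: "comm z (x + y) = comm z x + comm z y"
  and comm_diff_left: "comm (x - y) z = comm x z - comm y z"
  and comm_diff_right: "comm z (x - y) = comm z x - comm z y"
  by (simp_all add: comm_def algebra_simps)

lemma comm_mult_left: "comm (x * y) z = x * comm y z + comm x z * y"
  and comm_mult_right: "comm z (x * y) = comm z x * y + x * comm z y"
  by (simp_all add: comm_def algebra_simps)

lemma comm_swap: "comm x y = - comm y x"
  by (simp add: comm_def)

lemma comm_self [simp]: "comm x x = 0"
  by (simp add: comm_def)

lemma comm_scale_left: "comm (c *\<^sub>C x) y = c *\<^sub>C comm x y"
  and comm_scale_right: "comm x (c *\<^sub>C y) = c *\<^sub>C comm x y"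
  for x y :: "'a::complex_algebra_1"
  by (simp_all add: comm_def cscale_mult_left cscale_mult_right
      complex_vector.scale_right_diff_distrib)

lemma comm_sum_left: "comm (sum g A) y = (\<Sum>x\<in>A. comm (g x) y)"
  and comm_sum_right: "comm y (sum g A) = (\<Sum>x\<in>A. comm y (g x))"
  by (simp_all add: comm_def sum_distrib_left sum_distrib_right sum_subtractf)

lemma comm_eq_0_iff: "comm x y = 0 \<longleftrightarrow> x * y = y * x"
  by (simp add: comm_def)

lemma comm_eq_imp_mult: "comm x y = z \<Longrightarrow> x * y = y * x + z"
  by (auto simp: comm_def)

lemma comm_inverse_eq_0:
  fixes u t y :: "'a::ring_1"
  assumes "t * u = 1" "u * t = 1" "comm u y = 0"
  shows "comm t y = 0"
proof -
  have "t * y = t * (y * u) * t" by (simp add: assms(2) mult.assoc)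
  also have "t * (y * u) = t * u * y" using assms(3) by (simp add: comm_eq_0_iff mult.assoc)
  finally show ?thesis by (simp add: assms(1) comm_eq_0_iff)
qed

section \<open>The symplectic commutation relations\<close>

definition kd :: "nat \<Rightarrow> nat \<Rightarrow> complex" where
  "kd i j = (if i = j then 1 else 0)"

lemma kd_simps [simp]: "kd i i = 1" "i \<noteq> j \<Longrightarrow> kd i j = 0"
  by (simp_all add: kd_def)

text \<open>\<open>e i j\<close>, \<open>p i j\<close> and \<open>f i j\<close> play the roles of \<open>E\<^sub>i\<^sub>-\<^sub>j\<close>, \<open>E\<^sub>i\<^sub>+\<^sub>j\<close> and \<open>F\<^sub>i\<^sub>+\<^sub>j\<close>. With \<open>e i j\<close>
  available for all pairs of indices, \<open>F\<^sub>i\<^sub>-\<^sub>j\<close> is \<open>e j i\<close> and \<open>H\<^sub>i\<^sub>i\<close> is half of \<open>e i i\<close>.\<close>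

locale sp_relations =
  fixes I :: "nat set" and e p f :: "nat \<Rightarrow> nat \<Rightarrow> 'a::complex_algebra_1"
  assumes p_sym: "i \<in> I \<Longrightarrow> j \<in> I \<Longrightarrow> p i j = p j i"
    and f_sym: "i \<in> I \<Longrightarrow> j \<in> I \<Longrightarrow> f i j = f j i"
    and ee: "i \<in> I \<Longrightarrow> j \<in> I \<Longrightarrow> k \<in> I \<Longrightarrow> l \<in> I \<Longrightarrow>
      comm (e i j) (e k l) = kd j k *\<^sub>C e i l - kd i l *\<^sub>C e k j"
    and ep: "i \<in> I \<Longrightarrow> j \<in> I \<Longrightarrow> k \<in> I \<Longrightarrow> l \<in> I \<Longrightarrow>
      comm (e i j) (p k l) = kd j k *\<^sub>C p i l + kd j l *\<^sub>C p i k"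
    and ef: "i \<in> I \<Longrightarrow> j \<in> I \<Longrightarrow> k \<in> I \<Longrightarrow> l \<in> I \<Longrightarrow>
      comm (e i j) (f k l) = - (kd i k *\<^sub>C f j l) - kd i l *\<^sub>C f j k"
    and pp: "i \<in> I \<Longrightarrow> j \<in> I \<Longrightarrow> k \<in> I \<Longrightarrow> l \<in> I \<Longrightarrow> comm (p i j) (p k l) = 0"
    and ff: "i \<in> I \<Longrightarrow> j \<in> I \<Longrightarrow> k \<in> I \<Longrightarrow> l \<in> I \<Longrightarrow> comm (f i j) (f k l) = 0"
    and pf: "i \<in> I \<Longrightarrow> j \<in> I \<Longrightarrow> k \<in> I \<Longrightarrow> l \<in> I \<Longrightarrow>
      comm (p i j) (f k l) =
        kd j k *\<^sub>C e i l + kd j l *\<^sub>C e i k + kd i k *\<^sub>C e j l + kd i l *\<^sub>C e j k"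

text \<open>The index \<open>o1\<close> is the one to be removed, and \<open>t\<close> stands for
  e^-\<sigma>. It is characterised as the inverse of 1 + Z, which keeps the deformation purely
  algebraic and free of power series.\<close>

locale sp_deformation = sp_relations +
  fixes o1 :: nat and t
  assumes o1: "o1 \<in> I" and t: "t * (1 + p o1 o1) = 1" "(1 + p o1 o1) * t = 1"
begin

abbreviation "A \<equiv> e o1"
abbreviation "B \<equiv> p o1"
abbreviation "Z \<equiv> p o1 o1"

lemma t_comm: "comm t x = 0" if "comm Z x = 0"
  by (rule comm_inverse_eq_0[OF t]) (use that in \<open>simp add: comm_def algebra_simps\<close>)

lemma heisenberg:
  assumes "i \<in> I - {o1}" "j \<in> I - {o1}"
  shows "comm (A i) (A j) = 0" "comm (A i) (B j) = kd i j *\<^sub>C Z" "comm (B i) (B j) = 0"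
    "comm Z (A i) = 0" "comm Z (B i) = 0"
  using assms o1 ee[of o1 i o1 j] ep[of o1 i o1 j] pp[of o1 i o1 j] pp[of o1 o1 o1 i]
    ep[of o1 i o1 o1]
  by (auto simp: comm_swap[of Z "A i"])

lemma action:
  assumes "i \<in> I - {o1}" "j \<in> I - {o1}" "k \<in> I - {o1}"
  shows "comm (A k) (e i j) = kd k i *\<^sub>C A j" "comm (B k) (e i j) = - (kd j k *\<^sub>C B i)"
    "comm (A k) (p i j) = kd k i *\<^sub>C B j + kd k j *\<^sub>C B i" "comm (B k) (p i j) = 0"
    "comm (A k) (f i j) = 0" "comm (B k) (f i j) = kd k i *\<^sub>C A j + kd k j *\<^sub>C A i"
    "comm Z (e i j) = 0" "comm Z (p i j) = 0" "comm Z (f i j) = 0"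
  using assms o1 ee[of o1 k i j] ep[of i j o1 k] ep[of o1 k i j] pp[of o1 k i j] ef[of o1 k i j]
    pf[of o1 k i j] ep[of i j o1 o1] pp[of o1 o1 i j] pf[of o1 o1 i j] p_sym[of i o1]
  by (auto simp: comm_swap[of "p o1 _" "e i j"])

definition p' :: "nat \<Rightarrow> nat \<Rightarrow> 'a" where "p' i j = p i j - B i * B j * t"
definition f' :: "nat \<Rightarrow> nat \<Rightarrow> 'a" where "f' i j = f i j - A i * A j"

text \<open>With X = [B_i B_j, f_kl], Y = -[p_ij, A_k A_l] and [B_i B_j, A_k A_l] = -X Z, the
  corrections contribute Y - X t - X Z t = Y - X (1 + Z) t = Y - X. Here X and Y differ only in the
  order of A and B, and reordering produces the central term \<open>kd i k * kd j l\<close> times Z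
  twice, with opposite signs; hence X = Y.\<close>

lemma deformed_pf:
  assumes ijkl: "i \<in> I - {o1}" "j \<in> I - {o1}" "k \<in> I - {o1}" "l \<in> I - {o1}"
  shows "comm (p' i j) (f' k l) = comm (p i j) (f k l)"
proof -
  define X where "X = (kd i k *\<^sub>C A l + kd i l *\<^sub>C A k) * B j + B i * (kd j k *\<^sub>C A l + kd j l *\<^sub>C A k)"
  define Y where "Y = (kd k i *\<^sub>C B j + kd k j *\<^sub>C B i) * A l + A k * (kd l i *\<^sub>C B j + kd l j *\<^sub>C B i)"
  have BA: "comm (B i) (A j) = - (kd j i *\<^sub>C Z)" if "i \<in> I - {o1}" "j \<in> I - {o1}" for i j
    using heisenberg(2)[OF that(2,1)] comm_swap[of "B i" "A j"] by simp
  have Zc: "Z * A i = A i * Z" "Z * B i = B i * Z" if "i \<in> I - {o1}" for i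
    using heisenberg(4,5)[OF that that] by (simp_all add: comm_eq_0_iff)
  have "X - Y = kd i k *\<^sub>C comm (A l) (B j) - kd j l *\<^sub>C comm (A k) (B i)"
    by (simp add: X_def Y_def comm_def kd_def algebra_simps complex_vector.scale_right_diff_distrib
        cscale_mult_left cscale_mult_right)
  also have "\<dots> = 0"
    using ijkl by (simp add: heisenberg cscale_cscale kd_def)
  finally have XY: "X = Y" by simp
  have BBf: "comm (B i * B j) (f k l) = X"
    using ijkl by (simp add: comm_mult_left action X_def add.commute)
  have BBA: "comm (B i * B j) (A k * A l) = - (X * Z)"
  proof -
    have BAA: "comm (B i) (A k * A l) = - ((kd i k *\<^sub>C A l + kd i l *\<^sub>C A k) * Z)"
      if "i \<in> I - {o1}" for i
      using ijkl that
      by (simp add: comm_mult_right BA Zc kd_def algebra_simps cscale_mult_left cscale_mult_right)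
    show ?thesis
      using ijkl
      by (simp add: comm_mult_left BAA X_def Zc algebra_simps)
  qed
  have pA: "comm (p i j) (A k) = - (kd k i *\<^sub>C B j + kd k j *\<^sub>C B i)" if "k \<in> I - {o1}" for k
    using action(3)[OF ijkl(1,2) that] comm_swap[of "p i j" "A k"] by simp
  have pAA: "comm (p i j) (A k * A l) = - Y"
    using ijkl by (simp add: comm_mult_right pA Y_def algebra_simps)
  have t1: "comm (B i * B j * t) x = comm (B i * B j) x * t" if "comm t x = 0" for x
    by (simp add: comm_mult_left that)
  have "comm Z (A k * A l) = 0"
    using ijkl by (simp add: comm_mult_right heisenberg)
  then have "comm (p' i j) (f' k l) = comm (p i j) (f k l) + Y - X * t - X * Z * t"
    using ijkl
    by (simp add: p'_def f'_def comm_diff_left comm_diff_right pAA t1 t_comm action BBf BBA)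
  also have "\<dots> = comm (p i j) (f k l) + Y - X * ((1 + Z) * t)"
    by (simp add: distrib_left distrib_right mult.assoc)
  finally show ?thesis by (simp add: t XY)
qed

text \<open>Under \<open>e i j\<close> the elements B_k and A_k transform as the vector
  representation and its dual while \<open>t\<close> is invariant, so the corrections transform
  exactly like \<open>p\<close> and \<open>f\<close>. Within the family \<open>p'\<close>, and
  within \<open>f'\<close>, all factors commute. The mixed bracket is
  \<open>deformed_pf\<close>.\<close>

lemma deformed_relations: "sp_relations (I - {o1}) e p' f'"
proof
  fix i j k l assume ij: "i \<in> I - {o1}" "j \<in> I - {o1}"
  show "p' i j = p' j i" "f' i j = f' j i"
    using ij heisenberg[OF ij] p_sym[of i j] f_sym[of i j]
    by (simp_all add: p'_def f'_def comm_eq_0_iff)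
  assume kl: "k \<in> I - {o1}" "l \<in> I - {o1}"
  have eA: "comm (e i j) (A k) = - (kd i k *\<^sub>C A j)" if "k \<in> I - {o1}" for k
    using action(1)[OF ij that] comm_swap[of "e i j" "A k"] by (simp add: kd_def)
  have eB: "comm (e i j) (B k) = kd j k *\<^sub>C B i" if "k \<in> I - {o1}" for k
    using action(2)[OF ij that] comm_swap[of "e i j" "B k"] by simp
  have et: "comm (e i j) t = 0"
    using t_comm[OF action(7)[OF ij ij(1)]] comm_swap[of "e i j" t] by simp
  show "comm (e i j) (e k l) = kd j k *\<^sub>C e i l - kd i l *\<^sub>C e k j"
    using ij kl by (simp add: ee)
  have BB: "B k * B i = B i * B k" and AA: "A k * A j = A j * A k"
    using heisenberg(3)[OF ij(1) kl(1)] heisenberg(1)[OF ij(2) kl(1)] by (simp_all add: comm_eq_0_iff)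
  then have BBt: "B k * (B i * t) = B i * (B k * t)"
    by (simp flip: mult.assoc)
  show "comm (e i j) (p' k l) = kd j k *\<^sub>C p' i l + kd j l *\<^sub>C p' i k"
    using ij kl
    by (simp add: p'_def comm_diff_right comm_mult_right et eB ep kd_def algebra_simps BBt)
  show "comm (e i j) (f' k l) = - (kd i k *\<^sub>C f' j l) - kd i l *\<^sub>C f' j k"
    using ij kl
    by (simp add: f'_def comm_diff_right comm_mult_right eA ef kd_def algebra_simps AA)
  have pt: "comm (p i j) t = 0" "comm t (p i j) = 0" if "i \<in> I - {o1}" "j \<in> I - {o1}" for i j
    using t_comm[OF action(8)[OF that that(1)]] comm_swap[of "p i j" t] by simp_all
  have Bt: "comm (B i) t = 0" "comm t (B i) = 0" if "i \<in> I - {o1}" for i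
    using t_comm[OF heisenberg(5)[OF that that]] comm_swap[of "B i" t] by simp_all
  have pB: "comm (p i j) (B k) = 0" if "i \<in> I - {o1}" "j \<in> I - {o1}" "k \<in> I - {o1}" for i j k
    using action(4)[OF that] comm_swap[of "p i j" "B k"] by simp
  show "comm (p' i j) (p' k l) = 0"
    using ij kl
    by (simp add: p'_def comm_diff_left comm_diff_right comm_mult_left comm_mult_right pp pt Bt pB
        action heisenberg)
  have fA: "comm (f i j) (A k) = 0" if "i \<in> I - {o1}" "j \<in> I - {o1}" "k \<in> I - {o1}" for i j k
    using action(5)[OF that] comm_swap[of "f i j" "A k"] by simp
  show "comm (f' i j) (f' k l) = 0"
    using ij kl
    by (simp add: f'_def comm_diff_left comm_diff_right comm_mult_left comm_mult_right ff fA
        action heisenberg)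
  show "comm (p' i j) (f' k l) =
      kd j k *\<^sub>C e i l + kd j l *\<^sub>C e i k + kd i k *\<^sub>C e j l + kd i l *\<^sub>C e j k"
    using ij kl by (simp add: deformed_pf pf)
qed

end

section \<open>The generators of the symplectic Lie algebra\<close>

lemma mat_unit_index:
  "x < 2 * N \<Longrightarrow> y < 2 * N \<Longrightarrow> mat_unit N a b $$ (x, y) = kd (Suc x) a * kd (Suc y) b"
  by (simp add: mat_unit_def kd_def)

lemma mat_unit_dim [simp]: "dim_row (mat_unit N a b) = 2 * N" "dim_col (mat_unit N a b) = 2 * N"
  by (simp_all add: mat_unit_def)

lemma mat_unit_mult_index:
  assumes "x < 2 * N" "y < 2 * N" "b \<in> {1..2 * N}"
  shows "(mat_unit N a b * mat_unit N c d) $$ (x, y) = kd b c * (kd (Suc x) a * kd (Suc y) d)"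
proof -
  obtain b' where b: "b = Suc b'" "b' < 2 * N"
    using assms(3) by (cases b) auto
  have "(mat_unit N a b * mat_unit N c d) $$ (x, y) =
      (\<Sum>z<2 * N. kd (Suc x) a * kd (Suc z) b * (kd (Suc z) c * kd (Suc y) d))"
    using assms by (simp add: scalar_prod_def mat_unit_index lessThan_atLeast0)
  also have "\<dots> = (\<Sum>z<2 * N. if z = b' then kd (Suc x) a * (kd b c * kd (Suc y) d) else 0)"
    by (intro sum.cong) (auto simp: b kd_def)
  finally show ?thesis using b by simp
qed

text \<open>Each generator matrix is one matrix unit plus a multiple of another
  (\<open>generator_mats_lincomb\<close>), so this single expansion serves all six commutators
  below.\<close>

lemma mat_commutator_lincomb:
  assumes "A \<in> carrier_mat n n" "B \<in> carrier_mat n n" "C \<in> carrier_mat n n" "D \<in> carrier_mat n n"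
    and "x < n" "y < n"
  shows "mat_commutator (A + s \<cdot>\<^sub>m B) (C + t \<cdot>\<^sub>m D) $$ (x, y) =
    (A * C) $$ (x, y) + t * (A * D) $$ (x, y) + s * (B * C) $$ (x, y) + s * t * (B * D) $$ (x, y)
    - ((C * A) $$ (x, y) + t * (D * A) $$ (x, y) + s * (C * B) $$ (x, y) + s * t * (D * B) $$ (x, y))"
  using assms
  by (simp add: mat_commutator_def scalar_prod_def sum.distrib sum_distrib_left algebra_simps)

lemma kd_shift: "kd (N + i) (N + j) = kd i j"
  by (simp add: kd_def)

lemma kd_commute: "kd i j = kd j i"
  by (simp add: kd_def)

lemma generator_mats_lincomb:
  "E_minus_mat N i j = mat_unit N i j + (- 1) \<cdot>\<^sub>m mat_unit N (N + j) (N + i)"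
  "E_plus_mat N i j = mat_unit N i (N + j) + 1 \<cdot>\<^sub>m mat_unit N j (N + i)"
  "F_plus_mat N i j = mat_unit N (N + i) j + 1 \<cdot>\<^sub>m mat_unit N (N + j) i"
  by (auto simp: E_minus_mat_def E_plus_mat_def F_plus_mat_def)

lemma generator_mats_dim [simp]:
  "dim_row (E_minus_mat N i j) = 2 * N" "dim_col (E_minus_mat N i j) = 2 * N"
  "dim_row (E_plus_mat N i j) = 2 * N" "dim_col (E_plus_mat N i j) = 2 * N"
  "dim_row (F_plus_mat N i j) = 2 * N" "dim_col (F_plus_mat N i j) = 2 * N"
  by (simp_all add: generator_mats_lincomb)

lemma mat_commutator_dim:
  assumes "dim_row A = n" "dim_col A = n" "dim_row B = n" "dim_col B = n"
  shows "dim_row (mat_commutator A B) = n" "dim_col (mat_commutator A B) = n"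
  using assms by (simp_all add: mat_commutator_def)

lemma generator_mats_commutator:
  assumes ijkl: "i \<in> {1..N}" "j \<in> {1..N}" "k \<in> {1..N}" "l \<in> {1..N}"
  shows "mat_commutator (E_minus_mat N i j) (E_minus_mat N k l) =
      kd j k \<cdot>\<^sub>m E_minus_mat N i l - kd i l \<cdot>\<^sub>m E_minus_mat N k j" (is ?ee)
    and "mat_commutator (E_minus_mat N i j) (E_plus_mat N k l) =
      kd j k \<cdot>\<^sub>m E_plus_mat N i l + kd j l \<cdot>\<^sub>m E_plus_mat N i k" (is ?ep)
    and "mat_commutator (E_minus_mat N i j) (F_plus_mat N k l) =
      - (kd i k \<cdot>\<^sub>m F_plus_mat N j l) - kd i l \<cdot>\<^sub>m F_plus_mat N j k" (is ?ef)
    and "mat_commutator (E_plus_mat N i j) (E_plus_mat N k l) = 0\<^sub>m (2 * N) (2 * N)" (is ?pp)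
    and "mat_commutator (F_plus_mat N i j) (F_plus_mat N k l) = 0\<^sub>m (2 * N) (2 * N)" (is ?ff)
    and "mat_commutator (E_plus_mat N i j) (F_plus_mat N k l) =
      kd j k \<cdot>\<^sub>m E_minus_mat N i l + kd j l \<cdot>\<^sub>m E_minus_mat N i k
      + kd i k \<cdot>\<^sub>m E_minus_mat N j l + kd i l \<cdot>\<^sub>m E_minus_mat N j k" (is ?pf)
proof -
  have range: "a \<in> {1..2 * N}" "N + a \<in> {1..2 * N}" if "a \<in> {1..N}" for a
    using that by auto
  have kd: "kd (N + a) b = 0" "kd a (N + b) = 0" if "a \<in> {1..N}" "b \<in> {1..N}" for a b
    using that by (auto simp: kd_def)
  note entry = mat_commutator_lincomb[OF mat_unit_carrier mat_unit_carrier mat_unit_carrier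
      mat_unit_carrier]
  note kd_flip = kd_commute[of k i] kd_commute[of l i] kd_commute[of k j] kd_commute[of l j]
  note rules = mat_unit_mult_index mat_unit_index kd range ijkl kd_shift kd_flip
  show ?ee ?ep ?ef ?pp ?ff ?pf
    by (rule eq_matI,
        simp add: generator_mats_lincomb entry rules
          del: index_mult_mat(1) atLeastAtMost_iff One_nat_def,
        simp_all add: mat_commutator_dim algebra_simps)+
qed

text \<open>This is \<xi>^m x, since shifting by \<open>- m\<close> raises every exponent by m. The
  degree m is 1, 0, -1 on \<open>E_plus\<close>, \<open>E_minus\<close>, \<open>F_plus\<close>, and
  degrees add under the bracket (\<open>gen_comm\<close>); this is why the rescaling preserves the
  relations.\<close>

definition gen :: "int \<Rightarrow> 'g::complex_lie_algebra \<Rightarrow> 'g uea fls" where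
  "gen m x = fls_shift (- m) (fls_const (uea_in x))"

lemma gen_nth: "fls_nth (gen m x) k = (if k = m then uea_in x else 0)"
  by (simp add: gen_def)

lemma uea_in_zero: "uea_in 0 = 0"
  using uea_in_add[of 0 0] by simp

lemma gen_lincomb:
  fixes x y :: "'g::complex_lie_algebra"
  shows "gen m (x + y) = gen m x + gen m y" "gen m (c *\<^sub>C x) = c *\<^sub>C gen m x" "gen m (0 :: 'g) = 0"
  "gen m (- x) = - gen m x" "gen m (x - y) = gen m x - gen m y"
proof -
  have add: "gen m (x + y) = gen m x + gen m y" for x y :: 'g
    by (rule fls_eqI) (simp add: gen_nth uea_in_add)
  show "gen m (x + y) = gen m x + gen m y" by (rule add)
  show "gen m (c *\<^sub>C x) = c *\<^sub>C gen m x"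
    by (rule fls_eqI) (simp add: gen_nth uea_in_scale cscale_fls_nth)
  show zero: "gen m (0 :: 'g) = 0"
    by (rule fls_eqI) (simp add: gen_nth uea_in_zero)
  have minus: "gen m (- x) = - gen m x" for x :: 'g
    using add[of x "- x"] by (simp add: zero eq_neg_iff_add_eq_0 add.commute)
  show "gen m (- x) = - gen m x" by (rule minus)
  show "gen m (x - y) = gen m x - gen m y"
    using add[of x "- y"] minus[of y] by simp
qed

lemma gen_comm: "comm (gen m x) (gen k y) = gen (m + k) (lie x y)"
  by (simp add: comm_def gen_def fls_times_both_shifted_simp fls_const_mult_const uea_in_lie add.commute
      flip: fls_shift_minus fls_minus_const)

lemma gen_adic: "gen m x \<in> adic m"
  by (simp add: adic_def gen_nth)

lemma fls_coproduct_gen: "fls_coproduct (gen m x) = gen m x \<boxtimes> 1 + 1 \<boxtimes> gen m x"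
proof -
  have "fls_coproduct (gen m x) = inl (gen m x) + inr (gen m x)"
    by (rule fls_eqI)
       (simp add: fls_coproduct_def inl_def inr_def alg_hom.fls_map_nth coproduct_alg_hom
         pure_tensor_left_hom pure_tensor_right_hom gen_nth coproduct_hom
         alg_hom.hom_zero[OF coproduct_alg_hom] alg_hom.hom_zero[OF pure_tensor_left_hom]
         alg_hom.hom_zero[OF pure_tensor_right_hom])
  then show ?thesis by (simp add: fls_tensor_eq inl.hom_one inr.hom_one)
qed

lemma generators_gen:
  "(E_minus i j :: 'n::finite sp uea fls) = gen 0 (Abs_sp (E_minus_mat CARD('n) i j))"
  "(E_plus i j :: 'n sp uea fls) = gen 1 (Abs_sp (E_plus_mat CARD('n) i j))"
  "(F_plus i j :: 'n sp uea fls) = gen (- 1) (Abs_sp (F_plus_mat CARD('n) i j))"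
  by (simp_all add: E_minus_def E_plus_def F_plus_def gen_def fls_X_times_conv_shift
      fls_X_inv_times_conv_shift)

lemma F_minus_eq: "F_minus i j = E_minus j i"
  by (simp add: F_minus_def E_minus_def F_minus_mat_def E_minus_mat_def)

lemma Abs_sp_lincomb:
  assumes "A \<in> sp_mats CARD('n)"
  shows "B \<in> sp_mats CARD('n) \<Longrightarrow> Abs_sp (A + B) = Abs_sp A + (Abs_sp B :: 'n::finite sp)"
    "B \<in> sp_mats CARD('n) \<Longrightarrow> Abs_sp (A - B) = Abs_sp A - (Abs_sp B :: 'n sp)"
    "B \<in> sp_mats CARD('n) \<Longrightarrow> Abs_sp (mat_commutator A B) = lie (Abs_sp A) (Abs_sp B :: 'n sp)"
    "Abs_sp (- A) = - (Abs_sp A :: 'n sp)"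
    "Abs_sp (c \<cdot>\<^sub>m A) = c *\<^sub>C (Abs_sp A :: 'n sp)"
  using assms
  by (simp_all add: plus_sp.abs_eq minus_sp.abs_eq uminus_sp.abs_eq cscale_sp.abs_eq lie_sp.abs_eq
      eq_onp_same_args)

lemma H_cartan_eq:
  assumes "i \<in> {1..CARD('n)}"
  shows "(H_cartan i :: 'n::finite sp uea fls) = (1 / 2) *\<^sub>C E_minus i i"
proof -
  have "H_mat CARD('n) i = (1 / 2) \<cdot>\<^sub>m E_minus_mat CARD('n) i i"
    by (simp add: H_mat_def E_minus_mat_def)
  then have "Abs_sp (H_mat CARD('n) i) = (1 / 2) *\<^sub>C (Abs_sp (E_minus_mat CARD('n) i i) :: 'n sp)"
    using Abs_sp_lincomb(5)[OF generator_mats_in_sp(1)[OF assms assms]]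
    by simp
  then have "(H_cartan i :: 'n sp uea fls) = gen 0 ((1 / 2) *\<^sub>C Abs_sp (E_minus_mat CARD('n) i i))"
    by (simp add: H_cartan_def gen_def)
  then show ?thesis by (simp only: gen_lincomb generators_gen)
qed

lemma generators_relations:
  "sp_relations {1..CARD('n)} E_minus E_plus (F_plus :: nat \<Rightarrow> nat \<Rightarrow> 'n::finite sp uea fls)"
proof
  fix i j k l assume ij: "i \<in> {1..CARD('n)}" "j \<in> {1..CARD('n)}"
  have "E_plus_mat CARD('n) i j = E_plus_mat CARD('n) j i" "F_plus_mat CARD('n) i j = F_plus_mat CARD('n) j i"
    by (auto simp: E_plus_mat_def F_plus_mat_def intro!: comm_add_mat)
  then show "(E_plus i j :: 'n sp uea fls) = E_plus j i" "(F_plus i j :: 'n sp uea fls) = F_plus j i"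
    by (simp_all add: generators_gen)
  assume kl: "k \<in> {1..CARD('n)}" "l \<in> {1..CARD('n)}"
  note table = generator_mats_commutator[OF ij kl]
  note rules = generators_gen gen_comm generator_mats_in_sp table Abs_sp_lincomb(1,2,4,5)
    gen_lincomb sp_mats_smult sp_mats_uminus sp_mats_add
  have zero: "Abs_sp (0\<^sub>m (2 * CARD('n)) (2 * CARD('n))) = (0 :: 'n sp)"
    by (simp add: zero_sp_def)
  show "comm (E_minus i j) (E_minus k l) = kd j k *\<^sub>C E_minus i l - kd i l *\<^sub>C (E_minus k j :: 'n sp uea fls)"
    using ij kl by (simp add: rules flip: Abs_sp_lincomb(3))
  show "comm (E_minus i j) (E_plus k l) = kd j k *\<^sub>C E_plus i l + kd j l *\<^sub>C (E_plus i k :: 'n sp uea fls)"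
    using ij kl by (simp add: rules flip: Abs_sp_lincomb(3))
  show "comm (E_minus i j) (F_plus k l) = - (kd i k *\<^sub>C F_plus j l) - kd i l *\<^sub>C (F_plus j k :: 'n sp uea fls)"
    using ij kl by (simp add: rules flip: Abs_sp_lincomb(3))
  show "comm (E_plus i j) (E_plus k l) = (0 :: 'n sp uea fls)"
    using ij kl by (simp add: rules zero flip: Abs_sp_lincomb(3))
  show "comm (F_plus i j) (F_plus k l) = (0 :: 'n sp uea fls)"
    using ij kl by (simp add: rules zero flip: Abs_sp_lincomb(3))
  show "comm (E_plus i j) (F_plus k l) = kd j k *\<^sub>C E_minus i l + kd j l *\<^sub>C E_minus i k
      + kd i k *\<^sub>C E_minus j l + kd i l *\<^sub>C (E_minus j k :: 'n sp uea fls)"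
    using ij kl by (simp add: rules flip: Abs_sp_lincomb(3))
qed

section \<open>Conjugation by the twist\<close>

declare One_nat_def [simp del]

lemma tensor_mult: "(a \<boxtimes> b) * (c \<boxtimes> d) = (a * c) \<boxtimes> (b * d)"
proof -
  have "(a \<boxtimes> b) * (c \<boxtimes> d) = inl a * (inr b * inl c) * inr d"
    by (simp add: fls_tensor_eq mult.assoc)
  then show ?thesis
    by (simp add: inr_inl_commute fls_tensor_eq inl.hom_mult inr.hom_mult mult.assoc)
qed

lemma tensor_bilinear:
  "(a + a') \<boxtimes> b = a \<boxtimes> b + a' \<boxtimes> b" "a \<boxtimes> (b + b') = a \<boxtimes> b + a \<boxtimes> b'"
  "(a - a') \<boxtimes> b = a \<boxtimes> b - a' \<boxtimes> b" "a \<boxtimes> (b - b') = a \<boxtimes> b - a \<boxtimes> b'"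
  "(- a) \<boxtimes> b = - (a \<boxtimes> b)" "a \<boxtimes> (- b) = - (a \<boxtimes> b)"
  "(c *\<^sub>C a) \<boxtimes> b = c *\<^sub>C (a \<boxtimes> b)" "a \<boxtimes> (c *\<^sub>C b) = c *\<^sub>C (a \<boxtimes> b)"
  "0 \<boxtimes> b = 0" "a \<boxtimes> 0 = 0" "1 \<boxtimes> 1 = 1"
  by (simp_all add: fls_tensor_eq inl.hom_add inr.hom_add inl.hom_diff inr.hom_diff inl.hom_uminus
      inr.hom_uminus inl.hom_scale inr.hom_scale inl.hom_zero inr.hom_zero inl.hom_one inr.hom_one
      cscale_mult_left cscale_mult_right algebra_simps)

lemma tensor_adic: "a \<in> adic m \<Longrightarrow> b \<in> adic k \<Longrightarrow> a \<boxtimes> b \<in> adic (m + k)"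
  by (simp add: fls_tensor_eq adic_mult inl_adic inr_adic)

lemma tensor_formal_exp: "f \<in> adic 1 \<Longrightarrow> 1 \<boxtimes> formal_exp f = formal_exp (1 \<boxtimes> f)"
  by (simp add: fls_tensor_eq inl.hom_one inr_formal_exp)

lemma ring_inverse_eq: "x * y = 1 \<Longrightarrow> y * x = 1 \<Longrightarrow> ring_inverse x = y"
  unfolding ring_inverse_def
  by (rule the_equality) (simp, metis mult.assoc mult.left_neutral mult.right_neutral)

text \<open>For invertible \<open>u\<close> this says u x u^-1 = y. Written as an intertwining
  relation it is additive, multiplicative and composable without any inverse; the inverse of the
  twist enters only in \<open>twisted_coproductI\<close>.\<close>

definition conj_by :: "'a::ring_1 \<Rightarrow> 'a \<Rightarrow> 'a \<Rightarrow> bool" where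
  "conj_by u x y \<longleftrightarrow> u * x = y * u"

lemma conj_by_add: "conj_by u x y \<Longrightarrow> conj_by u x' y' \<Longrightarrow> conj_by u (x + x') (y + y')"
  and conj_by_diff: "conj_by u x y \<Longrightarrow> conj_by u x' y' \<Longrightarrow> conj_by u (x - x') (y - y')"
  by (simp_all add: conj_by_def algebra_simps)

lemma conj_by_scale: "conj_by u x y \<Longrightarrow> conj_by u (c *\<^sub>C x) (c *\<^sub>C y)"
  for x :: "'a::complex_algebra_1"
  by (simp add: conj_by_def cscale_mult_left cscale_mult_right)

lemma conj_by_one: "conj_by u 1 1"
  by (simp add: conj_by_def)

lemma conj_by_mult: "conj_by u x y \<Longrightarrow> conj_by u x' y' \<Longrightarrow> conj_by u (x * x') (y * y')"
  unfolding conj_by_def by (metis mult.assoc)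

lemma conj_by_trans: "conj_by v x y \<Longrightarrow> conj_by u y z \<Longrightarrow> conj_by (u * v) x z"
  unfolding conj_by_def by (metis mult.assoc)

lemma conj_by_inverse:
  assumes "conj_by u x y" "x * x' = 1" "y' * y = 1"
  shows "conj_by u x' y'"
proof -
  have "u * x' = y' * (y * u) * x'" by (simp add: assms(3) flip: mult.assoc)
  also have "\<dots> = y' * u * (x * x')" using assms(1) by (metis conj_by_def mult.assoc)
  finally show ?thesis by (simp add: assms(2) conj_by_def)
qed

lemma sum_kd:
  fixes g :: "nat \<Rightarrow> 'a::complex_vector"
  assumes "finite I"
  shows "(\<Sum>i\<in>I. kd i j *\<^sub>C g i) = (if j \<in> I then g j else 0)"
    "(\<Sum>i\<in>I. kd j i *\<^sub>C g i) = (if j \<in> I then g j else 0)"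
proof -
  have "kd i j *\<^sub>C g i = (if i = j then g i else 0)" "kd j i *\<^sub>C g i = (if j = i then g i else 0)" for i
    by (simp_all add: kd_def cscale_one)
  then show "(\<Sum>i\<in>I. kd i j *\<^sub>C g i) = (if j \<in> I then g j else 0)"
    "(\<Sum>i\<in>I. kd j i *\<^sub>C g i) = (if j \<in> I then g j else 0)"
    using assms by simp_all
qed

section \<open>The powers of e^\<sigma> and the two factors of the twist\<close>

lemma sigma11_adic: "sigma11 \<in> adic 1"
  by (simp add: sigma11_def formal_ln1p_adic generators_gen gen_adic)

lemma exp_sigma11: "formal_exp sigma11 = 1 + E_plus 1 1"
  by (simp add: sigma11_def formal_exp_ln1p generators_gen gen_adic)

lemma scale_sigma11_adic: "c *\<^sub>C sigma11 \<in> adic 1"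
  by (rule adic_scale[OF sigma11_adic])

definition sigma_exp :: "complex \<Rightarrow> 'n::finite sp uea fls" where
  "sigma_exp c = formal_exp (c *\<^sub>C sigma11)"

lemma sigma_exp_add: "sigma_exp c * sigma_exp d = (sigma_exp (c + d) :: 'n::finite sp uea fls)"
proof -
  have "formal_exp (c *\<^sub>C sigma11 + d *\<^sub>C sigma11) = sigma_exp c * (sigma_exp d :: 'n sp uea fls)"
    unfolding sigma_exp_def by (rule formal_exp_add) (simp_all add: scale_sigma11_adic cscale_mult_left cscale_mult_right
        cscale_cscale mult.commute)
  then show ?thesis by (simp add: sigma_exp_def cscale_add_left)
qed

lemma sigma_exp_special: "sigma_exp 0 = 1" "sigma_exp 1 = 1 + E_plus 1 1"
  "formal_exp (- sigma11) = sigma_exp (- 1)"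
  by (simp_all add: sigma_exp_def formal_exp_zero cscale_one exp_sigma11)

lemma sigma_exp_adic: "sigma_exp c \<in> adic 0"
  by (simp add: sigma_exp_def formal_exp_adic scale_sigma11_adic)

lemma sigma_comm: "comm sigma11 x = 0" if "comm (E_plus 1 1) x = 0"
  using that formal_ln1p_commute[of "E_plus 1 1" x]
  by (simp add: sigma11_def comm_eq_0_iff generators_gen gen_adic)

lemma sigma_exp_comm: "comm (sigma_exp c) x = 0" if "comm (E_plus 1 1) x = 0"
  using sigma_comm[OF that] formal_exp_commute[OF scale_sigma11_adic, of c x]
  by (simp add: sigma_exp_def comm_eq_0_iff cscale_mult_left cscale_mult_right)

lemma one_le_card: "1 \<le> CARD('n::finite)"
  by (simp add: Suc_leI One_nat_def)

global_interpretation gens: sp_deformation "{1..CARD('n)}" E_minus E_plus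
  "F_plus :: nat \<Rightarrow> nat \<Rightarrow> 'n::finite sp uea fls" 1 "formal_exp (- sigma11)"
proof (rule sp_deformation.intro[OF generators_relations], unfold_locales)
  show "1 \<in> {1..CARD('n)}" by (simp add: one_le_card)
  show "formal_exp (- sigma11) * (1 + E_plus 1 1 :: 'n sp uea fls) = 1"
    "(1 + E_plus 1 1 :: 'n sp uea fls) * formal_exp (- sigma11) = 1"
    unfolding sigma_exp_special(3) sigma_exp_special(2)[symmetric] sigma_exp_add
    by (simp_all add: sigma_exp_special(1))
qed

abbreviation jordan_exponent :: "('n::finite sp uea, 'n sp uea) tensor fls" where
  "jordan_exponent \<equiv> H_cartan 1 \<boxtimes> sigma11"

abbreviation extension_exponent :: "('n::finite sp uea, 'n sp uea) tensor fls" where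
  "extension_exponent \<equiv> \<Sum>i\<in>{1..CARD('n)} - {1}. E_minus 1 i \<boxtimes> (E_plus 1 i * sigma_exp (- 1 / 2))"

lemma H_cartan_adic: "H_cartan i \<in> adic 0"
  by (simp add: H_cartan_def)

lemma jordan_exponent_adic: "jordan_exponent \<in> adic 1"
  using tensor_adic[OF H_cartan_adic sigma11_adic, of 1] by simp

lemma extension_summand_adic: "E_minus 1 i \<boxtimes> (E_plus 1 i * sigma_exp c) \<in> adic 1"
proof -
  have "E_plus 1 i * sigma_exp c \<in> adic (1 + 0)"
    unfolding generators_gen by (intro adic_mult gen_adic sigma_exp_adic)
  from tensor_adic[OF _ this, of "E_minus 1 i" 0] show ?thesis
    by (simp add: generators_gen gen_adic)
qed

lemma extension_exponent_adic: "extension_exponent \<in> adic 1"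
  by (intro adic_sum extension_summand_adic)

lemma H_cartan_comm: "comm (H_cartan 1) x = (1 / 2) *\<^sub>C comm (E_minus 1 1) x"
  for x :: "'n::finite sp uea fls"
  by (simp add: H_cartan_eq one_le_card comm_scale_left)

lemma comm_Z_sigma_exp: "comm (E_plus 1 1) (sigma_exp c) = (0 :: 'n::finite sp uea fls)"
  using sigma_exp_comm[of "E_plus 1 1 :: 'n sp uea fls" c]
    comm_swap[of "E_plus 1 1" "sigma_exp c :: 'n sp uea fls"] by simp

lemma twist_factors:
  "(twist :: ('n::finite sp uea, 'n sp uea) tensor fls) =
    formal_exp extension_exponent * formal_exp jordan_exponent"
proof -
  let ?g = "\<lambda>i. E_minus 1 i \<boxtimes> (E_plus 1 i * sigma_exp (- 1 / 2)) :: ('n sp uea, 'n sp uea) tensor fls"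
  have "?g i * ?g j = ?g j * ?g i" if ij: "i \<in> {1..CARD('n)} - {1}" "j \<in> {1..CARD('n)} - {1}" for i j
  proof -
    have "E_minus 1 i * E_minus 1 j = E_minus 1 j * (E_minus 1 i :: 'n sp uea fls)"
      using gens.heisenberg(1)[OF ij] by (simp add: comm_eq_0_iff)
    moreover have "comm (E_plus 1 i * sigma_exp (- 1 / 2)) (E_plus 1 j * sigma_exp (- 1 / 2) :: 'n sp uea fls) = 0"
      using ij gens.heisenberg(3)[OF ij] sigma_exp_comm[OF gens.heisenberg(5)[OF ij]]
        sigma_exp_comm[OF gens.heisenberg(5)[OF ij(2,1)]]
        comm_swap[of "E_plus 1 i" "sigma_exp (- 1 / 2) :: 'n sp uea fls"]
      by (simp add: comm_mult_left comm_mult_right)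
    ultimately show ?thesis by (simp add: tensor_mult comm_eq_0_iff)
  qed
  then have "prod_list (map (\<lambda>i. formal_exp (?g i)) (rev [2..<CARD('n) + 1])) =
      formal_exp (sum_list (map ?g (rev [2..<CARD('n) + 1])))"
    by (intro prod_list_formal_exp extension_summand_adic) auto
  also have "sum_list (map ?g (rev [2..<CARD('n) + 1])) = extension_exponent"
    by (subst sum_list_distinct_conv_sum_set) (auto intro!: sum.cong)
  finally show ?thesis by (simp add: twist_def sigma_exp_def)
qed

definition untwist :: "('n::finite sp uea, 'n sp uea) tensor fls" where
  "untwist = formal_exp (- jordan_exponent) * formal_exp (- extension_exponent)"

lemma twist_untwist:
  "twist * untwist = (1 :: ('n::finite sp uea, 'n sp uea) tensor fls)"
  "untwist * twist = (1 :: ('n sp uea, 'n sp uea) tensor fls)"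
proof -
  have inv: "(k * j) * (j' * k') = 1" if "k * k' = 1" "j * j' = 1"
    for k k' j j' :: "('n sp uea, 'n sp uea) tensor fls"
  proof -
    have "(k * j) * (j' * k') = k * (j * j') * k'" by (simp only: mult.assoc)
    then show ?thesis by (simp add: that)
  qed
  note J = formal_exp_uminus[OF jordan_exponent_adic]
    and K = formal_exp_uminus[OF extension_exponent_adic]
  show "twist * untwist = (1 :: ('n sp uea, 'n sp uea) tensor fls)"
    "untwist * twist = (1 :: ('n sp uea, 'n sp uea) tensor fls)"
    unfolding twist_factors untwist_def by (intro inv J K)+
qed

lemma twisted_coproductI:
  fixes a :: "'n::finite sp uea fls"
  assumes "conj_by twist (fls_coproduct a) b"
  shows "twisted_coproduct a = b"
  using assms ring_inverse_eq[OF twist_untwist[where ?'n = 'n]] twist_untwist[where ?'n = 'n]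
  by (simp add: twisted_coproduct_def conj_by_def mult.assoc)

subsection \<open>The jordanian factor\<close>

lemma jordan_right: "conj_by (formal_exp jordan_exponent) (1 \<boxtimes> x) (1 \<boxtimes> x)"
  if "comm (E_plus 1 1) x = 0"
  unfolding conj_by_def
  by (rule formal_exp_commute[OF jordan_exponent_adic])
     (use sigma_comm[OF that] in \<open>simp add: tensor_mult comm_eq_0_iff\<close>)

text \<open>From H x = x (H + c), moving x \<boxtimes> 1 to the left of the exponential adds c (1
  \<boxtimes> \<sigma>) to the exponent. This summand commutes with the old exponent and splits off
  as the factor 1 \<boxtimes> e^(c \<sigma>).\<close>

lemma jordan_left: "conj_by (formal_exp jordan_exponent) (x \<boxtimes> 1) (x \<boxtimes> sigma_exp c)"
  if "comm (H_cartan 1) x = c *\<^sub>C x"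
proof -
  have "jordan_exponent * (x \<boxtimes> 1) = (x \<boxtimes> 1) * (1 \<boxtimes> (c *\<^sub>C sigma11) + jordan_exponent)"
    using comm_eq_imp_mult[OF that]
    by (simp add: tensor_mult distrib_left tensor_bilinear cscale_mult_right)
  moreover have cs: "1 \<boxtimes> (c *\<^sub>C sigma11) \<in> adic 1"
    using tensor_adic[OF adic_one scale_sigma11_adic, of c] by simp
  ultimately have "formal_exp jordan_exponent * (x \<boxtimes> 1) =
      (x \<boxtimes> 1) * formal_exp (1 \<boxtimes> (c *\<^sub>C sigma11) + jordan_exponent)"
    by (intro formal_exp_intertwine adic_add jordan_exponent_adic)
  also have "formal_exp (1 \<boxtimes> (c *\<^sub>C sigma11) + jordan_exponent) =
      (1 \<boxtimes> sigma_exp c) * formal_exp jordan_exponent"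
    unfolding sigma_exp_def by (subst formal_exp_add[OF cs jordan_exponent_adic])
       (simp_all add: tensor_formal_exp scale_sigma11_adic tensor_mult cscale_mult_left cscale_mult_right)
  finally show ?thesis
    by (simp add: conj_by_def tensor_mult flip: mult.assoc)
qed

subsection \<open>The extension factor\<close>

lemma comm_tensor_left: "comm (a \<boxtimes> b) (x \<boxtimes> 1) = comm a x \<boxtimes> b"
  and comm_tensor_right: "comm (a \<boxtimes> b) (1 \<boxtimes> y) = a \<boxtimes> comm b y"
  by (simp_all add: comm_def tensor_mult tensor_bilinear)

lemma extension_left: "comm extension_exponent (x \<boxtimes> 1) =
    (\<Sum>i\<in>{1..CARD('n)} - {1}. comm (E_minus 1 i) x \<boxtimes> (E_plus 1 i * sigma_exp (- 1 / 2)))"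
  for x :: "'n::finite sp uea fls"
  by (simp add: comm_sum_left comm_tensor_left)

lemma extension_right: "comm extension_exponent (1 \<boxtimes> x) =
    (\<Sum>i\<in>{1..CARD('n)} - {1}. E_minus 1 i \<boxtimes> (comm (E_plus 1 i) x * sigma_exp (- 1 / 2)))"
  if "comm (E_plus 1 1) x = 0" for x :: "'n::finite sp uea fls"
  by (simp add: comm_sum_left comm_tensor_right comm_mult_left sigma_exp_comm[OF that])

lemma extension_conj:
  assumes "comm extension_exponent x = z" "comm extension_exponent z = w + w"
    "comm extension_exponent w = 0"
  shows "conj_by (formal_exp extension_exponent) x (x + z + w)"
  unfolding conj_by_def
  by (rule formal_exp_conjugate[OF extension_exponent_adic])
     (use assms in \<open>auto intro: comm_eq_imp_mult simp: comm_eq_0_iff\<close>)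

lemma extension_conj_fixed:
  assumes "comm extension_exponent x = 0"
  shows "conj_by (formal_exp extension_exponent) x x"
  using extension_conj[OF assms, of 0] by (simp add: comm_def)

lemma extension_conj_linear:
  assumes "comm extension_exponent x = z" "comm extension_exponent z = 0"
  shows "conj_by (formal_exp extension_exponent) x (x + z)"
  using extension_conj[OF assms(1), of 0] assms(2) by (simp add: comm_def)

lemma tensor_split: "a \<boxtimes> b = (a \<boxtimes> 1) * (1 \<boxtimes> b)"
  by (simp add: tensor_mult)

lemma sum_delta_tensor:
  fixes a :: "'a::complex_algebra_1 fls" and b :: "nat \<Rightarrow> 'b::complex_algebra_1 fls"
  assumes "finite I" "j \<in> I"
  shows "(\<Sum>i\<in>I. (kd i j *\<^sub>C a) \<boxtimes> b i) = a \<boxtimes> b j" "(\<Sum>i\<in>I. (kd j i *\<^sub>C a) \<boxtimes> b i) = a \<boxtimes> b j"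
    "(\<Sum>i\<in>I. c i \<boxtimes> (kd i j *\<^sub>C d)) = c j \<boxtimes> d" "(\<Sum>i\<in>I. c i \<boxtimes> (kd j i *\<^sub>C d)) = c j \<boxtimes> d"
  using assms by (simp_all add: tensor_bilinear sum_kd)

text \<open>Every sum over the extension collapses under a Kronecker delta. For
  \<open>E_minus i j\<close> the two legs give \<open>A j \<boxtimes> (B i * q)\<close> with
  opposite signs: S is an invariant pairing of two dual modules. For \<open>E_plus i j\<close> only
  the commutators with A on the left leg contribute, for \<open>F_plus i j\<close> only those with B
  on the right leg.\<close>

lemma extension_comm:
  fixes i j :: nat
  defines "Z \<equiv> E_plus 1 1 :: 'n::finite sp uea fls" and "q \<equiv> sigma_exp (- 1 / 2) :: 'n sp uea fls"
    and "S \<equiv> extension_exponent :: ('n sp uea, 'n sp uea) tensor fls"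
    and "A \<equiv> E_minus 1 :: nat \<Rightarrow> 'n sp uea fls" and "B \<equiv> E_plus 1 :: nat \<Rightarrow> 'n sp uea fls"
  assumes ij: "i \<in> {1..CARD('n)} - {1}" "j \<in> {1..CARD('n)} - {1}"
  shows "comm S (Z \<boxtimes> 1) = 0" "comm S (1 \<boxtimes> sigma_exp c) = 0"
    "comm S (A j \<boxtimes> 1) = 0" "comm S (B j \<boxtimes> 1) = Z \<boxtimes> (B j * q)"
    "comm S (1 \<boxtimes> A j) = - (A j \<boxtimes> (Z * q))" "comm S (1 \<boxtimes> B j) = 0"
    "comm S (E_minus i j \<boxtimes> 1 + 1 \<boxtimes> E_minus i j) = 0"
    "comm S (E_plus i j \<boxtimes> 1 + 1 \<boxtimes> E_plus i j) = B j \<boxtimes> (B i * q) + B i \<boxtimes> (B j * q)"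
    "comm S (F_plus i j \<boxtimes> 1 + 1 \<boxtimes> F_plus i j) = A i \<boxtimes> (A j * q) + A j \<boxtimes> (A i * q)"
proof -
  let ?I = "{1..CARD('n)} - {1}"
  note heis = gens.heisenberg[where ?'n = 'n] and act = gens.action[where ?'n = 'n]
  have AZ: "comm (E_minus 1 k) (E_plus 1 1) = (0 :: 'n sp uea fls)" if "k \<in> ?I" for k
    using heis(4)[OF that that] comm_swap[of "E_minus 1 k" "E_plus 1 1 :: 'n sp uea fls"] by simp
  have Bq: "comm (E_plus 1 k) (sigma_exp c) = (0 :: 'n sp uea fls)" if "k \<in> ?I" for k c
    using sigma_exp_comm[OF heis(5)[OF that that]]
      comm_swap[of "E_plus 1 k" "sigma_exp c :: 'n sp uea fls"] by simp
  have BA: "comm (E_plus 1 k) (E_minus 1 j) = - (kd j k *\<^sub>C (E_plus 1 1 :: 'n sp uea fls))" if "k \<in> ?I" for k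
    using heis(2)[OF ij(2) that] comm_swap[of "E_plus 1 k" "E_minus 1 j :: 'n sp uea fls"] by simp
  note delta = sum_delta_tensor[of ?I]
  show "comm S (Z \<boxtimes> 1) = 0"
    unfolding S_def Z_def extension_left by (simp add: AZ tensor_bilinear)
  show "comm S (1 \<boxtimes> sigma_exp c) = 0"
    unfolding S_def extension_right[OF comm_Z_sigma_exp] by (simp add: Bq tensor_bilinear)
  show "comm S (A j \<boxtimes> 1) = 0"
    unfolding S_def A_def extension_left using ij by (simp add: heis tensor_bilinear)
  show "comm S (B j \<boxtimes> 1) = Z \<boxtimes> (B j * q)"
    unfolding S_def B_def Z_def q_def extension_left using ij by (simp add: heis delta)
  show "comm S (1 \<boxtimes> A j) = - (A j \<boxtimes> (Z * q))"
    unfolding S_def A_def Z_def q_def extension_right[OF heis(4)[OF ij(2,2)]] using ij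
    by (simp add: BA cscale_mult_left tensor_bilinear sum_negf sum_kd)
  show "comm S (1 \<boxtimes> B j) = 0"
    unfolding S_def B_def extension_right[OF heis(5)[OF ij(2,2)]] using ij
    by (simp add: heis tensor_bilinear)
  show "comm S (E_minus i j \<boxtimes> 1 + 1 \<boxtimes> E_minus i j) = 0"
    unfolding S_def comm_add_right extension_left extension_right[OF act(7)[OF ij ij(1)]] using ij
    by (simp add: act cscale_mult_left tensor_bilinear sum_negf sum_kd)
  show "comm S (E_plus i j \<boxtimes> 1 + 1 \<boxtimes> E_plus i j) = B j \<boxtimes> (B i * q) + B i \<boxtimes> (B j * q)"
    unfolding S_def B_def q_def comm_add_right extension_left extension_right[OF act(8)[OF ij ij(1)]]
    using ij by (simp add: act tensor_bilinear sum.distrib sum_kd)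
  show "comm S (F_plus i j \<boxtimes> 1 + 1 \<boxtimes> F_plus i j) = A i \<boxtimes> (A j * q) + A j \<boxtimes> (A i * q)"
    unfolding S_def A_def q_def comm_add_right extension_left extension_right[OF act(9)[OF ij ij(1)]]
    using ij
    by (simp add: act cscale_mult_left distrib_right tensor_bilinear sum.distrib sum_kd)
qed

lemma sigma_exp_half:
  defines "Z \<equiv> E_plus 1 1 :: 'n::finite sp uea fls"
  shows "sigma_exp (1 / 2) - Z * sigma_exp (- 1 / 2) = sigma_exp (- 1 / 2)"
    "(1 + Z) * sigma_exp (- 1) = 1"
proof -
  have "(1 + Z) * sigma_exp (- 1 / 2) = sigma_exp (1 / 2)"
    unfolding Z_def sigma_exp_special(2)[symmetric] sigma_exp_add by simp
  then show "sigma_exp (1 / 2) - Z * sigma_exp (- 1 / 2) = sigma_exp (- 1 / 2)"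
    by (simp add: distrib_right diff_eq_eq)
  show "(1 + Z) * sigma_exp (- 1) = 1"
    unfolding Z_def sigma_exp_special(2)[symmetric] sigma_exp_add by (simp add: sigma_exp_special(1))
qed

text \<open>A and B have weight 1/2 under H_11, so the jordanian factor multiplies their left leg by
  r = e^(\<sigma>/2); generators with both indices different from 1 have weight 0 and pass
  unchanged. Under the extension only \<open>E_plus i j\<close> and \<open>F_plus i j\<close> have
  nonzero double commutators, and the last summands are half of them.\<close>

lemma twist_conj:
  fixes i j :: nat
  defines "Z \<equiv> E_plus 1 1 :: 'n::finite sp uea fls" and "q \<equiv> sigma_exp (- 1 / 2) :: 'n sp uea fls"
    and "r \<equiv> sigma_exp (1 / 2) :: 'n sp uea fls" and "t \<equiv> sigma_exp (- 1) :: 'n sp uea fls"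
    and "A \<equiv> E_minus 1 :: nat \<Rightarrow> 'n sp uea fls" and "B \<equiv> E_plus 1 :: nat \<Rightarrow> 'n sp uea fls"
  assumes ij: "i \<in> {1..CARD('n)} - {1}" "j \<in> {1..CARD('n)} - {1}"
  shows "conj_by twist (fls_coproduct (A j)) (A j \<boxtimes> q + 1 \<boxtimes> A j)"
    "conj_by twist (fls_coproduct (B j)) (B j \<boxtimes> r + (1 + Z) \<boxtimes> B j)"
    "conj_by twist (fls_coproduct t) (t \<boxtimes> t)"
    "conj_by twist (fls_coproduct (E_minus i j :: 'n sp uea fls)) (E_minus i j \<boxtimes> 1 + 1 \<boxtimes> E_minus i j)"
    "conj_by twist (fls_coproduct (E_plus i j)) (E_plus i j \<boxtimes> 1 + 1 \<boxtimes> E_plus i j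
       + (B j \<boxtimes> (B i * q) + B i \<boxtimes> (B j * q)) + Z \<boxtimes> (B i * B j * t))"
    "conj_by twist (fls_coproduct (F_plus i j)) (F_plus i j \<boxtimes> 1 + 1 \<boxtimes> F_plus i j
       + (A i \<boxtimes> (A j * q) + A j \<boxtimes> (A i * q)) + - ((A i * A j) \<boxtimes> (Z * t)))"
proof -
  note heis = gens.heisenberg[where ?'n = 'n] and act = gens.action[where ?'n = 'n]
  note ext = extension_comm[where ?'n = 'n]
  let ?J = "formal_exp jordan_exponent :: ('n sp uea, 'n sp uea) tensor fls"
  let ?K = "formal_exp extension_exponent :: ('n sp uea, 'n sp uea) tensor fls"
  let ?S = "extension_exponent :: ('n sp uea, 'n sp uea) tensor fls"
  have one: "(1 :: nat) \<in> {1..CARD('n)}" by (simp add: one_le_card)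
  have cop: "fls_coproduct (E_minus k l :: 'n sp uea fls) = E_minus k l \<boxtimes> 1 + 1 \<boxtimes> E_minus k l"
    "fls_coproduct (E_plus k l :: 'n sp uea fls) = E_plus k l \<boxtimes> 1 + 1 \<boxtimes> E_plus k l"
    "fls_coproduct (F_plus k l :: 'n sp uea fls) = F_plus k l \<boxtimes> 1 + 1 \<boxtimes> F_plus k l" for k l
    by (simp_all only: generators_gen fls_coproduct_gen)
  have s1: "1 + Z = sigma_exp 1"
    by (simp add: Z_def sigma_exp_special(2))
  have HA: "comm (H_cartan 1) (A j) = (1 / 2) *\<^sub>C A j" and HB: "comm (H_cartan 1) (B j) = (1 / 2) *\<^sub>C B j"
    and HZ: "comm (H_cartan 1) Z = 1 *\<^sub>C Z"
    using ij one gens.ee[where ?'n = 'n, of 1 1 1 j] gens.ep[where ?'n = 'n, of 1 1 1 j]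
      gens.ep[where ?'n = 'n, of 1 1 1 1]
      cscale_add_left[of "1 / 2" "1 / 2" "E_plus 1 1 :: 'n sp uea fls"]
    by (auto simp: A_def B_def Z_def H_cartan_comm cscale_one cscale_add_right)
  have H0: "comm (H_cartan 1) (E_minus i j) = 0 *\<^sub>C (E_minus i j :: 'n sp uea fls)"
    "comm (H_cartan 1) (E_plus i j) = 0 *\<^sub>C (E_plus i j :: 'n sp uea fls)"
    "comm (H_cartan 1) (F_plus i j) = 0 *\<^sub>C (F_plus i j :: 'n sp uea fls)"
    using ij one gens.ee[where ?'n = 'n, of 1 1 i j] gens.ep[where ?'n = 'n, of 1 1 i j]
      gens.ef[where ?'n = 'n, of 1 1 i j]
    by (auto simp: H_cartan_comm)
  have prim: "conj_by ?J (x \<boxtimes> 1 + 1 \<boxtimes> x) (x \<boxtimes> 1 + 1 \<boxtimes> x)"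
    if "comm (H_cartan 1) x = 0 *\<^sub>C x" "comm (E_plus 1 1) x = 0" for x
    using conj_by_add[OF jordan_left[OF that(1)] jordan_right[OF that(2)]]
    by (simp add: sigma_exp_special(1))
  have KZ: "conj_by ?K (Z \<boxtimes> 1) (Z \<boxtimes> 1)" and Ks: "conj_by ?K (1 \<boxtimes> sigma_exp c) (1 \<boxtimes> sigma_exp c)" for c
    unfolding Z_def by (rule extension_conj_fixed[OF ext(1)[OF ij]] extension_conj_fixed[OF ext(2)[OF ij]])+
  have KA: "conj_by ?K (A j \<boxtimes> 1) (A j \<boxtimes> 1)" and KB: "conj_by ?K (1 \<boxtimes> B j) (1 \<boxtimes> B j)"
    unfolding A_def B_def
    by (rule extension_conj_fixed[OF ext(3)[OF ij]] extension_conj_fixed[OF ext(6)[OF ij]])+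
  have BS: "comm ?S (1 \<boxtimes> (B k * sigma_exp c)) = 0" if "k \<in> {1..CARD('n)} - {1}" for k c
  proof -
    have "1 \<boxtimes> (B k * sigma_exp c) = (1 \<boxtimes> B k) * ((1 :: 'n sp uea fls) \<boxtimes> sigma_exp c)"
      by (simp add: tensor_mult)
    then show ?thesis
      using ext[OF that that] by (simp add: comm_mult_right B_def)
  qed
  have ZS: "comm ?S (1 \<boxtimes> (Z * sigma_exp c)) = 0" for c
  proof -
    \<comment> \<open>As Z = e^\<sigma> - 1, the product is a difference of powers of e^\<sigma>,
      each of which commutes with S on the right leg.\<close>
    have "Z * sigma_exp c = sigma_exp 1 * sigma_exp c - sigma_exp c"
      by (simp add: distrib_right s1[symmetric])
    also have "\<dots> = sigma_exp (1 + c) - sigma_exp c"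
      by (simp only: sigma_exp_add)
    finally show ?thesis
      using ext(2)[OF ij] by (simp add: tensor_bilinear comm_diff_right)
  qed

  have "conj_by ?K (1 \<boxtimes> A j) (1 \<boxtimes> A j + - (A j \<boxtimes> (Z * q)))"
  proof (rule extension_conj_linear)
    show "comm ?S (1 \<boxtimes> A j) = - (A j \<boxtimes> (Z * q))"
      unfolding A_def Z_def q_def by (rule ext[OF ij])
    have "- (A j \<boxtimes> (Z * q)) = (- A j \<boxtimes> 1) * (1 \<boxtimes> (Z * q))"
      by (simp add: tensor_mult tensor_bilinear)
    moreover have "comm ?S (- A j \<boxtimes> 1) = 0"
      using ext(3)[OF ij] by (simp add: A_def tensor_bilinear comm_def)
    ultimately show "comm ?S (- (A j \<boxtimes> (Z * q))) = 0"
      using ZS[of "- 1 / 2"] by (simp add: comm_mult_right q_def)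
  qed
  from conj_by_add[OF conj_by_mult[OF KA Ks] this]
  have "conj_by ?K (A j \<boxtimes> r + 1 \<boxtimes> A j) (A j \<boxtimes> (r - Z * q) + 1 \<boxtimes> A j)"
    by (simp add: tensor_mult tensor_bilinear algebra_simps r_def)
  \<comment> \<open>Here the exponent -1/2 of the twist matters: e^(\<sigma>/2) from the weight and
    -Z e^(-\<sigma>/2) from the extension add up to e^(-\<sigma>/2), because e^\<sigma> = 1 +
    Z.\<close>
  also have "r - Z * q = q"
    unfolding r_def q_def Z_def by (rule sigma_exp_half)
  finally have "conj_by ?K (A j \<boxtimes> r + 1 \<boxtimes> A j) (A j \<boxtimes> q + 1 \<boxtimes> A j)" .
  moreover have "conj_by ?J (A j \<boxtimes> 1 + 1 \<boxtimes> A j) (A j \<boxtimes> r + 1 \<boxtimes> A j)"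
    unfolding r_def by (intro conj_by_add jordan_left[OF HA] jordan_right)
      (simp add: A_def heis(4)[OF ij(2,2)])
  ultimately show "conj_by twist (fls_coproduct (A j)) (A j \<boxtimes> q + 1 \<boxtimes> A j)"
    unfolding twist_factors A_def cop by (simp add: conj_by_trans)

  have "conj_by ?K (B j \<boxtimes> 1) (B j \<boxtimes> 1 + Z \<boxtimes> (B j * q))"
  proof (rule extension_conj_linear)
    show "comm ?S (B j \<boxtimes> 1) = Z \<boxtimes> (B j * q)"
      unfolding B_def Z_def q_def by (rule ext[OF ij])
    show "comm ?S (Z \<boxtimes> (B j * q)) = 0"
      using BS[OF ij(2)] ext(1)[OF ij]
      unfolding tensor_split[of Z "B j * q"] comm_mult_right by (simp add: q_def Z_def)
  qed
  from conj_by_add[OF conj_by_mult[OF this Ks[of "1 / 2"]] KB]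
  have "conj_by ?K (B j \<boxtimes> r + 1 \<boxtimes> B j) (B j \<boxtimes> r + (1 + Z) \<boxtimes> B j)"
    by (simp add: tensor_mult tensor_bilinear distrib_right r_def q_def sigma_exp_add sigma_exp_special(1)
        mult.assoc add.assoc add.commute add.left_commute)
  moreover have "conj_by ?J (B j \<boxtimes> 1 + 1 \<boxtimes> B j) (B j \<boxtimes> r + 1 \<boxtimes> B j)"
    unfolding r_def by (intro conj_by_add jordan_left[OF HB] jordan_right)
      (simp add: B_def heis(5)[OF ij(2,2)])
  ultimately show "conj_by twist (fls_coproduct (B j)) (B j \<boxtimes> r + (1 + Z) \<boxtimes> B j)"
    unfolding twist_factors B_def cop by (simp add: conj_by_trans)

  have "conj_by ?K (1 \<boxtimes> Z) (1 \<boxtimes> Z)"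
    using extension_conj_fixed[OF ZS[of 0]] by (simp add: sigma_exp_special(1))
  from conj_by_add[OF conj_by_mult[OF KZ Ks[of 1]] this]
  have "conj_by ?K (Z \<boxtimes> (1 + Z) + 1 \<boxtimes> Z) (Z \<boxtimes> (1 + Z) + 1 \<boxtimes> Z)"
    by (simp add: tensor_mult s1)
  moreover have "conj_by ?J (Z \<boxtimes> 1 + 1 \<boxtimes> Z) (Z \<boxtimes> (1 + Z) + 1 \<boxtimes> Z)"
    unfolding s1 by (intro conj_by_add jordan_left[OF HZ] jordan_right) (simp add: Z_def)
  ultimately have "conj_by twist (fls_coproduct Z) (Z \<boxtimes> (1 + Z) + 1 \<boxtimes> Z)"
    unfolding twist_factors Z_def cop by (simp add: conj_by_trans)
  \<comment> \<open>Adding the unit completes Z to the group-like element e^\<sigma>, and its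
    inverse t is then group-like as well.\<close>
  from conj_by_add[OF conj_by_one this]
  have "conj_by twist (fls_coproduct (1 + Z)) ((1 + Z) \<boxtimes> (1 + Z))"
    by (simp add: fls_coproduct.hom_add fls_coproduct.hom_one tensor_bilinear algebra_simps)
  then show "conj_by twist (fls_coproduct t) (t \<boxtimes> t)"
    unfolding s1 t_def
    by (rule conj_by_inverse)
       (simp_all add: tensor_mult sigma_exp_add sigma_exp_special(1) fls_coproduct.hom_one
         tensor_bilinear flip: fls_coproduct.hom_mult)

  show "conj_by twist (fls_coproduct (E_minus i j :: 'n sp uea fls)) (E_minus i j \<boxtimes> 1 + 1 \<boxtimes> E_minus i j)"
    unfolding twist_factors cop
    by (rule conj_by_trans[OF prim[OF H0(1) act(7)[OF ij ij(1)]]])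
       (rule extension_conj_fixed[OF ext(7)[OF ij]])

  have Bq: "B k * sigma_exp c = sigma_exp c * B k" if "k \<in> {1..CARD('n)} - {1}" for k c
    using sigma_exp_comm[OF heis(5)[OF that that]] by (simp add: B_def comm_eq_0_iff)
  have BB: "B j * B i = B i * B j" and AA: "A j * A i = A i * A j"
    using heis(1,3)[OF ij(2,1)] by (simp_all add: A_def B_def comm_eq_0_iff)
  have qq: "q * q = t" "x * q * q = x * t" for x
    by (simp_all add: q_def t_def sigma_exp_add mult.assoc)
  have "(B k * q) * (B l * q) = B k * B l * t" if "l \<in> {1..CARD('n)} - {1}" for k l
  proof -
    have "(B k * q) * (B l * q) = B k * (q * B l) * q" by (simp only: mult.assoc)
    also have "q * B l = B l * q" using Bq[OF that] by (simp add: q_def)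
    finally show ?thesis by (simp add: mult.assoc qq(1))
  qed
  then have BqBq: "(B i * q) * (B j * q) = B i * B j * t" "(B j * q) * (B i * q) = B i * B j * t"
    using ij by (simp_all add: BB)
  have "conj_by ?K (E_plus i j \<boxtimes> 1 + 1 \<boxtimes> E_plus i j) (E_plus i j \<boxtimes> 1 + 1 \<boxtimes> E_plus i j
       + (B j \<boxtimes> (B i * q) + B i \<boxtimes> (B j * q)) + Z \<boxtimes> (B i * B j * t))"
  proof (rule extension_conj)
    show "comm ?S (E_plus i j \<boxtimes> 1 + 1 \<boxtimes> E_plus i j) = B j \<boxtimes> (B i * q) + B i \<boxtimes> (B j * q)"
      unfolding B_def q_def by (rule ext[OF ij])
    have "comm ?S (B k \<boxtimes> (B l * q)) = Z \<boxtimes> ((B k * q) * (B l * q))"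
      if "k \<in> {1..CARD('n)} - {1}" "l \<in> {1..CARD('n)} - {1}" for k l
      using BS[OF that(2)] ext(4)[OF that(1,1)]
      unfolding tensor_split[of "B k" "B l * q"] comm_mult_right by (simp add: q_def B_def Z_def tensor_mult)
    then show "comm ?S (B j \<boxtimes> (B i * q) + B i \<boxtimes> (B j * q)) = Z \<boxtimes> (B i * B j * t) + Z \<boxtimes> (B i * B j * t)"
      using ij by (simp add: comm_add_right BqBq)
    have "1 \<boxtimes> (B i * B j * t) = ((1 :: 'n sp uea fls) \<boxtimes> B i) * (1 \<boxtimes> (B j * sigma_exp (- 1)))"
      by (simp add: tensor_mult mult.assoc t_def)
    then have "comm ?S (1 \<boxtimes> (B i * B j * t)) = 0"
      using BS[OF ij(2)] ext(6)[OF ij(1,1)] by (simp add: comm_mult_right B_def)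
    then show "comm ?S (Z \<boxtimes> (B i * B j * t)) = 0"
      using ext(1)[OF ij] unfolding tensor_split[of Z "B i * B j * t"] comm_mult_right by (simp add: Z_def)
  qed
  from conj_by_trans[OF prim[OF H0(2) act(8)[OF ij ij(1)]] this]
  show "conj_by twist (fls_coproduct (E_plus i j)) (E_plus i j \<boxtimes> 1 + 1 \<boxtimes> E_plus i j
       + (B j \<boxtimes> (B i * q) + B i \<boxtimes> (B j * q)) + Z \<boxtimes> (B i * B j * t))"
    unfolding twist_factors cop .

  have "conj_by ?K (F_plus i j \<boxtimes> 1 + 1 \<boxtimes> F_plus i j) (F_plus i j \<boxtimes> 1 + 1 \<boxtimes> F_plus i j
       + (A i \<boxtimes> (A j * q) + A j \<boxtimes> (A i * q)) + - ((A i * A j) \<boxtimes> (Z * t)))"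
  proof (rule extension_conj)
    show "comm ?S (F_plus i j \<boxtimes> 1 + 1 \<boxtimes> F_plus i j) = A i \<boxtimes> (A j * q) + A j \<boxtimes> (A i * q)"
      unfolding A_def q_def by (rule ext[OF ij])
    have "comm ?S (A k \<boxtimes> (A l * q)) = - ((A k * A l) \<boxtimes> (Z * t))"
      if "k \<in> {1..CARD('n)} - {1}" "l \<in> {1..CARD('n)} - {1}" for k l
    proof -
      have split: "A k \<boxtimes> (A l * q) = (A k \<boxtimes> 1) * ((1 \<boxtimes> A l) * (1 \<boxtimes> q))"
        by (simp add: tensor_mult)
      have comms: "comm ?S (A k \<boxtimes> 1) = 0" "comm ?S (1 \<boxtimes> A l) = - (A l \<boxtimes> (Z * q))"
        "comm ?S (1 \<boxtimes> q) = 0"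
        using ext(2)[OF ij] ext(3,5)[OF that(1,1)] ext(5)[OF that(2,2)]
        by (simp_all add: A_def Z_def q_def)
      show ?thesis
        unfolding split comm_mult_right comms by (simp add: tensor_mult qq)
    qed
    then show "comm ?S (A i \<boxtimes> (A j * q) + A j \<boxtimes> (A i * q)) =
        - ((A i * A j) \<boxtimes> (Z * t)) + - ((A i * A j) \<boxtimes> (Z * t))"
      using ij by (simp add: comm_add_right AA)
    have split: "- ((A i * A j) \<boxtimes> (Z * t)) = (- 1) * ((A i \<boxtimes> 1) * ((A j \<boxtimes> 1) * (1 \<boxtimes> (Z * t))))"
      by (simp add: tensor_mult mult.assoc)
    have comms: "comm ?S (A i \<boxtimes> 1) = 0" "comm ?S (A j \<boxtimes> 1) = 0" "comm ?S (1 \<boxtimes> (Z * t)) = 0"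
      "comm ?S (- 1) = 0"
      using ext(3)[OF ij(1,1)] ext(3)[OF ij(2,2)] ZS[of "- 1"]
      by (simp_all add: A_def t_def) (simp add: comm_def)
    show "comm ?S (- ((A i * A j) \<boxtimes> (Z * t))) = 0"
      unfolding split comm_mult_right comms by simp
  qed
  from conj_by_trans[OF prim[OF H0(3) act(9)[OF ij ij(1)]] this]
  show "conj_by twist (fls_coproduct (F_plus i j)) (F_plus i j \<boxtimes> 1 + 1 \<boxtimes> F_plus i j
       + (A i \<boxtimes> (A j * q) + A j \<boxtimes> (A i * q)) + - ((A i * A j) \<boxtimes> (Z * t)))"
    unfolding twist_factors cop .
qed

section \<open>Primitivity of the primed generators\<close>

lemma twisted_coproduct_E_minus:
  assumes "i \<in> {1..CARD('n)} - {1}" "j \<in> {1..CARD('n)} - {1}"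
  shows "twisted_coproduct (E_minus i j :: 'n::finite sp uea fls) = E_minus i j \<boxtimes> 1 + 1 \<boxtimes> E_minus i j"
  by (rule twisted_coproductI[OF twist_conj(4)[OF assms]])

lemma twisted_coproduct_H_cartan:
  assumes "i \<in> {1..CARD('n)} - {1}"
  shows "twisted_coproduct (H_cartan i :: 'n::finite sp uea fls) = H_cartan i \<boxtimes> 1 + 1 \<boxtimes> H_cartan i"
proof (rule twisted_coproductI)
  have "i \<in> {1..CARD('n)}" using assms by simp
  then show "conj_by twist (fls_coproduct (H_cartan i :: 'n sp uea fls)) (H_cartan i \<boxtimes> 1 + 1 \<boxtimes> H_cartan i)"
    using conj_by_scale[OF twist_conj(4)[OF assms assms], of "1 / 2"]
    by (simp add: H_cartan_eq fls_coproduct.hom_scale tensor_bilinear cscale_add_right)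
qed

text \<open>In the coproduct of B_i B_j t the relations r^2 t = 1, (1 + Z) t = 1 and r t = q reduce
  the four terms. The cross terms become those of the first commutator of \<open>E_plus i j\<close>,
  and (1 + Z) \<boxtimes> B_i B_j t exceeds the half double commutator by 1 \<boxtimes> B_i B_j t,
  as primitivity requires.\<close>

lemma twisted_coproduct_E_plus:
  fixes i j :: nat
  defines "X \<equiv> gens.p' i j :: 'n::finite sp uea fls"
  assumes ij: "i \<in> {1..CARD('n)} - {1}" "j \<in> {1..CARD('n)} - {1}"
  shows "twisted_coproduct X = X \<boxtimes> 1 + 1 \<boxtimes> X"
proof (rule twisted_coproductI)
  define Z q r t where "Z = (E_plus 1 1 :: 'n sp uea fls)" and "q = (sigma_exp (- 1 / 2) :: 'n sp uea fls)"
    and "r = (sigma_exp (1 / 2) :: 'n sp uea fls)" and "t = (sigma_exp (- 1) :: 'n sp uea fls)"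
  define B where "B = (E_plus 1 :: nat \<Rightarrow> 'n sp uea fls)"
  note defs = Z_def q_def r_def t_def B_def
  note conj = twist_conj[where ?'n = 'n, folded defs]
  have X: "X = E_plus i j - B i * B j * t"
    unfolding X_def gens.p'_def by (simp add: defs sigma_exp_special(3))
  have "conj_by twist (fls_coproduct X) (E_plus i j \<boxtimes> 1 + 1 \<boxtimes> E_plus i j
       + (B j \<boxtimes> (B i * q) + B i \<boxtimes> (B j * q)) + Z \<boxtimes> (B i * B j * t)
       - (B i \<boxtimes> r + (1 + Z) \<boxtimes> B i) * (B j \<boxtimes> r + (1 + Z) \<boxtimes> B j) * (t \<boxtimes> t))"
    unfolding X fls_coproduct.hom_diff fls_coproduct.hom_mult
    by (intro conj_by_diff conj_by_mult conj[OF ij] conj(2)[OF ij(1,1)] conj(3)[OF ij])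
  also have "(B i \<boxtimes> r + (1 + Z) \<boxtimes> B i) * (B j \<boxtimes> r + (1 + Z) \<boxtimes> B j) * (t \<boxtimes> t) =
      (B i * B j * t) \<boxtimes> 1 + B i \<boxtimes> (B j * q) + B j \<boxtimes> (B i * q) + (1 + Z) \<boxtimes> (B i * B j * t)"
  proof -
    have st: "(1 + Z) * t = 1" "r * r * t = 1" "r * t = q"
      by (simp_all add: Z_def r_def t_def q_def sigma_exp_add sigma_exp_half sigma_exp_special(1))
    have com: "comm (E_plus 1 1) (B k) = 0" if "k \<in> {1..CARD('n)} - {1}" for k
      using gens.heisenberg(5)[OF that that] by (simp add: B_def)
    have rB: "r * B j = B j * r"
      using sigma_exp_comm[OF com[OF ij(2)]] by (simp add: r_def comm_eq_0_iff)
    have sB: "(1 + Z) * B j = B j * (1 + Z)"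
      using com[OF ij(2)] by (simp add: Z_def comm_eq_0_iff distrib_left distrib_right)
    have 1: "B i * (1 + Z) * t = B i" "(1 + Z) * B j * t = B j" "(1 + Z) * (1 + Z) * t = 1 + Z"
      using st(1) sB by (simp_all add: mult.assoc)
    have 2: "r * B j * t = B j * q" "B i * r * t = B i * q"
      using st(3) rB by (simp_all add: mult.assoc)
    \<comment> \<open>Naming the sum keeps the distributive laws from breaking 1 + Z apart.\<close>
    define s where "s = 1 + Z"
    show ?thesis
      using 1 2 st(2) unfolding s_def[symmetric]
      by (simp add: distrib_left distrib_right tensor_mult add.assoc add.left_commute)
  qed
  also have "E_plus i j \<boxtimes> 1 + 1 \<boxtimes> E_plus i j
       + (B j \<boxtimes> (B i * q) + B i \<boxtimes> (B j * q)) + Z \<boxtimes> (B i * B j * t)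
       - ((B i * B j * t) \<boxtimes> 1 + B i \<boxtimes> (B j * q) + B j \<boxtimes> (B i * q) + (1 + Z) \<boxtimes> (B i * B j * t))
      = X \<boxtimes> 1 + 1 \<boxtimes> X"
    unfolding X by (simp only: tensor_bilinear) (simp add: algebra_simps)
  finally show "conj_by twist (fls_coproduct X) (X \<boxtimes> 1 + 1 \<boxtimes> X)" .
qed

text \<open>The cross terms of the coproduct of A_i A_j cancel the first commutator. The remaining
  A_i A_j \<boxtimes> t joins A_i A_j \<boxtimes> Z t from the double commutator into A_i A_j
  \<boxtimes> (1 + Z) t = A_i A_j \<boxtimes> 1.\<close>

lemma twisted_coproduct_F_plus:
  fixes i j :: nat
  defines "X \<equiv> gens.f' i j :: 'n::finite sp uea fls"
  assumes ij: "i \<in> {1..CARD('n)} - {1}" "j \<in> {1..CARD('n)} - {1}"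
  shows "twisted_coproduct X = X \<boxtimes> 1 + 1 \<boxtimes> X"
proof (rule twisted_coproductI)
  define Z q t where "Z = (E_plus 1 1 :: 'n sp uea fls)" and "q = (sigma_exp (- 1 / 2) :: 'n sp uea fls)"
    and "t = (sigma_exp (- 1) :: 'n sp uea fls)"
  define A where "A = (E_minus 1 :: nat \<Rightarrow> 'n sp uea fls)"
  note defs = Z_def q_def t_def A_def
  note conj = twist_conj[where ?'n = 'n, folded defs]
  have X: "X = F_plus i j - A i * A j"
    by (simp add: X_def gens.f'_def defs)
  have "conj_by twist (fls_coproduct X) (F_plus i j \<boxtimes> 1 + 1 \<boxtimes> F_plus i j
       + (A i \<boxtimes> (A j * q) + A j \<boxtimes> (A i * q)) + - ((A i * A j) \<boxtimes> (Z * t))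
       - (A i \<boxtimes> q + 1 \<boxtimes> A i) * (A j \<boxtimes> q + 1 \<boxtimes> A j))"
    unfolding X fls_coproduct.hom_diff fls_coproduct.hom_mult
    by (intro conj_by_diff conj_by_mult conj[OF ij] conj(1)[OF ij(1,1)])
  also have "(A i \<boxtimes> q + 1 \<boxtimes> A i) * (A j \<boxtimes> q + 1 \<boxtimes> A j) =
      (A i * A j) \<boxtimes> t + A i \<boxtimes> (A j * q) + A j \<boxtimes> (A i * q) + 1 \<boxtimes> (A i * A j)"
  proof -
    have "q * q = t"
      by (simp add: q_def t_def sigma_exp_add)
    moreover have "q * A j = A j * q"
      using sigma_exp_comm[OF gens.heisenberg(4)[OF ij(2,2)]] by (simp add: q_def A_def comm_eq_0_iff)
    ultimately show ?thesis
      by (simp add: distrib_left distrib_right tensor_mult add.assoc add.left_commute)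
  qed
  also have "F_plus i j \<boxtimes> 1 + 1 \<boxtimes> F_plus i j
       + (A i \<boxtimes> (A j * q) + A j \<boxtimes> (A i * q)) + - ((A i * A j) \<boxtimes> (Z * t))
       - ((A i * A j) \<boxtimes> t + A i \<boxtimes> (A j * q) + A j \<boxtimes> (A i * q) + 1 \<boxtimes> (A i * A j)) =
      F_plus i j \<boxtimes> 1 + 1 \<boxtimes> F_plus i j - (A i * A j) \<boxtimes> ((1 + Z) * t) - 1 \<boxtimes> (A i * A j)"
    by (simp add: distrib_right tensor_bilinear algebra_simps)
  also have "(1 + Z) * t = 1"
    by (simp add: Z_def t_def sigma_exp_half)
  also have "F_plus i j \<boxtimes> 1 + 1 \<boxtimes> F_plus i j - (A i * A j) \<boxtimes> 1 - 1 \<boxtimes> (A i * A j) = X \<boxtimes> 1 + 1 \<boxtimes> X"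
    unfolding X by (simp add: tensor_bilinear algebra_simps)
  finally show "conj_by twist (fls_coproduct X) (X \<boxtimes> 1 + 1 \<boxtimes> X)" .
qed

section \<open>Representing symplectic matrices\<close>

lemma sp_matsD:
  assumes A: "A \<in> sp_mats N" and ij: "i < N" "j < N"
  shows "A $$ (i, j + N) = A $$ (j, i + N)" "A $$ (i + N, j) = A $$ (j + N, i)"
    "A $$ (i + N, j + N) = - A $$ (j, i)"
proof -
  have c: "A \<in> carrier_mat (2 * N) (2 * N)" using A by (rule sp_mats_carrier)
  then have T: "transpose_mat A \<in> carrier_mat (2 * N) (2 * N)" by simp
  have eq: "(transpose_mat A * symplectic_form N) $$ (x, y) = - (symplectic_form N * A) $$ (x, y)"
    if "x < 2 * N" "y < 2 * N" for x y
    using A c that symplectic_form_mult_carrier[OF c] unfolding sp_mats_iff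
    by (simp del: index_mult_mat(1))
  note entries = mult_symplectic_form_index[OF T] symplectic_form_mult_index[OF c]
  show "A $$ (i, j + N) = A $$ (j, i + N)"
    using eq[of "i + N" "j + N"] ij c by (simp add: entries del: index_mult_mat(1))
  show "A $$ (i + N, j) = A $$ (j + N, i)"
    using eq[of i j] ij c by (simp add: entries del: index_mult_mat(1))
  show "A $$ (i + N, j + N) = - A $$ (j, i)"
    using eq[of i "j + N"] ij c by (simp add: entries del: index_mult_mat(1))
qed

lemma sum_split_half: "(\<Sum>k<2 * n. g k) = (\<Sum>k<n. g k + g (k + n))"
  for g :: "nat \<Rightarrow> 'a::comm_monoid_add"
  using sum.atLeastLessThan_concat[of 0 n "2 * n" g] sum.shift_bounds_nat_ivl[of g 0 n n]
  by (simp add: sum.distrib lessThan_atLeast0 mult_2)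

lemma mat_commutator_index:
  assumes "A \<in> carrier_mat (2 * n) (2 * n)" "B \<in> carrier_mat (2 * n) (2 * n)" "x < 2 * n" "y < 2 * n"
  shows "mat_commutator A B $$ (x, y) =
    (\<Sum>k<n. A $$ (x, k) * B $$ (k, y)) + (\<Sum>k<n. A $$ (x, k + n) * B $$ (k + n, y))
    - (\<Sum>k<n. B $$ (x, k) * A $$ (k, y)) - (\<Sum>k<n. B $$ (x, k + n) * A $$ (k + n, y))"
proof -
  have "mat_commutator A B $$ (x, y) =
      (\<Sum>k<2 * n. A $$ (x, k) * B $$ (k, y)) - (\<Sum>k<2 * n. B $$ (x, k) * A $$ (k, y))"
    using assms by (simp add: mat_commutator_def scalar_prod_def lessThan_atLeast0)
  then show ?thesis by (simp add: sum_split_half sum.distrib)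
qed

section \<open>Generators paired with coefficient blocks\<close>

abbreviation (input) mmul :: "nat \<Rightarrow> (nat \<Rightarrow> nat \<Rightarrow> complex) \<Rightarrow> (nat \<Rightarrow> nat \<Rightarrow> complex) \<Rightarrow> nat \<Rightarrow> nat \<Rightarrow> complex" where
  "mmul n a b \<equiv> \<lambda>i j. \<Sum>k<n. a i k * b k j"

abbreviation (input) mtr :: "(nat \<Rightarrow> nat \<Rightarrow> complex) \<Rightarrow> nat \<Rightarrow> nat \<Rightarrow> complex" where
  "mtr a \<equiv> \<lambda>i j. a j i"

text \<open>The pairing of a coefficient block with a family of generators; commutators of such
  pairings become pairings with products of blocks.\<close>

definition lc :: "nat \<Rightarrow> (nat \<Rightarrow> nat \<Rightarrow> 'a::complex_vector) \<Rightarrow> (nat \<Rightarrow> nat \<Rightarrow> complex) \<Rightarrow> 'a" where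
  "lc n x a = (\<Sum>i<n. \<Sum>j<n. a i j *\<^sub>C x i j)"

lemma lc_cong: "(\<And>i j. i < n \<Longrightarrow> j < n \<Longrightarrow> a i j = b i j) \<Longrightarrow> lc n x a = lc n x b"
  by (simp add: lc_def)

lemma lc_linear:
  "lc n x (\<lambda>i j. a i j + b i j) = lc n x a + lc n x b"
  "lc n x (\<lambda>i j. a i j - b i j) = lc n x a - lc n x b"
  "lc n x (\<lambda>i j. c * a i j) = c *\<^sub>C lc n x a"
  "lc n x (\<lambda>i j. 0) = 0"
  by (simp_all add: lc_def cscale_add_left complex_vector.scale_left_diff_distrib sum.distrib
      sum_subtractf complex_vector.scale_sum_right cscale_cscale)

lemma lc_sum: "lc n x (\<lambda>i j. \<Sum>y\<in>Y. a y i j) = (\<Sum>y\<in>Y. lc n x (a y))"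
  by (induction Y rule: infinite_finite_induct) (simp_all add: lc_linear)

lemma lc_unit:
  assumes "k < n" "l < n"
  shows "lc n x (\<lambda>i j. kd i k * kd j l) = x k l"
proof -
  have "lc n x (\<lambda>i j. kd i k * kd j l) = (\<Sum>i<n. kd i k *\<^sub>C (\<Sum>j<n. kd j l *\<^sub>C x i j))"
    unfolding lc_def complex_vector.scale_sum_right by simp
  then show ?thesis using assms by (simp add: sum_kd)
qed

lemma lc_mtr:
  assumes "\<And>i j. i < n \<Longrightarrow> j < n \<Longrightarrow> x i j = x j i"
  shows "lc n x (mtr a) = lc n x a"
proof -
  have "lc n x (mtr a) = (\<Sum>i<n. \<Sum>j<n. a i j *\<^sub>C x j i)"
    unfolding lc_def by (rule sum.swap)
  also have "\<dots> = lc n x a"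
    unfolding lc_def using assms by (intro sum.cong refl) simp
  finally show ?thesis .
qed

lemma lc_triple:
  "(\<Sum>i<n. \<Sum>j<n. \<Sum>k<n. g i j k *\<^sub>C x i k) = lc n x (\<lambda>i k. \<Sum>j<n. g i j k)"
  "(\<Sum>i<n. \<Sum>j<n. \<Sum>k<n. g i j k *\<^sub>C x k j) = lc n x (\<lambda>k j. \<Sum>i<n. g i j k)"
  "(\<Sum>i<n. \<Sum>j<n. \<Sum>k<n. g i j k *\<^sub>C x j k) = lc n x (\<lambda>j k. \<Sum>i<n. g i j k)"
proof -
  show "(\<Sum>i<n. \<Sum>j<n. \<Sum>k<n. g i j k *\<^sub>C x i k) = lc n x (\<lambda>i k. \<Sum>j<n. g i j k)"
    unfolding lc_def complex_vector.scale_sum_left by (intro sum.cong refl sum.swap)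
  have "(\<Sum>i<n. \<Sum>j<n. \<Sum>k<n. g i j k *\<^sub>C x j k) = (\<Sum>j<n. \<Sum>i<n. \<Sum>k<n. g i j k *\<^sub>C x j k)"
    by (rule sum.swap)
  also have "\<dots> = lc n x (\<lambda>j k. \<Sum>i<n. g i j k)"
    unfolding lc_def complex_vector.scale_sum_left by (intro sum.cong refl sum.swap)
  finally show T3: "(\<Sum>i<n. \<Sum>j<n. \<Sum>k<n. g i j k *\<^sub>C x j k) = lc n x (\<lambda>j k. \<Sum>i<n. g i j k)" .
  have "(\<Sum>i<n. \<Sum>j<n. \<Sum>k<n. g i j k *\<^sub>C x k j) = (\<Sum>i<n. \<Sum>k<n. \<Sum>j<n. g i j k *\<^sub>C x k j)"
    by (intro sum.cong refl sum.swap)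
  also have "\<dots> = (\<Sum>k<n. \<Sum>i<n. \<Sum>j<n. g i j k *\<^sub>C x k j)"
    by (rule sum.swap)
  also have "\<dots> = lc n x (\<lambda>k j. \<Sum>i<n. g i j k)"
    unfolding lc_def complex_vector.scale_sum_left by (intro sum.cong refl sum.swap)
  finally show "(\<Sum>i<n. \<Sum>j<n. \<Sum>k<n. g i j k *\<^sub>C x k j) = lc n x (\<lambda>k j. \<Sum>i<n. g i j k)" .
qed

lemma kd_contract:
  fixes G :: "nat \<Rightarrow> nat \<Rightarrow> nat \<Rightarrow> nat \<Rightarrow> 'a::complex_vector"
  shows "(\<Sum>i<n. \<Sum>j<n. \<Sum>k<n. \<Sum>l<n. kd j k *\<^sub>C G i j k l) = (\<Sum>i<n. \<Sum>j<n. \<Sum>l<n. G i j j l)"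
    "(\<Sum>i<n. \<Sum>j<n. \<Sum>k<n. \<Sum>l<n. kd i k *\<^sub>C G i j k l) = (\<Sum>i<n. \<Sum>j<n. \<Sum>l<n. G i j i l)"
    "(\<Sum>i<n. \<Sum>j<n. \<Sum>k<n. \<Sum>l<n. kd j l *\<^sub>C G i j k l) = (\<Sum>i<n. \<Sum>j<n. \<Sum>k<n. G i j k j)"
    "(\<Sum>i<n. \<Sum>j<n. \<Sum>k<n. \<Sum>l<n. kd i l *\<^sub>C G i j k l) = (\<Sum>i<n. \<Sum>j<n. \<Sum>k<n. G i j k i)"
  by (simp_all add: sum_kd flip: complex_vector.scale_sum_right)

lemma comm_lc:
  fixes x y :: "nat \<Rightarrow> nat \<Rightarrow> 'a::complex_algebra_1"
  shows "comm (lc n x a) (lc n y b) =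
    (\<Sum>i<n. \<Sum>j<n. \<Sum>k<n. \<Sum>l<n. (a i j * b k l) *\<^sub>C comm (x i j) (y k l))"
  unfolding lc_def comm_sum_left comm_scale_left
  by (simp add: comm_sum_right comm_scale_right complex_vector.scale_sum_right cscale_cscale)

text \<open>The indices start at 0 so that they coincide with row and column numbers of a
  block.\<close>

locale sp_rep = sp_relations "{..<n}" e p f for n and e p f :: "nat \<Rightarrow> nat \<Rightarrow> 'a::complex_algebra_1"
begin

lemma comm_lc_ee: "comm (lc n e a) (lc n e b) = lc n e (mmul n a b) - lc n e (mmul n b a)"
proof -
  have "comm (lc n e a) (lc n e b) =
      (\<Sum>i<n. \<Sum>j<n. \<Sum>k<n. \<Sum>l<n. kd j k *\<^sub>C (a i j * b k l) *\<^sub>C e i l) -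
      (\<Sum>i<n. \<Sum>j<n. \<Sum>k<n. \<Sum>l<n. kd i l *\<^sub>C (a i j * b k l) *\<^sub>C e k j)"
    unfolding comm_lc sum_subtractf[symmetric]
    by (intro sum.cong refl)
       (simp add: ee complex_vector.scale_right_diff_distrib mult.commute mult.left_commute)
  also have "\<dots> = lc n e (mmul n a b) - lc n e (\<lambda>k j. \<Sum>i<n. a i j * b k i)"
    by (simp only: kd_contract, simp only: lc_triple)
  finally show ?thesis by (simp add: mult.commute)
qed

text \<open>For a symmetric block both Kronecker terms contribute the same pairing, hence the factor
  2, here and in \<open>comm_lc_ef\<close>. In \<open>comm_lc_pf\<close> four terms coincide. The
  halves in \<open>rep\<close> compensate these factors.\<close>

lemma comm_lc_ep:
  assumes "\<And>i j. i < n \<Longrightarrow> j < n \<Longrightarrow> b i j = b j i"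
  shows "comm (lc n e a) (lc n p b) = 2 *\<^sub>C lc n p (mmul n a b)"
proof -
  have "comm (lc n e a) (lc n p b) =
      (\<Sum>i<n. \<Sum>j<n. \<Sum>k<n. \<Sum>l<n. kd j k *\<^sub>C (a i j * b k l) *\<^sub>C p i l) +
      (\<Sum>i<n. \<Sum>j<n. \<Sum>k<n. \<Sum>l<n. kd j l *\<^sub>C (a i j * b k l) *\<^sub>C p i k)"
    unfolding comm_lc sum.distrib[symmetric]
    by (intro sum.cong refl) (simp add: ep cscale_add_right mult.commute mult.left_commute)
  also have "\<dots> = lc n p (mmul n a b) + lc n p (\<lambda>i k. \<Sum>j<n. a i j * b k j)"
    by (simp only: kd_contract, simp only: lc_triple)
  also have "lc n p (\<lambda>i k. \<Sum>j<n. a i j * b k j) = lc n p (mmul n a b)"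
    by (rule lc_cong, rule sum.cong) (simp_all add: assms)
  finally show ?thesis
    using cscale_add_left[of 1 1 "lc n p (mmul n a b)"] by (simp add: cscale_one)
qed

lemma comm_lc_ef:
  assumes "\<And>i j. i < n \<Longrightarrow> j < n \<Longrightarrow> c i j = c j i"
  shows "comm (lc n e a) (lc n f c) = - (2 *\<^sub>C lc n f (mmul n (mtr a) c))"
proof -
  have "comm (lc n e a) (lc n f c) =
      - (\<Sum>i<n. \<Sum>j<n. \<Sum>k<n. \<Sum>l<n. kd i k *\<^sub>C (a i j * c k l) *\<^sub>C f j l) -
      (\<Sum>i<n. \<Sum>j<n. \<Sum>k<n. \<Sum>l<n. kd i l *\<^sub>C (a i j * c k l) *\<^sub>C f j k)"
    unfolding comm_lc sum_negf[symmetric] sum_subtractf[symmetric]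
    by (intro sum.cong refl)
       (simp add: ef complex_vector.scale_right_diff_distrib complex_vector.scale_minus_right
         mult.commute mult.left_commute)
  also have "\<dots> = - lc n f (mmul n (mtr a) c) - lc n f (\<lambda>j k. \<Sum>i<n. a i j * c k i)"
    by (simp only: kd_contract, simp only: lc_triple(1,3))
  also have "lc n f (\<lambda>j k. \<Sum>i<n. a i j * c k i) = lc n f (mmul n (mtr a) c)"
    by (rule lc_cong, rule sum.cong) (simp_all add: assms)
  finally show ?thesis
    using cscale_add_left[of 1 1 "lc n f (mmul n (mtr a) c)"] by (simp add: cscale_one)
qed

lemma comm_lc_pp: "comm (lc n p b) (lc n p b') = 0"
  and comm_lc_ff: "comm (lc n f c) (lc n f c') = 0"
  by (simp_all add: comm_lc pp ff)

lemma comm_lc_pf: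
  assumes b: "\<And>i j. i < n \<Longrightarrow> j < n \<Longrightarrow> b i j = b j i"
    and c: "\<And>i j. i < n \<Longrightarrow> j < n \<Longrightarrow> c i j = c j i"
  shows "comm (lc n p b) (lc n f c) = 4 *\<^sub>C lc n e (mmul n b c)"
proof -
  have "comm (lc n p b) (lc n f c) =
      (\<Sum>i<n. \<Sum>j<n. \<Sum>k<n. \<Sum>l<n. kd j k *\<^sub>C (b i j * c k l) *\<^sub>C e i l) +
      (\<Sum>i<n. \<Sum>j<n. \<Sum>k<n. \<Sum>l<n. kd j l *\<^sub>C (b i j * c k l) *\<^sub>C e i k) +
      (\<Sum>i<n. \<Sum>j<n. \<Sum>k<n. \<Sum>l<n. kd i k *\<^sub>C (b i j * c k l) *\<^sub>C e j l) +
      (\<Sum>i<n. \<Sum>j<n. \<Sum>k<n. \<Sum>l<n. kd i l *\<^sub>C (b i j * c k l) *\<^sub>C e j k)"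
    unfolding comm_lc sum.distrib[symmetric]
    by (intro sum.cong refl) (simp add: pf cscale_add_right mult.commute mult.left_commute)
  also have "\<dots> = lc n e (mmul n b c) + lc n e (\<lambda>i k. \<Sum>j<n. b i j * c k j) +
      lc n e (\<lambda>j l. \<Sum>i<n. b i j * c i l) + lc n e (\<lambda>j k. \<Sum>i<n. b i j * c k i)"
    by (simp only: kd_contract, simp only: lc_triple(1,3))
  also have "lc n e (\<lambda>i k. \<Sum>j<n. b i j * c k j) = lc n e (mmul n b c)"
    by (rule lc_cong, rule sum.cong) (simp_all add: c)
  also have "lc n e (\<lambda>j l. \<Sum>i<n. b i j * c i l) = lc n e (mmul n b c)"
    by (rule lc_cong, rule sum.cong) (simp_all add: b)
  also have "lc n e (\<lambda>j k. \<Sum>i<n. b i j * c k i) = lc n e (mmul n b c)"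
  proof (rule lc_cong, rule sum.cong)
    fix j k i assume "j < n" "k < n" "i \<in> {..<n}"
    then show "b i j * c k i = b j i * c i k" using b[of i j] c[of k i] by simp
  qed simp
  finally have "comm (lc n p b) (lc n f c) =
      (1 + 1 + 1 + 1) *\<^sub>C lc n e (mmul n b c)"
    by (simp only: cscale_add_left cscale_one)
  then show ?thesis by simp
qed

text \<open>The lower right block of a symplectic matrix is determined by the upper left one, so
  three blocks suffice. The halves account for \<open>p i j = p j i\<close> and
  \<open>f i j = f j i\<close>: an off-diagonal generator occurs twice in the double sum, and the
  matrix of E_(i+i) has the entry 2.\<close>

definition rep :: "complex mat \<Rightarrow> 'a" where
  "rep M = lc n e (\<lambda>i j. M $$ (i, j)) + (1 / 2) *\<^sub>C lc n p (\<lambda>i j. M $$ (i, j + n))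
     + (1 / 2) *\<^sub>C lc n f (\<lambda>i j. M $$ (i + n, j))"

lemma rep_add:
  assumes "A \<in> carrier_mat (2 * n) (2 * n)" "B \<in> carrier_mat (2 * n) (2 * n)"
  shows "rep (A + B) = rep A + rep B"
proof -
  have "lc n x (\<lambda>i j. (A + B) $$ (u i, v j)) = lc n x (\<lambda>i j. A $$ (u i, v j)) + lc n x (\<lambda>i j. B $$ (u i, v j))"
    if "\<And>i. i < n \<Longrightarrow> u i < 2 * n" "\<And>i. i < n \<Longrightarrow> v i < 2 * n" for u v and x :: "nat \<Rightarrow> nat \<Rightarrow> 'a"
    unfolding lc_linear[symmetric] using assms that by (intro lc_cong) auto
  from this[of "\<lambda>i. i" "\<lambda>i. i"] this[of "\<lambda>i. i" "\<lambda>i. i + n"] this[of "\<lambda>i. i + n" "\<lambda>i. i"]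
  show ?thesis by (simp add: rep_def cscale_add_right)
qed

lemma rep_scale:
  assumes "A \<in> carrier_mat (2 * n) (2 * n)"
  shows "rep (c \<cdot>\<^sub>m A) = c *\<^sub>C rep A"
proof -
  have "lc n x (\<lambda>i j. (c \<cdot>\<^sub>m A) $$ (u i, v j)) = c *\<^sub>C lc n x (\<lambda>i j. A $$ (u i, v j))"
    if "\<And>i. i < n \<Longrightarrow> u i < 2 * n" "\<And>i. i < n \<Longrightarrow> v i < 2 * n" for u v and x :: "nat \<Rightarrow> nat \<Rightarrow> 'a"
    unfolding lc_linear[symmetric] using assms that by (intro lc_cong) auto
  from this[of "\<lambda>i. i" "\<lambda>i. i"] this[of "\<lambda>i. i" "\<lambda>i. i + n"] this[of "\<lambda>i. i + n" "\<lambda>i. i"]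
  show ?thesis by (simp add: rep_def cscale_add_right cscale_cscale)
qed

text \<open>The lower right blocks are replaced by negative transposes of the upper left ones. With
  the symmetry of the off-diagonal blocks, half of the products in an off-diagonal block of the
  commutator become transposes of the other half, and symmetry of \<open>p\<close> and
  \<open>f\<close> identifies their pairings.\<close>

lemma rep_commutator:
  assumes M: "M \<in> sp_mats n" and M': "M' \<in> sp_mats n"
  shows "rep (mat_commutator M M') = comm (rep M) (rep M')"
proof -
  define a b c where "a = (\<lambda>i j. M $$ (i, j))" and "b = (\<lambda>i j. M $$ (i, j + n))"
    and "c = (\<lambda>i j. M $$ (i + n, j))"
  define a' b' c' where "a' = (\<lambda>i j. M' $$ (i, j))" and "b' = (\<lambda>i j. M' $$ (i, j + n))"
    and "c' = (\<lambda>i j. M' $$ (i + n, j))"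
  note defs = a_def b_def c_def a'_def b'_def c'_def
  have sym: "b i j = b j i" "c i j = c j i" "b' i j = b' j i" "c' i j = c' j i"
    if "i < n" "j < n" for i j
    using sp_matsD[OF M that] sp_matsD[OF M' that] by (simp_all add: defs)
  have p_sym': "lc n p (mtr u) = lc n p u" and f_sym': "lc n f (mtr u) = lc n f u" for u
    by (rule lc_mtr, simp add: p_sym f_sym)+
  note entry = mat_commutator_index[OF sp_mats_carrier[OF M] sp_mats_carrier[OF M']]
  have "lc n e (\<lambda>i j. mat_commutator M M' $$ (i, j)) =
      lc n e (\<lambda>i j. mmul n a a' i j + mmul n b c' i j - mmul n a' a i j - mmul n b' c i j)"
    by (rule lc_cong) (simp add: entry defs)
  then have E: "lc n e (\<lambda>i j. mat_commutator M M' $$ (i, j)) =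
      lc n e (mmul n a a') + lc n e (mmul n b c') - lc n e (mmul n a' a) - lc n e (mmul n b' c)"
    by (simp only: lc_linear)
  have "lc n p (\<lambda>i j. mat_commutator M M' $$ (i, j + n)) =
      lc n p (\<lambda>i j. mmul n a b' i j - mtr (mmul n a' b) i j - mmul n a' b i j + mtr (mmul n a b') i j)"
  proof (rule lc_cong)
    fix i j assume ij: "i < n" "j < n"
    have "(\<Sum>k<n. M $$ (i, k + n) * M' $$ (k + n, j + n)) = - mmul n a' b j i"
      unfolding sum_negf[symmetric]
      by (rule sum.cong) (use ij sp_matsD[OF M'] sym in \<open>simp_all add: defs\<close>)
    moreover have "(\<Sum>k<n. M' $$ (i, k + n) * M $$ (k + n, j + n)) = - mmul n a b' j i"
      unfolding sum_negf[symmetric]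
      by (rule sum.cong) (use ij sp_matsD[OF M] sym in \<open>simp_all add: defs\<close>)
    ultimately show "mat_commutator M M' $$ (i, j + n) =
        mmul n a b' i j - mtr (mmul n a' b) i j - mmul n a' b i j + mtr (mmul n a b') i j"
      using ij by (simp add: entry) (simp add: defs)
  qed
  then have P: "lc n p (\<lambda>i j. mat_commutator M M' $$ (i, j + n)) =
      2 *\<^sub>C lc n p (mmul n a b') - 2 *\<^sub>C lc n p (mmul n a' b)"
    using cscale_add_left[of 1 1 "lc n p (mmul n a b')"] cscale_add_left[of 1 1 "lc n p (mmul n a' b)"]
    by (simp add: lc_linear p_sym'[of "mmul n a b'"] p_sym'[of "mmul n a' b"] cscale_one)
  have "lc n f (\<lambda>i j. mat_commutator M M' $$ (i + n, j)) =
      lc n f (\<lambda>i j. mtr (mmul n (mtr a') c) i j - mmul n (mtr a) c' i j - mtr (mmul n (mtr a) c') i j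
        + mmul n (mtr a') c i j)"
  proof (rule lc_cong)
    fix i j assume ij: "i < n" "j < n"
    have "(\<Sum>k<n. M $$ (i + n, k + n) * M' $$ (k + n, j)) = - mmul n (mtr a) c' i j"
      "(\<Sum>k<n. M' $$ (i + n, k + n) * M $$ (k + n, j)) = - mmul n (mtr a') c i j"
      "(\<Sum>k<n. M $$ (i + n, k) * M' $$ (k, j)) = mmul n (mtr a') c j i"
      "(\<Sum>k<n. M' $$ (i + n, k) * M $$ (k, j)) = mmul n (mtr a) c' j i"
      unfolding sum_negf[symmetric]
      by (rule sum.cong, use ij sp_matsD[OF M] sp_matsD[OF M'] sym in \<open>simp_all add: defs\<close>)+
    then show "mat_commutator M M' $$ (i + n, j) = mtr (mmul n (mtr a') c) i j - mmul n (mtr a) c' i j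
        - mtr (mmul n (mtr a) c') i j + mmul n (mtr a') c i j"
      using ij by (simp add: entry)
  qed
  then have F: "lc n f (\<lambda>i j. mat_commutator M M' $$ (i + n, j)) =
      2 *\<^sub>C lc n f (mmul n (mtr a') c) - 2 *\<^sub>C lc n f (mmul n (mtr a) c')"
    using cscale_add_left[of 1 1 "lc n f (mmul n (mtr a) c')"]
      cscale_add_left[of 1 1 "lc n f (mmul n (mtr a') c)"]
    by (simp add: lc_linear f_sym'[of "mmul n (mtr a) c'"] f_sym'[of "mmul n (mtr a') c"] cscale_one)
  have swap: "comm (lc n p b) (lc n e a') = - comm (lc n e a') (lc n p b)"
    "comm (lc n f c) (lc n e a') = - comm (lc n e a') (lc n f c)"
    "comm (lc n f c) (lc n p b') = - comm (lc n p b') (lc n f c)"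
    by (rule comm_swap)+
  have "comm (rep M) (rep M') = lc n e (mmul n a a') - lc n e (mmul n a' a)
      + lc n p (mmul n a b') - lc n p (mmul n a' b)
      - lc n f (mmul n (mtr a) c') + lc n f (mmul n (mtr a') c)
      + lc n e (mmul n b c') - lc n e (mmul n b' c)"
    unfolding rep_def defs[symmetric]
    by (simp add: comm_add_left comm_add_right comm_scale_left comm_scale_right comm_lc_pp comm_lc_ff
        swap comm_lc_ee comm_lc_ep comm_lc_ef comm_lc_pf sym cscale_cscale cscale_one
        complex_vector.scale_right_diff_distrib)
  then show ?thesis
    unfolding rep_def E P F
    by (simp add: complex_vector.scale_right_diff_distrib cscale_cscale cscale_one)
qed

end

lemma sp_relations_reindex:
  assumes "sp_relations I e p f" "\<And>i. i < n \<Longrightarrow> h i \<in> I" "\<And>i j. h i = h j \<longleftrightarrow> i = j"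
  shows "sp_rep n (\<lambda>i j. e (h i) (h j)) (\<lambda>i j. p (h i) (h j)) (\<lambda>i j. f (h i) (h j))"
proof -
  interpret sp_relations I e p f by fact
  have kd: "kd (h i) (h j) = kd i j" for i j
    by (simp add: kd_def assms(3))
  show ?thesis
    by unfold_locales (simp_all add: assms(2) p_sym f_sym ee ep ef pp ff pf kd)
qed

section \<open>Faithfulness of the enveloping algebra\<close>

lemma mat_unit_mult_mat:
  assumes "A \<in> carrier_mat (2 * N) (2 * N)" "x < 2 * N" "y < 2 * N" "b < 2 * N"
  shows "(mat_unit N a (Suc b) * A) $$ (x, y) = kd (Suc x) a * A $$ (b, y)"
    "(A * mat_unit N (Suc b) a) $$ (x, y) = A $$ (x, b) * kd (Suc y) a"
proof -
  have "(mat_unit N a (Suc b) * A) $$ (x, y) = (\<Sum>z<2 * N. kd (Suc x) a * kd (Suc z) (Suc b) * A $$ (z, y))"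
    using assms by (simp add: scalar_prod_def mat_unit_index lessThan_atLeast0)
  also have "\<dots> = (\<Sum>z<2 * N. if z = b then kd (Suc x) a * A $$ (b, y) else 0)"
    by (intro sum.cong) (auto simp: kd_def)
  finally show "(mat_unit N a (Suc b) * A) $$ (x, y) = kd (Suc x) a * A $$ (b, y)"
    using assms by simp
  have "(A * mat_unit N (Suc b) a) $$ (x, y) = (\<Sum>z<2 * N. A $$ (x, z) * (kd (Suc z) (Suc b) * kd (Suc y) a))"
    using assms by (simp add: scalar_prod_def mat_unit_index lessThan_atLeast0)
  also have "\<dots> = (\<Sum>z<2 * N. if z = b then A $$ (x, b) * kd (Suc y) a else 0)"
    by (intro sum.cong) (auto simp: kd_def)
  finally show "(A * mat_unit N (Suc b) a) $$ (x, y) = A $$ (x, b) * kd (Suc y) a"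
    using assms by simp
qed

text \<open>Long root vectors suffice. Commuting with E_(k+k) = 2 e_(k,N+k) leaves in column k only
  the diagonal entry and equates it with the one at N + k, which is its negative; so the left half
  vanishes. Commuting with F_(k+k) then kills the right half.\<close>

lemma sp_mats_centre_trivial:
  assumes A: "A \<in> sp_mats N"
    and central: "\<And>B. B \<in> sp_mats N \<Longrightarrow> mat_commutator A B = 0\<^sub>m (2 * N) (2 * N)"
  shows "A = 0\<^sub>m (2 * N) (2 * N)"
proof -
  have c: "A \<in> carrier_mat (2 * N) (2 * N)" using A by (rule sp_mats_carrier)
  have comm: "(A * B) $$ (x, y) = (B * A) $$ (x, y)" if "B \<in> sp_mats N" "x < 2 * N" "y < 2 * N" for B x y
  proof -
    have "B \<in> carrier_mat (2 * N) (2 * N)" using that(1) by (rule sp_mats_carrier)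
    then have "mat_commutator A B $$ (x, y) = (A * B) $$ (x, y) - (B * A) $$ (x, y)"
      using c that by (simp add: mat_commutator_def del: index_mult_mat(1))
    then show ?thesis using central[OF that(1)] that by simp
  qed
  have double: "A * (U + U) = A * U + A * U" "(U + U) * A = U * A + U * A"
    if "U \<in> carrier_mat (2 * N) (2 * N)" for U
    using mult_add_distrib_mat[OF c that that] add_mult_distrib_mat[OF that that c] by simp_all
  have left: "A $$ (r, k) = 0" if k: "k < N" and r: "r < 2 * N" for r k
  proof -
    have "Suc k \<in> {1..N}" using k by simp
    from comm[OF generator_mats_in_sp(2)[OF this this] r, of "N + k"] k
    have "A $$ (r, k) = kd r k * A $$ (N + k, N + k)"
      using c r unfolding E_plus_mat_def
      by (simp add: double mat_unit_mult_mat[OF c] kd_def del: index_mult_mat(1))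
    moreover have "A $$ (N + k, N + k) = - A $$ (k, k)"
      using sp_matsD(3)[OF A k k] by (simp add: add.commute)
    ultimately show ?thesis by (cases "r = k") simp_all
  qed
  have right: "A $$ (r, N + k) = 0" if k: "k < N" and r: "r < 2 * N" for r k
  proof -
    have "Suc k \<in> {1..N}" using k by simp
    from comm[OF generator_mats_in_sp(4)[OF this this] r, of k] k
    show ?thesis
      using c r left[OF k, of k] unfolding F_plus_mat_def
      by (simp add: double mat_unit_mult_mat[OF c, where b = "N + k", simplified]
          mat_unit_mult_mat[OF c] kd_def del: index_mult_mat(1))
  qed
  show ?thesis
  proof (rule eq_matI)
    fix x y assume "x < dim_row (0\<^sub>m (2 * N) (2 * N) :: complex mat)" "y < dim_col (0\<^sub>m (2 * N) (2 * N) :: complex mat)"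
    then show "A $$ (x, y) = 0\<^sub>m (2 * N) (2 * N) $$ (x, y)"
      using left[of y x] right[of "y - N" x] by (cases "y < N") auto
  qed (use c in auto)
qed

text \<open>The endomorphism algebra of the adjoint module is a type-level target for homomorphisms out of
  the enveloping algebra, so that the trivial centre yields injectivity of \<open>uea_in\<close> without the
  Poincare-Birkhoff-Witt theorem.\<close>

typedef (overloaded) ('n::finite) sp_endo =
  "{h :: 'n sp \<Rightarrow> 'n sp. (\<forall>x y. h (x + y) = h x + h y) \<and> (\<forall>c x. h (c *\<^sub>C x) = c *\<^sub>C h x)}"
  by (rule exI[of _ "\<lambda>x. x"]) simp

setup_lifting type_definition_sp_endo

lemma sp_nontrivial: "\<exists>x :: 'n::finite sp. x \<noteq> 0"
proof
  let ?N = "CARD('n)"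
  have in_sp: "E_plus_mat ?N 1 1 \<in> sp_mats ?N"
    by (rule generator_mats_in_sp(2)) (simp_all add: one_le_card)
  have lt: "0 < 2 * ?N" "?N < 2 * ?N" using one_le_card[where ?'n = 'n] by linarith+
  have "E_plus_mat ?N 1 1 $$ (0, ?N) = 2"
    using lt by (simp add: E_plus_mat_def mat_unit_index kd_def)
  moreover have "(0\<^sub>m (2 * ?N) (2 * ?N) :: complex mat) $$ (0, ?N) = 0"
    using lt by simp
  ultimately have "E_plus_mat ?N 1 1 \<noteq> 0\<^sub>m (2 * ?N) (2 * ?N)" by auto
  then show "Abs_sp (E_plus_mat ?N 1 1) \<noteq> (0 :: 'n sp)"
    unfolding zero_sp_def using in_sp by (simp add: Abs_sp_inject sp_mats_zero)
qed

instantiation sp_endo :: (finite) complex_algebra_1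
begin

lift_definition zero_sp_endo :: "'a sp_endo" is "\<lambda>x. 0" by simp
lift_definition one_sp_endo :: "'a sp_endo" is "\<lambda>x. x" by simp
lift_definition plus_sp_endo :: "'a sp_endo \<Rightarrow> 'a sp_endo \<Rightarrow> 'a sp_endo" is "\<lambda>g h x. g x + h x"
  by (simp add: cscale_add_right algebra_simps)
lift_definition minus_sp_endo :: "'a sp_endo \<Rightarrow> 'a sp_endo \<Rightarrow> 'a sp_endo" is "\<lambda>g h x. g x - h x"
  by (simp add: complex_vector.scale_right_diff_distrib algebra_simps)
lift_definition uminus_sp_endo :: "'a sp_endo \<Rightarrow> 'a sp_endo" is "\<lambda>h x. - h x"
  by (simp add: complex_vector.scale_minus_right)
lift_definition times_sp_endo :: "'a sp_endo \<Rightarrow> 'a sp_endo \<Rightarrow> 'a sp_endo" is "\<lambda>g h x. g (h x)"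
  by simp
lift_definition cscale_sp_endo :: "complex \<Rightarrow> 'a sp_endo \<Rightarrow> 'a sp_endo" is "\<lambda>c h x. c *\<^sub>C h x"
  by (simp add: cscale_add_right cscale_cscale mult.commute)

instance
proof
  show "(0 :: 'a sp_endo) \<noteq> 1"
  proof
    assume "(0 :: 'a sp_endo) = 1"
    from arg_cong[OF this, of Rep_sp_endo] have "(0 :: 'a sp) = x" for x
      by (simp add: zero_sp_endo.rep_eq one_sp_endo.rep_eq fun_eq_iff)
    then show False using sp_nontrivial[where ?'n = 'a] by metis
  qed
qed (transfer; simp add: fun_eq_iff cscale_add_right cscale_add_left cscale_cscale cscale_one
    algebra_simps)+

end

definition sp_ad :: "'n::finite sp \<Rightarrow> 'n sp_endo" where
  "sp_ad x = Abs_sp_endo (lie x)"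

lemma Rep_sp_ad: "Rep_sp_endo (sp_ad x) = lie x"
  by (simp add: sp_ad_def Abs_sp_endo_inverse lie_add_right lie_scale_right)

lemma lie_minus_swap: "lie x y = - lie y x"
  using lie_self[of "x + y", unfolded lie_add_left lie_add_right]
  by (simp add: lie_self eq_neg_iff_add_eq_0 add.commute)

lemma sp_ad_lie: "sp_ad (lie x y) = sp_ad x * sp_ad y - sp_ad y * sp_ad x"
  for x y :: "'n::finite sp"
proof -
  have "lie (lie x y) z = lie x (lie y z) - lie y (lie x z)" for z
  proof -
    have "lie y (lie z x) = - lie y (lie x z)"
      using lie_scale_right[of y "- 1" "lie x z"] lie_minus_swap[of z x] by simp
    then show ?thesis
      using jacobi[of x y z] lie_minus_swap[of "lie x y" z] by (simp add: algebra_simps)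
  qed
  then show ?thesis
    by (simp add: Rep_sp_ad times_sp_endo.rep_eq minus_sp_endo.rep_eq fun_eq_iff
        flip: Rep_sp_endo_inject)
qed

lemma uea_in_sp_eq_0:
  fixes x :: "'n::finite sp"
  assumes "uea_in x = 0"
  shows "x = 0"
proof -
  have "uea_rel (letter x) 0"
    using assms by (simp add: uea_in.abs_eq zero_uea.abs_eq uea.abs_eq_iff)
  then have "free_ext sp_ad (letter x) = free_ext sp_ad 0"
  proof (rule free_ext_uea_rel)
    show "sp_ad (x + y) = sp_ad x + sp_ad y" for x y :: "'n sp"
      by (simp add: Rep_sp_ad plus_sp_endo.rep_eq lie_add_left fun_eq_iff flip: Rep_sp_endo_inject)
    show "sp_ad (c *\<^sub>C x) = c *\<^sub>C sp_ad x" for c and x :: "'n sp"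
      by (simp add: Rep_sp_ad cscale_sp_endo.rep_eq lie_scale_left fun_eq_iff flip: Rep_sp_endo_inject)
  qed (rule sp_ad_lie)
  then have "sp_ad x = 0" by (simp add: free_ext_simps)
  then have "lie x y = 0" for y
    using Rep_sp_ad[of x] by (metis zero_sp_endo.rep_eq)
  then show ?thesis
    by transfer (auto intro: sp_mats_centre_trivial)
qed

section \<open>The basis of primed generators\<close>

lemma generator_mats_entries:
  assumes "k < n" "l < n" "i < n" "j < n"
  shows "E_minus_mat n (Suc k) (Suc l) $$ (i, j) = kd i k * kd j l"
    "E_minus_mat n (Suc k) (Suc l) $$ (i, j + n) = 0"
    "E_minus_mat n (Suc k) (Suc l) $$ (i + n, j) = 0"
    "E_plus_mat n (Suc k) (Suc l) $$ (i, j) = 0"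
    "E_plus_mat n (Suc k) (Suc l) $$ (i, j + n) = kd i k * kd j l + kd i l * kd j k"
    "E_plus_mat n (Suc k) (Suc l) $$ (i + n, j) = 0"
    "F_plus_mat n (Suc k) (Suc l) $$ (i, j) = 0"
    "F_plus_mat n (Suc k) (Suc l) $$ (i, j + n) = 0"
    "F_plus_mat n (Suc k) (Suc l) $$ (i + n, j) = kd i k * kd j l + kd i l * kd j k"
  using assms
  by (simp_all add: E_minus_mat_def E_plus_mat_def F_plus_mat_def mat_unit_index kd_def)

context sp_rep
begin

lemma rep_E_minus: "k < n \<Longrightarrow> l < n \<Longrightarrow> rep (E_minus_mat n (Suc k) (Suc l)) = e k l"
proof -
  assume kl: "k < n" "l < n"
  have "lc n e (\<lambda>i j. E_minus_mat n (Suc k) (Suc l) $$ (i, j)) = lc n e (\<lambda>i j. kd i k * kd j l)"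
    "lc n p (\<lambda>i j. E_minus_mat n (Suc k) (Suc l) $$ (i, j + n)) = lc n p (\<lambda>i j. 0)"
    "lc n f (\<lambda>i j. E_minus_mat n (Suc k) (Suc l) $$ (i + n, j)) = lc n f (\<lambda>i j. 0)"
    using kl by (auto intro!: lc_cong simp: generator_mats_entries)
  then show ?thesis using kl by (simp add: rep_def lc_unit lc_linear)
qed

lemma rep_E_plus: "k < n \<Longrightarrow> l < n \<Longrightarrow> rep (E_plus_mat n (Suc k) (Suc l)) = p k l"
proof -
  assume kl: "k < n" "l < n"
  have "lc n e (\<lambda>i j. E_plus_mat n (Suc k) (Suc l) $$ (i, j)) = lc n e (\<lambda>i j. 0)"
    "lc n p (\<lambda>i j. E_plus_mat n (Suc k) (Suc l) $$ (i, j + n)) = lc n p (\<lambda>i j. kd i k * kd j l + kd i l * kd j k)"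
    "lc n f (\<lambda>i j. E_plus_mat n (Suc k) (Suc l) $$ (i + n, j)) = lc n f (\<lambda>i j. 0)"
    using kl by (auto intro!: lc_cong simp: generator_mats_entries)
  then show ?thesis
    using kl p_sym[of l k] cscale_add_left[of "1 / 2" "1 / 2" "p k l"]
    by (simp add: rep_def lc_unit lc_linear cscale_add_right cscale_one)
qed

lemma rep_F_plus: "k < n \<Longrightarrow> l < n \<Longrightarrow> rep (F_plus_mat n (Suc k) (Suc l)) = f k l"
proof -
  assume kl: "k < n" "l < n"
  have "lc n e (\<lambda>i j. F_plus_mat n (Suc k) (Suc l) $$ (i, j)) = lc n e (\<lambda>i j. 0)"
    "lc n f (\<lambda>i j. F_plus_mat n (Suc k) (Suc l) $$ (i + n, j)) = lc n f (\<lambda>i j. kd i k * kd j l + kd i l * kd j k)"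
    "lc n p (\<lambda>i j. F_plus_mat n (Suc k) (Suc l) $$ (i, j + n)) = lc n p (\<lambda>i j. 0)"
    using kl by (auto intro!: lc_cong simp: generator_mats_entries)
  then show ?thesis
    using kl f_sym[of l k] cscale_add_left[of "1 / 2" "1 / 2" "f k l"]
    by (simp add: rep_def lc_unit lc_linear cscale_add_right cscale_one)
qed

text \<open>Pulls a linear combination of generators back to one matrix, so that a linear relation
  becomes a statement about the kernel of \<open>rep\<close>.\<close>

lemma rep_lincomb:
  "rep (mat (2 * n) (2 * n) (\<lambda>(i, j). \<Sum>x\<in>Y. c x * G x $$ (i, j))) = (\<Sum>x\<in>Y. c x *\<^sub>C rep (G x))"
proof -
  let ?M = "mat (2 * n) (2 * n) (\<lambda>(i, j). \<Sum>x\<in>Y. c x * G x $$ (i, j))"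
  have "lc n z (\<lambda>i j. ?M $$ (u i, v j)) = (\<Sum>x\<in>Y. c x *\<^sub>C lc n z (\<lambda>i j. G x $$ (u i, v j)))"
    if "\<And>i. i < n \<Longrightarrow> u i < 2 * n" "\<And>i. i < n \<Longrightarrow> v i < 2 * n" for u v and z :: "nat \<Rightarrow> nat \<Rightarrow> 'a"
    unfolding lc_linear(3)[symmetric] lc_sum[symmetric] using that by (intro lc_cong) simp
  from this[of "\<lambda>i. i" "\<lambda>i. i"] this[of "\<lambda>i. i" "\<lambda>i. i + n"] this[of "\<lambda>i. i + n" "\<lambda>i. i"]
  show ?thesis
    by (simp add: rep_def cscale_add_right sum.distrib complex_vector.scale_sum_right mult.commute)
qed

end

lemma sp_mats_eq_0I:
  assumes M: "M \<in> sp_mats n"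
    and zero: "\<And>i j. i < n \<Longrightarrow> j < n \<Longrightarrow> M $$ (i, j) = 0 \<and> M $$ (i, j + n) = 0 \<and> M $$ (i + n, j) = 0"
  shows "M = 0\<^sub>m (2 * n) (2 * n)"
proof (rule eq_matI)
  fix x y assume "x < dim_row (0\<^sub>m (2 * n) (2 * n) :: complex mat)" "y < dim_col (0\<^sub>m (2 * n) (2 * n) :: complex mat)"
  then have xy: "x < n \<or> (\<exists>i<n. x = i + n)" "y < n \<or> (\<exists>j<n. y = j + n)" "x < 2 * n" "y < 2 * n"
    by (simp_all, presburger+)
  then show "M $$ (x, y) = 0\<^sub>m (2 * n) (2 * n) $$ (x, y)"
    using zero sp_matsD(3)[OF M] by auto
qed (use sp_mats_carrier[OF M] in auto)

section \<open>Independence of the original generators\<close>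

lemma lc_nth: "fls_nth (lc n x a) k = lc n (\<lambda>i j. fls_nth (x i j) k) a"
  by (simp add: lc_def fls_nth_sum cscale_fls_nth)

lemma uea_in_lc: "uea_in (lc n x a) = lc n (\<lambda>i j. uea_in (x i j)) a"
proof -
  have sum: "uea_in (sum g A) = (\<Sum>i\<in>A. uea_in (g i))" for g :: "nat \<Rightarrow> 'a" and A
    by (induction A rule: infinite_finite_induct) (simp_all add: uea_in_zero uea_in_add)
  show ?thesis by (simp add: lc_def sum uea_in_scale)
qed

lemma Rep_sp_lc_index:
  fixes y :: "nat \<Rightarrow> nat \<Rightarrow> 'n::finite sp"
  assumes "r < 2 * CARD('n)" "s < 2 * CARD('n)"
  shows "Rep_sp (lc n y a) $$ (r, s) = lc n (\<lambda>i j. Rep_sp (y i j) $$ (r, s)) a"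
proof -
  have c: "Rep_sp z \<in> carrier_mat (2 * CARD('n)) (2 * CARD('n))" for z :: "'n sp"
    using Rep_sp[of z] by (rule sp_mats_carrier)
  have sum: "Rep_sp (sum g A) $$ (r, s) = (\<Sum>i\<in>A. Rep_sp (g i) $$ (r, s))"
    for g :: "nat \<Rightarrow> 'n sp" and A
    by (induction A rule: infinite_finite_induct)
       (use assms carrier_matD[OF c] in \<open>simp_all add: zero_sp.rep_eq plus_sp.rep_eq\<close>)
  show ?thesis
    using assms carrier_matD[OF c]
    by (simp add: lc_def sum cscale_sp.rep_eq cscale_complex_def)
qed

lemma lc_pick:
  assumes "k < n" "l < n"
  shows "lc n (\<lambda>i j. kd i k * kd j l) a = a k l"
proof -
  have "lc n (\<lambda>i j. kd i k * kd j l) a = lc n a (\<lambda>i j. kd i k * kd j l)"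
    by (simp add: lc_def cscale_complex_def mult.commute)
  then show ?thesis by (simp add: lc_unit assms)
qed

text \<open>A single matrix entry isolates each coefficient. For \<open>E_plus\<close> and
  \<open>F_plus\<close> the order of the indices is immaterial, so only the symmetrised coefficient
  can be recovered.\<close>

lemma generators_independent:
  fixes n :: nat
  assumes n: "n + 1 = CARD('n::finite)"
  shows "lc n (\<lambda>i j. Abs_sp (E_minus_mat CARD('n) (Suc (Suc i)) (Suc (Suc j))) :: 'n sp) a = 0 \<Longrightarrow>
      k < n \<Longrightarrow> l < n \<Longrightarrow> a k l = 0"
    and "lc n (\<lambda>i j. Abs_sp (E_plus_mat CARD('n) (Suc (Suc i)) (Suc (Suc j))) :: 'n sp) a = 0 \<Longrightarrow>
      k < n \<Longrightarrow> l < n \<Longrightarrow> a k l + a l k = 0"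
    and "lc n (\<lambda>i j. Abs_sp (F_plus_mat CARD('n) (Suc (Suc i)) (Suc (Suc j))) :: 'n sp) a = 0 \<Longrightarrow>
      k < n \<Longrightarrow> l < n \<Longrightarrow> a k l + a l k = 0"
proof -
  let ?N = "CARD('n)"
  have entries: "E_minus_mat ?N (Suc (Suc i)) (Suc (Suc j)) $$ (Suc k, Suc l) = kd i k * kd j l"
    "E_plus_mat ?N (Suc (Suc i)) (Suc (Suc j)) $$ (Suc k, Suc l + ?N) = kd i k * kd j l + kd i l * kd j k"
    "F_plus_mat ?N (Suc (Suc i)) (Suc (Suc j)) $$ (Suc k + ?N, Suc l) = kd i k * kd j l + kd i l * kd j k"
    if "k < n" "l < n" "i < n" "j < n" for i j k l
    using generator_mats_entries[of "Suc i" ?N "Suc j" "Suc k" "Suc l"] that n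
    by (auto simp: kd_def)
  have in_range: "Suc (Suc i) \<in> {1..?N}" if "i < n" for i
    using that n by auto
  have lin: "lc n (\<lambda>i j. Rep_sp (Abs_sp (G i j) :: 'n sp) $$ (r, s)) a = 0"
    if "lc n (\<lambda>i j. Abs_sp (G i j) :: 'n sp) a = 0" "r < 2 * ?N" "s < 2 * ?N" for G r s
    using Rep_sp_lc_index[OF that(2,3), of n "\<lambda>i j. Abs_sp (G i j)" a] that
    by (simp add: zero_sp.rep_eq)
  have cong: "lc n x a = lc n y a" if "\<And>i j. i < n \<Longrightarrow> j < n \<Longrightarrow> x i j = y i j"
    for x y :: "nat \<Rightarrow> nat \<Rightarrow> complex"
    using that by (simp add: lc_def)
  have two: "lc n (\<lambda>i j. kd i k * kd j l + kd i l * kd j k) a = a k l + a l k"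
    if "k < n" "l < n" for k l
  proof -
    have "lc n (\<lambda>i j. kd i k * kd j l + kd i l * kd j k) a =
        lc n (\<lambda>i j. kd i k * kd j l) a + lc n (\<lambda>i j. kd i l * kd j k) a"
      by (simp add: lc_def cscale_complex_def distrib_left sum.distrib)
    then show ?thesis by (simp add: lc_pick that)
  qed
  note inv = Abs_sp_inverse generator_mats_in_sp in_range
  show "a k l = 0"
    if "lc n (\<lambda>i j. Abs_sp (E_minus_mat ?N (Suc (Suc i)) (Suc (Suc j))) :: 'n sp) a = 0" and kl: "k < n" "l < n"
  proof -
    have "lc n (\<lambda>i j. kd i k * kd j l) a =
        lc n (\<lambda>i j. Rep_sp (Abs_sp (E_minus_mat ?N (Suc (Suc i)) (Suc (Suc j))) :: 'n sp) $$ (Suc k, Suc l)) a"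
      by (rule cong) (simp only: inv entries kl)
    then show ?thesis using lin[OF that(1), of "Suc k" "Suc l"] kl n by (simp add: lc_pick)
  qed
  show "a k l + a l k = 0"
    if "lc n (\<lambda>i j. Abs_sp (E_plus_mat ?N (Suc (Suc i)) (Suc (Suc j))) :: 'n sp) a = 0" and kl: "k < n" "l < n"
  proof -
    have "lc n (\<lambda>i j. kd i k * kd j l + kd i l * kd j k) a =
        lc n (\<lambda>i j. Rep_sp (Abs_sp (E_plus_mat ?N (Suc (Suc i)) (Suc (Suc j))) :: 'n sp) $$ (Suc k, Suc l + ?N)) a"
      by (rule cong) (simp only: inv entries kl)
    then show ?thesis using lin[OF that(1), of "Suc k" "Suc l + ?N"] kl n by (simp add: two)
  qed
  show "a k l + a l k = 0"
    if "lc n (\<lambda>i j. Abs_sp (F_plus_mat ?N (Suc (Suc i)) (Suc (Suc j))) :: 'n sp) a = 0" and kl: "k < n" "l < n"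
  proof -
    have "lc n (\<lambda>i j. kd i k * kd j l + kd i l * kd j k) a =
        lc n (\<lambda>i j. Rep_sp (Abs_sp (F_plus_mat ?N (Suc (Suc i)) (Suc (Suc j))) :: 'n sp) $$ (Suc k + ?N, Suc l)) a"
      by (rule cong) (simp only: inv entries kl)
    then show ?thesis using lin[OF that(1), of "Suc k + ?N" "Suc l"] kl n by (simp add: two)
  qed
qed

text \<open>The shift by two sends the positions 0, ..., n - 1 of a block to the indices 2, ..., n +
  1 left after removing 1.\<close>

abbreviation (input) "e2 \<equiv> \<lambda>i j. E_minus (Suc (Suc i)) (Suc (Suc j))"
abbreviation (input) "p2 \<equiv> \<lambda>i j. gens.p' (Suc (Suc i)) (Suc (Suc j))"
abbreviation (input) "f2 \<equiv> \<lambda>i j. gens.f' (Suc (Suc i)) (Suc (Suc j))"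

lemma primed_rep:
  assumes "n + 1 = CARD('n::finite)"
  shows "sp_rep n e2 p2 (f2 :: nat \<Rightarrow> nat \<Rightarrow> 'n sp uea fls)"
  by (rule sp_relations_reindex[OF gens.deformed_relations]) (use assms in auto)

text \<open>The correction B_i B_j e^-\<sigma> has order at least 2 and A_i A_j order at least 0, so
  below these orders only the original generator is visible.\<close>

lemma deformed_nth:
  "k < 2 \<Longrightarrow> fls_nth (gens.p' i j :: 'n::finite sp uea fls) k =
     (if k = 1 then uea_in (Abs_sp (E_plus_mat CARD('n) i j)) else 0)"
  "k < 0 \<Longrightarrow> fls_nth (gens.f' i j :: 'n sp uea fls) k =
     (if k = - 1 then uea_in (Abs_sp (F_plus_mat CARD('n) i j)) else 0)"
proof -
  have "E_plus 1 i * E_plus 1 j * sigma_exp (- 1) \<in> (adic (1 + 1 + 0) :: 'n sp uea fls set)"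
    unfolding generators_gen by (intro adic_mult gen_adic sigma_exp_adic)
  from adicD[OF this]
  show "k < 2 \<Longrightarrow> fls_nth (gens.p' i j :: 'n sp uea fls) k =
     (if k = 1 then uea_in (Abs_sp (E_plus_mat CARD('n) i j)) else 0)"
    unfolding gens.p'_def by (simp add: sigma_exp_special(3) generators_gen(2)[of i j] gen_nth)
  have "E_minus 1 i * E_minus 1 j \<in> (adic (0 + 0) :: 'n sp uea fls set)"
    unfolding generators_gen by (intro adic_mult gen_adic)
  from adicD[OF this]
  show "k < 0 \<Longrightarrow> fls_nth (gens.f' i j :: 'n sp uea fls) k =
     (if k = - 1 then uea_in (Abs_sp (F_plus_mat CARD('n) i j)) else 0)"
    unfolding gens.f'_def by (simp add: generators_gen(3)[of i j] gen_nth)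
qed

text \<open>The coefficients of \<open>\<xi>\<^sup>-\<^sup>1\<close>, \<open>\<xi>\<^sup>0\<close> and \<open>\<xi>\<^sup>1\<close> successively determine the three blocks of the
  matrix, the quadratic corrections contributing only to higher orders than their leading terms.\<close>

lemma primed_rep_kernel:
  fixes n :: nat
  assumes n: "n + 1 = CARD('n::finite)" and M: "M \<in> sp_mats n"
    and zero: "sp_rep.rep n e2 p2 (f2 :: nat \<Rightarrow> nat \<Rightarrow> 'n sp uea fls) M = 0"
  shows "M = 0\<^sub>m (2 * n) (2 * n)"
proof -
  interpret R: sp_rep n e2 p2 "f2 :: nat \<Rightarrow> nat \<Rightarrow> 'n sp uea fls"
    by (rule primed_rep[OF n])
  define a b c where "a = (\<lambda>i j. M $$ (i, j))" and "b = (\<lambda>i j. M $$ (i, j + n))"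
    and "c = (\<lambda>i j. M $$ (i + n, j))"
  have sym: "b i j = b j i" "c i j = c j i" if "i < n" "j < n" for i j
    using sp_matsD[OF M that] by (simp_all add: b_def c_def)
  have eq: "lc n e2 a + (1 / 2) *\<^sub>C lc n p2 b + (1 / 2) *\<^sub>C lc n f2 c = (0 :: 'n sp uea fls)"
    using zero unfolding R.rep_def a_def b_def c_def .
  have coeff: "fls_nth (lc n e2 a) m + (1 / 2) *\<^sub>C fls_nth (lc n p2 b) m +
      (1 / 2) *\<^sub>C fls_nth (lc n f2 c :: 'n sp uea fls) m = 0" for m
    using arg_cong[OF eq, of "\<lambda>g. fls_nth g m"] by (simp add: cscale_fls_nth)
  have zero_lc: "lc n (\<lambda>i j. 0) u = (0 :: 'n sp uea)" for u
    by (simp add: lc_def)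
  have e_nth: "fls_nth (E_minus i j :: 'n sp uea fls) m =
      (if m = 0 then uea_in (Abs_sp (E_minus_mat CARD('n) i j)) else 0)" for i j m
    by (simp add: generators_gen gen_nth)
  have "uea_in (lc n (\<lambda>i j. Abs_sp (F_plus_mat CARD('n) (Suc (Suc i)) (Suc (Suc j))) :: 'n sp) c) = 0"
    using coeff[of "- 1"] by (simp add: lc_nth e_nth deformed_nth zero_lc uea_in_lc)
  then have c: "c i j = 0" if "i < n" "j < n" for i j
    using generators_independent(3)[OF n uea_in_sp_eq_0 that, of c] sym(2)[OF that] by simp
  \<comment> \<open>With c gone the whole F' family drops out, including the corrections A_i A_j at
    \<xi>^0, so the next coefficient again lies in the image of the Lie algebra.\<close>
  then have fc: "lc n f2 c = (0 :: 'n sp uea fls)"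
    by (simp add: lc_def)
  have "uea_in (lc n (\<lambda>i j. Abs_sp (E_minus_mat CARD('n) (Suc (Suc i)) (Suc (Suc j))) :: 'n sp) a) = 0"
    using coeff[of 0] by (simp add: fc lc_nth e_nth deformed_nth zero_lc uea_in_lc)
  then have a: "a i j = 0" if "i < n" "j < n" for i j
    using generators_independent(1)[OF n uea_in_sp_eq_0 that, of a] by simp
  then have ea: "lc n e2 a = (0 :: 'n sp uea fls)"
    by (simp add: lc_def)
  have "uea_in (lc n (\<lambda>i j. Abs_sp (E_plus_mat CARD('n) (Suc (Suc i)) (Suc (Suc j))) :: 'n sp) b) = 0"
    using coeff[of 1] by (simp add: fc ea lc_nth deformed_nth uea_in_lc)
  then have "b i j = 0" if "i < n" "j < n" for i j
    using generators_independent(2)[OF n uea_in_sp_eq_0 that, of b] sym(1)[OF that] by simp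
  with a c show ?thesis
    by (intro sp_mats_eq_0I[OF M]) (simp add: a_def b_def c_def)
qed

text \<open>The matrices of sp(N-1) number their indices from 1 while labels start at 2, hence the
  shift by one.\<close>

fun label_mat :: "nat \<Rightarrow> label \<Rightarrow> complex mat" where
  "label_mat n (EPlus i j) = E_plus_mat n (i - 1) (j - 1)"
| "label_mat n (FPlus i j) = F_plus_mat n (i - 1) (j - 1)"
| "label_mat n (EMinus i j) = E_minus_mat n (i - 1) (j - 1)"
| "label_mat n (FMinus i j) = E_minus_mat n (j - 1) (i - 1)"
| "label_mat n (HCartan i) = (1 / 2) \<cdot>\<^sub>m E_minus_mat n (i - 1) (i - 1)"

text \<open>A position where the matrix of this label, and of no other, has a nonzero entry
  (\<open>label_mat_pos\<close>); positions count from 0, hence the shift by two.\<close>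

fun label_pos :: "nat \<Rightarrow> label \<Rightarrow> nat \<times> nat" where
  "label_pos n (EPlus i j) = (i - 2, j - 2 + n)"
| "label_pos n (FPlus i j) = (i - 2 + n, j - 2)"
| "label_pos n (EMinus i j) = (i - 2, j - 2)"
| "label_pos n (FMinus i j) = (j - 2, i - 2)"
| "label_pos n (HCartan i) = (i - 2, i - 2)"

lemma labels_cases:
  assumes "x \<in> labels (n + 1)"
  obtains (EPlus) k l where "x = EPlus (Suc (Suc k)) (Suc (Suc l))" "k \<le> l" "l < n"
  | (FPlus) k l where "x = FPlus (Suc (Suc k)) (Suc (Suc l))" "k \<le> l" "l < n"
  | (EMinus) k l where "x = EMinus (Suc (Suc k)) (Suc (Suc l))" "k < l" "l < n"
  | (FMinus) k l where "x = FMinus (Suc (Suc k)) (Suc (Suc l))" "k < l" "l < n"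
  | (HCartan) k where "x = HCartan (Suc (Suc k))" "k < n"
proof -
  have shift: "i = Suc (Suc (i - 2))" if "2 \<le> i" for i :: nat using that by simp
  from assms consider
      i j where "x = EPlus i j" "2 \<le> i" "i \<le> j" "j \<le> n + 1"
    | i j where "x = FPlus i j" "2 \<le> i" "i \<le> j" "j \<le> n + 1"
    | i j where "x = EMinus i j" "2 \<le> i" "i < j" "j \<le> n + 1"
    | i j where "x = FMinus i j" "2 \<le> i" "i < j" "j \<le> n + 1"
    | i where "x = HCartan i" "2 \<le> i" "i \<le> n + 1"
    unfolding labels_def by blast
  then show thesis
  proof cases
    case (1 i j) then show ?thesis using EPlus[of "i - 2" "j - 2"] by (simp flip: shift)
  next
    case (2 i j) then show ?thesis using FPlus[of "i - 2" "j - 2"] by (simp flip: shift)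
  next
    case (3 i j) then show ?thesis using EMinus[of "i - 2" "j - 2"] by (simp flip: shift)
  next
    case (4 i j) then show ?thesis using FMinus[of "i - 2" "j - 2"] by (simp flip: shift)
  next
    case (5 i) then show ?thesis using HCartan[of "i - 2"] by (simp flip: shift)
  qed
qed

lemma finite_labels: "finite (labels N)"
proof -
  have "labels N \<subseteq> (\<lambda>(i, j). EPlus i j) ` ({..N} \<times> {..N}) \<union> (\<lambda>(i, j). FPlus i j) ` ({..N} \<times> {..N})
      \<union> (\<lambda>(i, j). EMinus i j) ` ({..N} \<times> {..N}) \<union> (\<lambda>(i, j). FMinus i j) ` ({..N} \<times> {..N})
      \<union> HCartan ` {..N}"
    unfolding labels_def by (auto simp: image_iff)
  then show ?thesis by (rule finite_subset) auto
qed

lemma label_mat_in_sp: "x \<in> labels (n + 1) \<Longrightarrow> label_mat n x \<in> sp_mats n"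
  by (erule labels_cases) (auto intro!: generator_mats_in_sp sp_mats_smult)

lemma label_mat_pos:
  assumes "x \<in> labels (n + 1)" "y \<in> labels (n + 1)"
  shows "label_mat n x $$ label_pos n y = 0 \<longleftrightarrow> x \<noteq> y"
  using assms
  by (elim labels_cases) (auto simp: generator_mats_entries kd_def)

lemma label_pos_bound:
  assumes "x \<in> labels (n + 1)"
  obtains i j where "label_pos n x = (i, j)" "i < 2 * n" "j < 2 * n"
  using assms by (elim labels_cases) auto

lemma primed_eq:
  "primed (EPlus i j) = gens.p' i j" "primed (FPlus i j) = gens.f' i j"
  "primed (EMinus i j) = E_minus i j" "primed (FMinus i j) = E_minus j i"
  by (simp_all add: gens.p'_def gens.f'_def F_minus_eq)

lemma primed_HCartan:
  "i \<in> {1..CARD('n)} \<Longrightarrow> primed (HCartan i) = (1 / 2) *\<^sub>C (E_minus i i :: 'n::finite sp uea fls)"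
  by (simp add: H_cartan_eq)

lemma primed_label_mat:
  fixes n :: nat
  assumes n: "n + 1 = CARD('n::finite)" and x: "x \<in> labels (n + 1)"
  shows "sp_rep.rep n e2 p2 (f2 :: nat \<Rightarrow> nat \<Rightarrow> 'n sp uea fls) (label_mat n x) = primed x"
proof -
  interpret R: sp_rep n e2 p2 "f2 :: nat \<Rightarrow> nat \<Rightarrow> 'n sp uea fls"
    by (rule primed_rep[OF n])
  show ?thesis
    using x
  proof (cases rule: labels_cases)
    case (EPlus k l)
    then show ?thesis using R.rep_E_plus[of k l] unfolding EPlus primed_eq by simp
  next
    case (FPlus k l)
    then show ?thesis using R.rep_F_plus[of k l] unfolding FPlus primed_eq by simp
  next
    case (EMinus k l)
    then show ?thesis using R.rep_E_minus[of k l] unfolding EMinus primed_eq by simp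
  next
    case (FMinus k l)
    then show ?thesis using R.rep_E_minus[of l k] unfolding FMinus primed_eq by simp
  next
    case (HCartan k)
    then have "Suc (Suc k) \<in> {1..CARD('n)}" using n by simp
    moreover have "E_minus_mat n (Suc k) (Suc k) \<in> carrier_mat (2 * n) (2 * n)"
      by (simp add: carrier_matI)
    ultimately show ?thesis
      using R.rep_E_minus[of k k] R.rep_scale HCartan by (simp add: primed_HCartan del: primed.simps)
  qed
qed

text \<open>The relation is the image under \<open>rep\<close> of the matrix M with the same
  coefficients. The kernel is trivial, so M = 0, and the entry at \<open>label_pos n y\<close> is a
  nonzero multiple of \<open>c y\<close>. Coefficients indexed by labels also rule out coincidences
  among the primed elements.\<close>

lemma primed_scalars_zero:
  fixes n :: nat and c :: "label \<Rightarrow> complex"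
  assumes n: "n + 1 = CARD('n::finite)"
    and zero: "(\<Sum>x\<in>labels (n + 1). c x *\<^sub>C (primed x :: 'n sp uea fls)) = 0"
    and y: "y \<in> labels (n + 1)"
  shows "c y = 0"
proof -
  interpret R: sp_rep n e2 p2 "f2 :: nat \<Rightarrow> nat \<Rightarrow> 'n sp uea fls"
    by (rule primed_rep[OF n])
  define M where "M = mat (2 * n) (2 * n) (\<lambda>(i, j). \<Sum>x\<in>labels (n + 1). c x * label_mat n x $$ (i, j))"
  have "R.rep M = (\<Sum>x\<in>labels (n + 1). c x *\<^sub>C primed x)"
    unfolding M_def R.rep_lincomb by (rule sum.cong) (simp_all add: primed_label_mat[OF n])
  then have "R.rep M = 0" by (simp add: zero)
  moreover have "M \<in> sp_mats n"
  proof (rule sp_matsI)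
    fix i j assume ij: "i < n" "j < n"
    note D = sp_matsD[OF label_mat_in_sp ij]
    show "M $$ (i, j + n) = M $$ (j, i + n)" "M $$ (i + n, j) = M $$ (j + n, i)"
      "M $$ (i + n, j + n) = - M $$ (j, i)"
      using ij by (auto simp: M_def D simp flip: sum_negf intro!: sum.cong)
  qed (simp add: M_def)
  ultimately have M0: "M = 0\<^sub>m (2 * n) (2 * n)"
    by (intro primed_rep_kernel[OF n])
  obtain i j where pos: "label_pos n y = (i, j)" "i < 2 * n" "j < 2 * n"
    using y by (rule label_pos_bound)
  then have "(\<Sum>x\<in>labels (n + 1). c x * label_mat n x $$ label_pos n y) = M $$ (i, j)"
    by (simp add: M_def)
  then have "(\<Sum>x\<in>labels (n + 1). c x * label_mat n x $$ label_pos n y) = 0"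
    using M0 pos by simp
  moreover have "(\<Sum>x\<in>labels (n + 1). c x * label_mat n x $$ label_pos n y) =
      (\<Sum>x\<in>{y}. c x * label_mat n x $$ label_pos n y)"
    using y by (intro sum.mono_neutral_right) (auto simp: finite_labels label_mat_pos)
  ultimately show ?thesis
    using label_mat_pos[OF y y] by simp
qed

theorem mainTheorem2:
  fixes N :: nat and X' :: "label \<Rightarrow> 'n::finite sp uea fls" and L :: "'n sp uea fls set"
  assumes "N = CARD('n)" and "N \<ge> 2"
  defines "X' \<equiv> primed" and "L \<equiv> complex_vector.span (X' ` labels N)"
  shows "(\<forall>x \<in> labels N. twisted_coproduct (X' x) = X' x \<boxtimes> 1 + 1 \<boxtimes> X' x)
    \<and> inj_on X' (labels N) \<and> complex_vector.independent (X' ` labels N)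
    \<and> (\<forall>a \<in> L. \<forall>b \<in> L. a * b - b * a \<in> L)
    \<and> (\<exists>\<phi> :: complex mat \<Rightarrow> 'n sp uea fls. bij_betw \<phi> (sp_mats (N - 1)) L
        \<and> (\<forall>A \<in> sp_mats (N - 1). \<forall>B \<in> sp_mats (N - 1).
              \<phi> (A + B) = \<phi> A + \<phi> B
            \<and> \<phi> (mat_commutator A B) = \<phi> A * \<phi> B - \<phi> B * \<phi> A)
        \<and> (\<forall>c. \<forall>A \<in> sp_mats (N - 1). \<phi> (c \<cdot>\<^sub>m A) = c *\<^sub>C \<phi> A))"
proof -
  define n where "n = N - 1"
  have Nn: "N = n + 1" and n: "n + 1 = CARD('n)"
    using assms(1,2) by (simp_all add: n_def)
  interpret R: sp_rep n e2 p2 "f2 :: nat \<Rightarrow> nat \<Rightarrow> 'n sp uea fls"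
    by (rule primed_rep[OF n])
  note carrier = sp_mats_carrier[where N = n]

  have "twisted_coproduct (X' x) = X' x \<boxtimes> 1 + 1 \<boxtimes> X' x" if "x \<in> labels N" for x
  proof -
    have range: "Suc (Suc i) \<in> {1..CARD('n)} - {1}" if "i < n" for i
      using that n by auto
    show ?thesis
      using that unfolding Nn X'_def
    proof (cases rule: labels_cases)
      case (EPlus k l)
      then show "twisted_coproduct (primed x :: 'n sp uea fls) = primed x \<boxtimes> 1 + 1 \<boxtimes> primed x"
        unfolding EPlus primed_eq by (intro twisted_coproduct_E_plus range) simp_all
    next
      case (FPlus k l)
      then show "twisted_coproduct (primed x :: 'n sp uea fls) = primed x \<boxtimes> 1 + 1 \<boxtimes> primed x"
        unfolding FPlus primed_eq by (intro twisted_coproduct_F_plus range) simp_all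
    next
      case (EMinus k l)
      then show "twisted_coproduct (primed x :: 'n sp uea fls) = primed x \<boxtimes> 1 + 1 \<boxtimes> primed x"
        unfolding EMinus primed_eq by (intro twisted_coproduct_E_minus range) simp_all
    next
      case (FMinus k l)
      then show "twisted_coproduct (primed x :: 'n sp uea fls) = primed x \<boxtimes> 1 + 1 \<boxtimes> primed x"
        unfolding FMinus primed_eq by (intro twisted_coproduct_E_minus range) simp_all
    next
      case (HCartan k)
      then show "twisted_coproduct (primed x :: 'n sp uea fls) = primed x \<boxtimes> 1 + 1 \<boxtimes> primed x"
        unfolding HCartan primed.simps by (intro twisted_coproduct_H_cartan range) simp_all
    qed
  qed
  moreover have scalars: "c y = 0" if "(\<Sum>x\<in>labels N. c x *\<^sub>C X' x) = 0" "y \<in> labels N" for c y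
    using primed_scalars_zero[OF n] that unfolding X'_def Nn by blast
  have inj: "inj_on X' (labels N)"
  proof (rule inj_onI, rule ccontr)
    fix x y assume xy: "x \<in> labels N" "y \<in> labels N" "X' x = X' y" "x \<noteq> y"
    \<comment> \<open>A coincidence would be a relation with coefficients 1 and -1.\<close>
    define c :: "label \<Rightarrow> complex" where "c z = (if z = x then 1 else if z = y then - 1 else 0)" for z
    have "(\<Sum>z\<in>labels N. c z *\<^sub>C X' z) = (\<Sum>z\<in>{x, y}. c z *\<^sub>C X' z)"
      using xy by (intro sum.mono_neutral_right) (auto simp: finite_labels c_def)
    also have "\<dots> = 0"
      using xy by (simp add: c_def cscale_one)
    finally have "c x = 0" using scalars xy by blast
    then show False by (simp add: c_def)
  qed
  moreover have "complex_vector.independent (X' ` labels N)"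
  proof (rule complex_vector.independent_if_scalars_zero)
    show "finite (X' ` labels N)" by (simp add: finite_labels)
    fix g v assume "(\<Sum>v\<in>X' ` labels N. g v *\<^sub>C v) = 0" "v \<in> X' ` labels N"
    then show "g v = 0"
      using scalars[of "\<lambda>x. g (X' x)"] by (auto simp: sum.reindex[OF inj])
  qed
  moreover have rep_comm: "R.rep (mat_commutator A B) = R.rep A * R.rep B - R.rep B * R.rep A"
    if "A \<in> sp_mats n" "B \<in> sp_mats n" for A B
    using R.rep_commutator[OF that] by (simp add: comm_def)
  have "R.rep ` sp_mats n = L"
  proof
    have "e2 i j \<in> L" "p2 i j \<in> L" "f2 i j \<in> L" if ij: "i < n" "j < n" for i j
    proof -
      have base: "primed x \<in> L" if "x \<in> labels (n + 1)" for x
        using that unfolding L_def X'_def Nn by (intro complex_vector.span_base) blast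
      have *: "p2 i j \<in> L \<and> f2 i j \<in> L" if "i \<le> j" "j < n" for i j
        using base[of "EPlus (Suc (Suc i)) (Suc (Suc j))"] base[of "FPlus (Suc (Suc i)) (Suc (Suc j))"] that
        unfolding primed_eq by (simp add: labels_def)
      show "p2 i j \<in> L" "f2 i j \<in> L"
        using *[of i j] *[of j i] ij R.p_sym[of i j] R.f_sym[of i j] by (cases "i \<le> j", simp_all)+
      consider "i < j" | "j < i" | "i = j" by linarith
      then show "e2 i j \<in> L"
      proof cases
        case 1
        then show ?thesis using base[of "EMinus (Suc (Suc i)) (Suc (Suc j))"] ij unfolding primed_eq
          by (simp add: labels_def)
      next
        case 2
        then show ?thesis using base[of "FMinus (Suc (Suc j)) (Suc (Suc i))"] ij unfolding primed_eq
          by (simp add: labels_def)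
      next
        case 3
        have "(1 / 2) *\<^sub>C e2 i i \<in> L"
          using base[of "HCartan (Suc (Suc i))"] primed_HCartan[where ?'n = 'n, of "Suc (Suc i)"] ij n
          by (simp add: labels_def del: primed.simps)
        then have "2 *\<^sub>C (1 / 2) *\<^sub>C e2 i i \<in> L"
          unfolding L_def by (rule complex_vector.span_scale)
        then show ?thesis using 3 by (simp add: cscale_one)
      qed
    qed
    then show "R.rep ` sp_mats n \<subseteq> L"
      unfolding L_def R.rep_def lc_def
      by (auto intro!: complex_vector.span_add complex_vector.span_scale complex_vector.span_sum)
    have "complex_vector.subspace (R.rep ` sp_mats n)"
    proof (rule complex_vector.subspaceI)
      have "R.rep (0\<^sub>m (2 * n) (2 * n)) = 0"
        using R.rep_scale[of "0\<^sub>m (2 * n) (2 * n)" 0] by simp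
      then show "0 \<in> R.rep ` sp_mats n"
        by (rule image_eqI[OF sym sp_mats_zero])
      show "x + y \<in> R.rep ` sp_mats n" if "x \<in> R.rep ` sp_mats n" "y \<in> R.rep ` sp_mats n" for x y
        using that by (auto simp: carrier sp_mats_add simp flip: R.rep_add)
      show "c *\<^sub>C x \<in> R.rep ` sp_mats n" if "x \<in> R.rep ` sp_mats n" for c x
        using that by (auto simp: carrier sp_mats_smult simp flip: R.rep_scale)
    qed
    moreover have "X' ` labels N \<subseteq> R.rep ` sp_mats n"
      unfolding X'_def Nn
      by (auto simp: primed_label_mat[OF n, symmetric] label_mat_in_sp)
    ultimately show "L \<subseteq> R.rep ` sp_mats n"
      unfolding L_def by (intro complex_vector.span_minimal)
  qed
  \<comment> \<open>Closure is transported from the matrix commutator through \<open>rep\<close>,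
    whose image has just been identified with L.\<close>
  moreover from this have "\<forall>a \<in> L. \<forall>b \<in> L. a * b - b * a \<in> L"
    by (auto simp: sp_mats_commutator simp flip: rep_comm)
  moreover have "inj_on R.rep (sp_mats n)"
  proof (rule inj_onI)
    fix A B assume AB: "A \<in> sp_mats n" "B \<in> sp_mats n" "R.rep A = R.rep B"
    have "R.rep (A + (- 1) \<cdot>\<^sub>m B) = 0"
      using AB by (simp add: R.rep_add R.rep_scale carrier)
    then have "A + (- 1) \<cdot>\<^sub>m B = 0\<^sub>m (2 * n) (2 * n)"
      using AB by (intro primed_rep_kernel[OF n] sp_mats_add sp_mats_smult)
    then show "A = B"
      using carrier_matD[OF carrier[OF AB(1)]] carrier_matD[OF carrier[OF AB(2)]]
      by (auto simp: mat_eq_iff)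
  qed
  ultimately show ?thesis
    unfolding n_def[symmetric]
    by (intro conjI exI[of _ R.rep])
       (auto simp: bij_betw_def rep_comm R.rep_add R.rep_scale carrier)
qed

end
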